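(* Let $\Omega=(0,1)$, $s\in(1,2)$, $d\in L_\infty(\Omega)$ with $d(x)\ge d_0>0$ for almost all $x\in\Omega$ (for some constant $d_0$), $r\in L_\infty(\Omega)$ and $f\in L_2(\Omega)$. Put $\mu(d):=\tfrac12(\operatorname{ess\,sup}_\Omega d+\operatorname{ess\,inf}_\Omega d)$, $\varrho(d):=\tfrac12(\operatorname{ess\,sup}_\Omega d-\operatorname{ess\,inf}_\Omega d)$, $\underline r:=\operatorname{ess\,inf}_\Omega r$ and $\gamma_{s,d}:=\mu(d)\,|\cos(s\tfrac{\pi}{2})|-\varrho(d)$. Assume $$\gamma_{s,d}\,\tfrac{\Gamma(s/2+1)^2}{4}+\underline r\ \ge\ 0 .$$ For $u,v\in\widetilde H^{s/2}(\Omega)$ let $$a(u,v):=-\big(d\;{}_0\mathcal D_x^{s/2}u,\ {}_x\mathcal D_1^{s/2}v\big)_{L_2(\Omega)}+(r\,u,v)_{L_2(\Omega)} .$$ Then $a$ is coercive, i.e. $$a(u,u)\ \ge\ \alpha_{s,d}\,\|u\|_{\widetilde H^{s/2}(\Omega)}^2\quad\text{for all }u\in\widetilde H^{s/2}(\Omega),\qquad \alpha_{s,d}:=\gamma_{s,d}\,\tfrac{\Gamma(s/2+1)^4}{8}.$$ Moreover, there is a unique $u\in\widetilde H^{s/2}(\Omega)$ such that $a(u,v)=(f,v)_{L_2(\Omega)}$ for all $v\in\widetilde H^{s/2}(\Omega)$, and it satisfies $$\|u\|_{\widetilde H^{s/2}(\Omega)}\le \tfrac1{\alpha_{s,d}}\,\|f\|_{L_2(\Omega)}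 .$$
   Context: All functions are real valued and $\Omega=(0,1)$. For $\sigma\ge 0$, $\widetilde H^\sigma(\Omega)$ is the closure of $C_0^\infty(\Omega)$ in $H^\sigma(\mathbb R)$ (functions identified with their extensions by zero), with norm $\|\varphi\|_{\widetilde H^\sigma(\Omega)}^2=\|\varphi\|_{H^\sigma(\mathbb R)}^2=\int_{\mathbb R}(1+|\omega|^2)^\sigma|\mathcal F\varphi(\omega)|^2\,d\omega$, where $\mathcal F$ is the unitary Fourier transform. For $\sigma\in(0,1)$ and $\varphi\in C_0^\infty(\Omega)$ the left- and right-sided Riemann–Liouville derivatives are $${}_0\mathcal D_x^{\sigma}\varphi(x)=\frac{d}{dx}\,\frac1{\Gamma(1-\sigma)}\int_0^x(x-t)^{-\sigma}\varphi(t)\,dt,\qquad {}_x\mathcal D_1^{\sigma}\varphi(x)=-\frac{d}{dx}\,\frac1{\Gamma(1-\sigma)}\int_x^1(t-x)^{-\sigma}\varphi(t)\,dt .$$ Both extend to bounded linear operators $\widetilde H^\sigma(\Omega)\to L_2(\Omega)$, and these extensions are denoted by the same symbols.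
   Formalization: The formal theorem additionally assumes γ_{s,d} > 0; without it the claim fails: if γ_{s,d} < 0 (d non-constant, s near 1, r a large constant), then α_{s,d} < 0 and the bound on ‖u‖ is impossible for f ≠ 0, and if γ_{s,d} = 0, then 1/α_{s,d} is undefined. *)

theory Defs
  imports "HOL-Analysis.Analysis" "HOL-Probability.Essential_Supremum"
begin

text \<open>
  Elements of Lebesgue and Sobolev spaces are represented by Borel measurable functions, and
  equality in these spaces is equality almost everywhere. A function on the unit interval is a
  function on the reals of which only the values on the unit interval matter; elements of
  \<open>Htilde\<close> live on the whole real line (extension by zero).
\<close>

abbreviation Om :: "real measure" where
  "Om \<equiv> restrict_space lborel {0<..<1}"

definition L2 :: "'a measure \<Rightarrow> ('a \<Rightarrow> 'b::real_normed_vector) set" where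
  "L2 M = {f. f \<in> borel_measurable M \<and> integrable M (\<lambda>x. (norm (f x))\<^sup>2)}"

definition L2_norm :: "'a measure \<Rightarrow> ('a \<Rightarrow> 'b::real_normed_vector) \<Rightarrow> real" where
  "L2_norm M f = sqrt (\<integral>x. (norm (f x))\<^sup>2 \<partial>M)"

definition L2_inner :: "'a measure \<Rightarrow> ('a \<Rightarrow> real) \<Rightarrow> ('a \<Rightarrow> real) \<Rightarrow> real" where
  "L2_inner M f g = (\<integral>x. f x * g x \<partial>M)"

text \<open>
  The first conjunct is needed because the Bochner integral of a non-integrable function is 0.
\<close>

definition L2_tendsto ::
  "'a measure \<Rightarrow> (nat \<Rightarrow> 'a \<Rightarrow> 'b::real_normed_vector) \<Rightarrow> ('a \<Rightarrow> 'b) \<Rightarrow> bool" where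
  "L2_tendsto M f g \<longleftrightarrow> (\<forall>n. (\<lambda>x. f n x - g x) \<in> L2 M) \<and>
     (\<lambda>n. L2_norm M (\<lambda>x. f n x - g x)) \<longlonglongrightarrow> 0"

definition L_infty :: "'a measure \<Rightarrow> ('a \<Rightarrow> real) set" where
  "L_infty M = {f. f \<in> borel_measurable M \<and> (\<exists>C. AE x in M. \<bar>f x\<bar> \<le> C)}"

text \<open>
  \<^const>\<open>esssup\<close> needs a complete linear order as codomain, hence the detour via \<^typ>\<open>ereal\<close>.
\<close>

definition ess_sup :: "'a measure \<Rightarrow> ('a \<Rightarrow> real) \<Rightarrow> real" where
  "ess_sup M f = real_of_ereal (esssup M (\<lambda>x. ereal (f x)))"

text \<open>
  The dual of the definition of \<^const>\<open>esssup\<close> (only applied to measurable functions).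
\<close>

definition ess_inf :: "'a measure \<Rightarrow> ('a \<Rightarrow> real) \<Rightarrow> real" where
  "ess_inf M f = real_of_ereal (Liminf (ae_filter M) (\<lambda>x. ereal (f x)))"

text \<open>
  The unitary Fourier transform on \<open>L2(\<real>)\<close>: the limit in \<open>L2(\<real>)\<close> of the Fourier integrals over
  \<open>{-n..n}\<close>. It is determined up to null sets, and \<open>fourier f\<close> is some representative.
\<close>

definition truncated_fourier :: "(real \<Rightarrow> real) \<Rightarrow> nat \<Rightarrow> real \<Rightarrow> complex" where
  "truncated_fourier f n \<omega> =
     complex_of_real (1 / sqrt (2 * pi)) *
       (LINT x:{- real n..real n}|lborel. complex_of_real (f x) * cis (- (\<omega> * x)))"

definition has_fourier :: "(real \<Rightarrow> real) \<Rightarrow> (real \<Rightarrow> complex) \<Rightarrow> bool" where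
  "has_fourier f F \<longleftrightarrow> F \<in> L2 lborel \<and> L2_tendsto lborel (truncated_fourier f) F"

definition fourier :: "(real \<Rightarrow> real) \<Rightarrow> real \<Rightarrow> complex" where
  "fourier f = (SOME F. has_fourier f F)"

text \<open>
  By Plancherel's theorem the condition \<open>\<exists>F. has_fourier u F\<close> holds for every \<open>u\<close> in \<open>L2(\<real>)\<close>;
  it is included so that \<open>fourier u\<close> is meaningful independently of that theorem.
\<close>

definition Hs :: "real \<Rightarrow> (real \<Rightarrow> real) set" where
  "Hs \<sigma> = {u \<in> L2 lborel. (\<exists>F. has_fourier u F) \<and>
     integrable lborel (\<lambda>\<omega>. (1 + \<bar>\<omega>\<bar>\<^sup>2) powr \<sigma> * (norm (fourier u \<omega>))\<^sup>2)}"

definition Hs_norm :: "real \<Rightarrow> (real \<Rightarrow> real) \<Rightarrow> real" where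
  "Hs_norm \<sigma> u = sqrt (\<integral>\<omega>. (1 + \<bar>\<omega>\<bar>\<^sup>2) powr \<sigma> * (norm (fourier u \<omega>))\<^sup>2 \<partial>lborel)"

definition test_functions :: "(real \<Rightarrow> real) set" where
  "test_functions = {\<phi>. (\<forall>k x. ((deriv ^^ k) \<phi>) differentiable (at x)) \<and>
     compact (closure {x. \<phi> x \<noteq> 0}) \<and> closure {x. \<phi> x \<noteq> 0} \<subseteq> {0<..<1}}"

definition Htilde :: "real \<Rightarrow> (real \<Rightarrow> real) set" where
  "Htilde \<sigma> = {u \<in> Hs \<sigma>. \<forall>e>0. \<exists>\<phi>\<in>test_functions. Hs_norm \<sigma> (\<lambda>x. \<phi> x - u x) < e}"

definition RL_left :: "real \<Rightarrow> (real \<Rightarrow> real) \<Rightarrow> real \<Rightarrow> real" where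
  "RL_left \<sigma> \<phi> x =
     deriv (\<lambda>y. 1 / Gamma (1 - \<sigma>) * (LINT t:{0..y}|lborel. (y - t) powr (- \<sigma>) * \<phi> t)) x"

definition RL_right :: "real \<Rightarrow> (real \<Rightarrow> real) \<Rightarrow> real \<Rightarrow> real" where
  "RL_right \<sigma> \<phi> x =
     - deriv (\<lambda>y. 1 / Gamma (1 - \<sigma>) * (LINT t:{y..1}|lborel. (t - y) powr (- \<sigma>) * \<phi> t)) x"

text \<open>
  The continuous extension to \<open>Htilde \<sigma>\<close> of an operator \<open>D\<close> given on test functions: \<open>D\<close> is
  bounded from the norm of \<open>Htilde \<sigma>\<close> to \<open>L2(0,1)\<close>, so the value of the extension at \<open>u\<close> is the
  \<open>L2\<close>-limit of \<open>D \<phi>\<^sub>n\<close> along any sequence of test functions \<open>\<phi>\<^sub>n\<close> converging to \<open>u\<close>; it is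
  determined up to null sets.
\<close>

definition has_extension ::
  "((real \<Rightarrow> real) \<Rightarrow> real \<Rightarrow> real) \<Rightarrow> real \<Rightarrow> (real \<Rightarrow> real) \<Rightarrow> (real \<Rightarrow> real) \<Rightarrow> bool" where
  "has_extension D \<sigma> u g \<longleftrightarrow> g \<in> L2 Om \<and>
     (\<forall>\<phi>. (\<forall>n. \<phi> n \<in> test_functions) \<and> (\<lambda>n. Hs_norm \<sigma> (\<lambda>x. \<phi> n x - u x)) \<longlonglongrightarrow> 0
        \<longrightarrow> L2_tendsto Om (\<lambda>n. D (\<phi> n)) g)"

definition D_left :: "real \<Rightarrow> (real \<Rightarrow> real) \<Rightarrow> real \<Rightarrow> real" where
  "D_left \<sigma> u = (SOME g. has_extension (RL_left \<sigma>) \<sigma> u g)"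

definition D_right :: "real \<Rightarrow> (real \<Rightarrow> real) \<Rightarrow> real \<Rightarrow> real" where
  "D_right \<sigma> u = (SOME g. has_extension (RL_right \<sigma>) \<sigma> u g)"

definition mu :: "(real \<Rightarrow> real) \<Rightarrow> real" where
  "mu d = (ess_sup Om d + ess_inf Om d) / 2"

definition rho :: "(real \<Rightarrow> real) \<Rightarrow> real" where
  "rho d = (ess_sup Om d - ess_inf Om d) / 2"

definition gamma_coeff :: "real \<Rightarrow> (real \<Rightarrow> real) \<Rightarrow> real" where
  "gamma_coeff s d = mu d * \<bar>cos (s * (pi / 2))\<bar> - rho d"

definition alpha_coeff :: "real \<Rightarrow> (real \<Rightarrow> real) \<Rightarrow> real" where
  "alpha_coeff s d = gamma_coeff s d * (Gamma (s / 2 + 1) ^ 4 / 8)"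

definition bilinear_a ::
  "real \<Rightarrow> (real \<Rightarrow> real) \<Rightarrow> (real \<Rightarrow> real) \<Rightarrow> (real \<Rightarrow> real) \<Rightarrow> (real \<Rightarrow> real) \<Rightarrow> real" where
  "bilinear_a s d r u v =
     - L2_inner Om (\<lambda>x. d x * D_left (s / 2) u x) (D_right (s / 2) v)
     + L2_inner Om (\<lambda>x. r x * u x) v"

end

(* The Riemann-Liouville derivatives of order \<sigma> = s/2 have the Fourier symbols (i\<omega>)^\<sigma> and
   (-i\<omega>)^\<sigma>.  With E(u) the integral of |\<omega>|^(2\<sigma>) |Fu|^2, Plancherel's theorem bounds both
   derivatives of u in L2(0,1) by sqrt (E(u)) and shows that their inner product is cos(s pi/2) E(u):
   the left derivative vanishes left of 0 and the right one right of 1, so the inner product over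
   the unit interval is the one over the line.  Splitting d = mu(d) + (d - mu(d)) with
   |d - mu(d)| \<le> rho(d) gives a(u,u) \<ge> gamma E(u) + ess_inf r ||u||^2, and a Poincare inequality
   between ||u||^2 and E(u) yields coercivity; existence is the Lax-Milgram theorem.

   The kernel z^(-\<sigma>) of the fractional integral is not integrable on the half-line.  It is
   therefore multiplied by exp(-\<epsilon> z), which turns the symbol into (\<epsilon> + i\<omega>)^(\<sigma>-1) i\<omega>, and \<epsilon>
   tends to 0 at the end. *)

theory Submission
  imports Defs "HOL-Probability.Characteristic_Functions" "HOL-Real_Asymp.Real_Asymp"
begin

text \<open>The cosine has a pointwise origin: the left symbol times the conjugate of the right one
  is (i \<omega>)^(2 \<sigma>), whose real part is cos (pi \<sigma>) |\<omega>|^(2 \<sigma>) for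
  either sign of \<omega>. The damped kernels are still one-sided, so the cut to the unit interval
  is harmless for every positive damping, and only numbers pass to the limit: by bounded convergence
  on the interval and by dominated convergence of the symbols on the frequency side. The damped
  symbol is found from a differential equation in \<omega>. Plancherel's theorem comes from the
  continuity at 0 of the autocorrelation, averaged against Gaussians. \<open>D_left\<close> and
  \<open>D_right\<close> are chosen up to null sets, so linearity holds almost everywhere and the
  Hilbert space arguments are made for a semidefinite form. The Gamma values enter the comparison of
  constants through \<open>Gamma (\<sigma> + 1)\<close> being at most 1; this is so generous that a
  Poincare constant above 2/3 suffices.\<close>

section \<open>Square integrable functions\<close>

text \<open>With \<open>inner\<close> on the complex numbers this is the real part of the Hermitian
  product, so one set of lemmas serves real functions and their complex transforms.\<close>

definition L2_ip :: "'a measure \<Rightarrow> ('a \<Rightarrow> 'b::real_inner) \<Rightarrow> ('a \<Rightarrow> 'b) \<Rightarrow> real" where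
  "L2_ip M f g = (\<integral>x. inner (f x) (g x) \<partial>M)"

lemma L2_inner_eq_ip: "L2_inner M f g = L2_ip M f g"
  by (simp add: L2_inner_def L2_ip_def)

lemma L2_measurable: "f \<in> L2 M \<Longrightarrow> f \<in> borel_measurable M"
  by (simp add: L2_def)

lemma L2_integrable: "f \<in> L2 M \<Longrightarrow> integrable M (\<lambda>x. (norm (f x))\<^sup>2)"
  by (simp add: L2_def)

lemma L2_norm_nonneg [simp]: "0 \<le> L2_norm M f"
  by (simp add: L2_norm_def)

lemma L2_norm_sq: "(L2_norm M f)\<^sup>2 = (\<integral>x. (norm (f x))\<^sup>2 \<partial>M)"
  by (simp add: L2_norm_def)

lemma L2_norm_le_iff: "0 \<le> c \<Longrightarrow> L2_norm M f \<le> c \<longleftrightarrow> (\<integral>x. (norm (f x))\<^sup>2 \<partial>M) \<le> c\<^sup>2"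
  unfolding L2_norm_sq[symmetric] by (simp add: power_mono_iff)

lemma L2_ip_self: "L2_ip M f f = (L2_norm M f)\<^sup>2"
  by (simp add: L2_ip_def L2_norm_sq power2_norm_eq_inner)

lemma L2_bound:
  fixes f :: "'a \<Rightarrow> 'b::{second_countable_topology, banach}" and g :: "'a \<Rightarrow> 'c::{second_countable_topology, banach}"
  assumes "g \<in> L2 M" "f \<in> borel_measurable M" "AE x in M. norm (f x) \<le> c * norm (g x)"
  shows "f \<in> L2 M"
  unfolding L2_def
proof (intro CollectI conjI assms)
  show "integrable M (\<lambda>x. (norm (f x))\<^sup>2)"
  proof (rule Bochner_Integration.integrable_bound)
    show "integrable M (\<lambda>x. c\<^sup>2 * (norm (g x))\<^sup>2)"
      using L2_integrable[OF assms(1)] by simp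
    show "(\<lambda>x. (norm (f x))\<^sup>2) \<in> borel_measurable M"
      using assms(2) by measurable
    show "AE x in M. norm ((norm (f x))\<^sup>2) \<le> norm (c\<^sup>2 * (norm (g x))\<^sup>2)"
      using assms(3)
    proof eventually_elim
      fix x assume "norm (f x) \<le> c * norm (g x)"
      then have "(norm (f x))\<^sup>2 \<le> (c * norm (g x))\<^sup>2" by (rule power_mono) simp
      then show "norm ((norm (f x))\<^sup>2) \<le> norm (c\<^sup>2 * (norm (g x))\<^sup>2)"
        by (simp add: power_mult_distrib)
    qed
  qed
qed

lemma L2_scale:
  fixes f :: "'a \<Rightarrow> 'b::{second_countable_topology, banach}"
  assumes "f \<in> L2 M" shows "(\<lambda>x. c *\<^sub>R f x) \<in> L2 M"
proof (rule L2_bound[OF assms, where c = "\<bar>c\<bar>"])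
  show "(\<lambda>x. c *\<^sub>R f x) \<in> borel_measurable M" using L2_measurable[OF assms] by measurable
qed simp

lemma L2_mult_integrable:
  fixes f :: "'a \<Rightarrow> 'b::{second_countable_topology, banach}" and g :: "'a \<Rightarrow> 'c::{second_countable_topology, banach}"
  assumes "f \<in> L2 M" "g \<in> L2 M"
  shows "integrable M (\<lambda>x. norm (f x) * norm (g x))"
proof (rule Bochner_Integration.integrable_bound)
  show "integrable M (\<lambda>x. (norm (f x))\<^sup>2 + (norm (g x))\<^sup>2)"
    using assms[THEN L2_integrable] by simp
  show "(\<lambda>x. norm (f x) * norm (g x)) \<in> borel_measurable M"
    using assms[THEN L2_measurable] by measurable
  have "a * b \<le> a\<^sup>2 + b\<^sup>2" if "0 \<le> a" "0 \<le> b" for a b :: real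
    using sum_squares_bound[of a b] mult_nonneg_nonneg[OF that] by simp
  then show "AE x in M. norm (norm (f x) * norm (g x)) \<le> norm ((norm (f x))\<^sup>2 + (norm (g x))\<^sup>2)"
    by simp
qed

lemma L2_norm_mult_le:
  fixes f :: "'a \<Rightarrow> 'b::{second_countable_topology, banach}" and g :: "'a \<Rightarrow> 'c::{second_countable_topology, banach}"
  assumes "f \<in> L2 M" "g \<in> L2 M"
  shows "(\<integral>x. norm (f x) * norm (g x) \<partial>M) \<le> L2_norm M f * L2_norm M g"
proof -
  let ?I = "\<integral>x. norm (f x) * norm (g x) \<partial>M"
  have m: "(\<lambda>x. norm (f x)) \<in> borel_measurable M" "(\<lambda>x. norm (g x)) \<in> borel_measurable M"
    using assms[THEN L2_measurable] by measurable
  have "(ennreal ?I)\<^sup>2 = (\<integral>\<^sup>+x. ennreal (norm (f x)) * ennreal (norm (g x)) \<partial>M)\<^sup>2"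
    using L2_mult_integrable[OF assms] by (simp add: nn_integral_eq_integral ennreal_mult'[symmetric])
  also have "\<dots> \<le> (\<integral>\<^sup>+x. (ennreal (norm (f x)))\<^sup>2 \<partial>M) * (\<integral>\<^sup>+x. (ennreal (norm (g x)))\<^sup>2 \<partial>M)"
    by (rule Cauchy_Schwarz_nn_integral) (use m in measurable)
  also have "\<dots> = ennreal ((L2_norm M f)\<^sup>2) * ennreal ((L2_norm M g)\<^sup>2)"
    using assms[THEN L2_integrable] by (simp add: nn_integral_eq_integral ennreal_power L2_norm_sq)
  also have "\<dots> = (ennreal (L2_norm M f * L2_norm M g))\<^sup>2"
    by (simp add: ennreal_mult'[symmetric] ennreal_power power_mult_distrib)
  finally have "?I\<^sup>2 \<le> (L2_norm M f * L2_norm M g)\<^sup>2"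
    by (simp add: ennreal_power integral_nonneg_AE)
  then show ?thesis by (rule power2_le_imp_le) simp
qed

lemma L2_ip_integrable:
  fixes f :: "'a \<Rightarrow> 'b::{second_countable_topology, banach, real_inner}"
  assumes "f \<in> L2 M" "g \<in> L2 M"
  shows "integrable M (\<lambda>x. inner (f x) (g x))"
proof (rule Bochner_Integration.integrable_bound[OF L2_mult_integrable[OF assms]])
  show "(\<lambda>x. inner (f x) (g x)) \<in> borel_measurable M"
    using assms[THEN L2_measurable] by measurable
qed (simp add: Cauchy_Schwarz_ineq2)

lemma L2_Cauchy_Schwarz:
  fixes f :: "'a \<Rightarrow> 'b::{second_countable_topology, banach, real_inner}"
  assumes "f \<in> L2 M" "g \<in> L2 M"
  shows "\<bar>L2_ip M f g\<bar> \<le> L2_norm M f * L2_norm M g"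
proof -
  have "\<bar>L2_ip M f g\<bar> \<le> (\<integral>x. norm (f x) * norm (g x) \<partial>M)"
    unfolding L2_ip_def
  proof (rule order_trans[OF integral_abs_bound], rule integral_mono)
    show "integrable M (\<lambda>x. \<bar>inner (f x) (g x)\<bar>)"
      by (rule integrable_abs[OF L2_ip_integrable[OF assms]])
  qed (rule L2_mult_integrable[OF assms], rule Cauchy_Schwarz_ineq2)
  also have "\<dots> \<le> L2_norm M f * L2_norm M g" by (rule L2_norm_mult_le[OF assms])
  finally show ?thesis .
qed

lemma L2_add:
  fixes f :: "'a \<Rightarrow> 'b::{second_countable_topology, banach}"
  assumes "f \<in> L2 M" "g \<in> L2 M"
  shows "(\<lambda>x. f x + g x) \<in> L2 M"
proof -
  have m: "(\<lambda>x. f x + g x) \<in> borel_measurable M"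
    using assms[THEN L2_measurable] by measurable
  have "integrable M (\<lambda>x. (norm (f x))\<^sup>2 + 2 * (norm (f x) * norm (g x)) + (norm (g x))\<^sup>2)"
    using assms[THEN L2_integrable] L2_mult_integrable[OF assms] by simp
  then have "integrable M (\<lambda>x. (norm (f x + g x))\<^sup>2)"
  proof (rule Bochner_Integration.integrable_bound)
    show "(\<lambda>x. (norm (f x + g x))\<^sup>2) \<in> borel_measurable M" using m by measurable
    have "(norm (f x + g x))\<^sup>2 \<le> (norm (f x) + norm (g x))\<^sup>2" for x
      by (intro power_mono norm_triangle_ineq) simp
    then show "AE x in M. norm ((norm (f x + g x))\<^sup>2) \<le> norm ((norm (f x))\<^sup>2 + 2 * (norm (f x) * norm (g x)) + (norm (g x))\<^sup>2)"
      by (simp add: power2_sum algebra_simps)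
  qed
  with m show ?thesis by (simp add: L2_def)
qed

lemma L2_norm_triangle:
  fixes f :: "'a \<Rightarrow> 'b::{second_countable_topology, banach}"
  assumes "f \<in> L2 M" "g \<in> L2 M"
  shows "L2_norm M (\<lambda>x. f x + g x) \<le> L2_norm M f + L2_norm M g"
proof (subst L2_norm_le_iff)
  have "(\<integral>x. (norm (f x + g x))\<^sup>2 \<partial>M) \<le> (\<integral>x. (norm (f x))\<^sup>2 + 2 * (norm (f x) * norm (g x)) + (norm (g x))\<^sup>2 \<partial>M)"
  proof (rule integral_mono)
    show "integrable M (\<lambda>x. (norm (f x + g x))\<^sup>2)" using L2_add[OF assms] L2_integrable by blast
    show "integrable M (\<lambda>x. (norm (f x))\<^sup>2 + 2 * (norm (f x) * norm (g x)) + (norm (g x))\<^sup>2)"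
      using assms[THEN L2_integrable] L2_mult_integrable[OF assms] by simp
    have "(norm (f x + g x))\<^sup>2 \<le> (norm (f x) + norm (g x))\<^sup>2" for x
      by (intro power_mono norm_triangle_ineq) simp
    then show "(norm (f x + g x))\<^sup>2 \<le> (norm (f x))\<^sup>2 + 2 * (norm (f x) * norm (g x)) + (norm (g x))\<^sup>2" for x
      by (simp add: power2_sum algebra_simps)
  qed
  also have "\<dots> = (L2_norm M f)\<^sup>2 + 2 * (\<integral>x. norm (f x) * norm (g x) \<partial>M) + (L2_norm M g)\<^sup>2"
    using assms[THEN L2_integrable] L2_mult_integrable[OF assms] by (simp add: L2_norm_sq)
  also have "\<dots> \<le> (L2_norm M f + L2_norm M g)\<^sup>2"
    using L2_norm_mult_le[OF assms] by (simp add: power2_sum)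
  finally show "(\<integral>x. (norm (f x + g x))\<^sup>2 \<partial>M) \<le> (L2_norm M f + L2_norm M g)\<^sup>2" .
qed simp

lemma L2_norm_scale: "L2_norm M (\<lambda>x. c *\<^sub>R f x) = \<bar>c\<bar> * L2_norm M f"
  by (simp add: L2_norm_def power_mult_distrib real_sqrt_mult)

lemma L2_norm_minus_commute: "L2_norm M (\<lambda>x. f x - g x) = L2_norm M (\<lambda>x. g x - f x)"
  by (simp add: L2_norm_def norm_minus_commute)

lemma L2_comb:
  fixes f :: "'a \<Rightarrow> 'b::{second_countable_topology, banach}"
  assumes "f \<in> L2 M" "g \<in> L2 M"
  shows "(\<lambda>x. f x + c *\<^sub>R g x) \<in> L2 M"
  by (intro L2_add L2_scale assms)

lemma L2_diff:
  fixes f :: "'a \<Rightarrow> 'b::{second_countable_topology, banach}"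
  assumes "f \<in> L2 M" "g \<in> L2 M"
  shows "(\<lambda>x. f x - g x) \<in> L2 M"
  using L2_comb[OF assms, of "-1"] by simp

lemma L2_norm_diff_triangle:
  fixes f :: "'a \<Rightarrow> 'b::{second_countable_topology, banach}"
  assumes "f \<in> L2 M" "g \<in> L2 M" "h \<in> L2 M"
  shows "L2_norm M (\<lambda>x. f x - h x) \<le> L2_norm M (\<lambda>x. f x - g x) + L2_norm M (\<lambda>x. g x - h x)"
  using L2_norm_triangle[OF L2_diff[OF assms(1,2)] L2_diff[OF assms(2,3)]] by simp

lemma L2_norm_diff_abs_le:
  fixes f :: "'a \<Rightarrow> 'b::{second_countable_topology, banach}"
  assumes "f \<in> L2 M" "g \<in> L2 M"
  shows "\<bar>L2_norm M f - L2_norm M g\<bar> \<le> L2_norm M (\<lambda>x. f x - g x)"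
  using L2_norm_triangle[OF L2_diff[OF assms] assms(2)] L2_norm_triangle[OF L2_diff[OF assms(2,1)] assms(1)]
  by (simp add: L2_norm_minus_commute[of M g f])

lemma L2_norm_cong_AE:
  fixes f g :: "'a \<Rightarrow> 'b::{second_countable_topology, banach}"
  assumes "f \<in> borel_measurable M" "g \<in> borel_measurable M" "AE x in M. f x = g x"
  shows "L2_norm M f = L2_norm M g"
proof -
  have "(\<integral>x. (norm (f x))\<^sup>2 \<partial>M) = (\<integral>x. (norm (g x))\<^sup>2 \<partial>M)"
    by (rule integral_cong_AE) (use assms in auto)
  then show ?thesis by (simp add: L2_norm_def)
qed

lemma L2_cong_AE:
  fixes f g :: "'a \<Rightarrow> 'b::{second_countable_topology, banach}"
  assumes "f \<in> L2 M" "g \<in> borel_measurable M" "AE x in M. f x = g x"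
  shows "g \<in> L2 M"
  by (rule L2_bound[OF assms(1,2), of 1]) (use assms(3) in auto)

lemma L2_norm_zero_AE:
  fixes f :: "'a \<Rightarrow> 'b::{second_countable_topology, banach}"
  assumes "f \<in> L2 M" "L2_norm M f = 0"
  shows "AE x in M. f x = 0"
proof -
  have "(\<integral>x. (norm (f x))\<^sup>2 \<partial>M) = 0" using assms(2) by (simp add: L2_norm_def)
  then have "AE x in M. (norm (f x))\<^sup>2 = 0"
    using integral_nonneg_eq_0_iff_AE[OF L2_integrable[OF assms(1)]] by simp
  then show ?thesis by simp
qed

lemma L2_ip_comb_left:
  fixes f :: "'a \<Rightarrow> 'b::{second_countable_topology, banach, real_inner}"
  assumes "f \<in> L2 M" "g \<in> L2 M" "h \<in> L2 M"
  shows "L2_ip M (\<lambda>x. f x + c *\<^sub>R g x) h = L2_ip M f h + c * L2_ip M g h"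
  using assms by (simp add: L2_ip_def inner_add_left L2_ip_integrable)

lemma L2_ip_commute: "L2_ip M f g = L2_ip M g f"
  by (simp add: L2_ip_def inner_commute)

lemma L2_ip_cong_AE:
  fixes f g f' g' :: "'a \<Rightarrow> 'b::{second_countable_topology, banach, real_inner}"
  assumes [measurable]: "f \<in> borel_measurable M" "g \<in> borel_measurable M" "f' \<in> borel_measurable M" "g' \<in> borel_measurable M"
    and "AE x in M. f x = f' x" "AE x in M. g x = g' x"
  shows "L2_ip M f g = L2_ip M f' g'"
  unfolding L2_ip_def by (rule integral_cong_AE) (use assms in auto)

lemma L2_tendsto_unique:
  fixes g h :: "'a \<Rightarrow> 'b::{second_countable_topology, banach}"
  assumes "L2_tendsto M f g" "L2_tendsto M f h"
  shows "AE x in M. g x = h x"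
proof -
  have d: "(\<lambda>x. f n x - g x) \<in> L2 M" "(\<lambda>x. f n x - h x) \<in> L2 M" for n
    using assms by (auto simp: L2_tendsto_def)
  \<comment> \<open>\<open>g\<close> and \<open>h\<close> themselves need not be square integrable:
    \<open>L2_tendsto\<close> speaks only of their differences from \<open>f n\<close>.\<close>
  have gh: "(\<lambda>x. g x - h x) \<in> L2 M" using L2_diff[OF d(2)[of 0] d(1)[of 0]] by simp
  have le: "L2_norm M (\<lambda>x. g x - h x) \<le> L2_norm M (\<lambda>x. f n x - h x) + L2_norm M (\<lambda>x. f n x - g x)" for n
    using L2_norm_triangle[OF d(2)[of n] L2_scale[OF d(1)[of n], of "-1"]]
      L2_norm_scale[of M "-1" "\<lambda>x. f n x - g x"] by simp
  have "(\<lambda>n. L2_norm M (\<lambda>x. f n x - h x) + L2_norm M (\<lambda>x. f n x - g x)) \<longlonglongrightarrow> 0 + 0"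
    using assms by (intro tendsto_add) (auto simp: L2_tendsto_def)
  then have "L2_norm M (\<lambda>x. g x - h x) \<le> 0 + 0"
    by (rule LIMSEQ_le_const) (use le in auto)
  then have "L2_norm M (\<lambda>x. g x - h x) = 0" by (simp add: order_antisym)
  from L2_norm_zero_AE[OF gh this] show ?thesis by simp
qed

lemma L2_tendsto_comb:
  fixes g h :: "'a \<Rightarrow> 'b::{second_countable_topology, banach}"
  assumes "L2_tendsto M f g" "L2_tendsto M f' g'"
  shows "L2_tendsto M (\<lambda>n x. f n x + c *\<^sub>R f' n x) (\<lambda>x. g x + c *\<^sub>R g' x)"
proof -
  have d: "(\<lambda>x. f n x - g x) \<in> L2 M" "(\<lambda>x. f' n x - g' x) \<in> L2 M" for n
    using assms by (auto simp: L2_tendsto_def)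
  have eq: "f n x + c *\<^sub>R f' n x - (g x + c *\<^sub>R g' x) = (f n x - g x) + c *\<^sub>R (f' n x - g' x)" for n x
    by (simp add: algebra_simps)
  have lim: "(\<lambda>n. L2_norm M (\<lambda>x. f n x - g x) + \<bar>c\<bar> * L2_norm M (\<lambda>x. f' n x - g' x)) \<longlonglongrightarrow> 0 + \<bar>c\<bar> * 0"
    using assms by (intro tendsto_intros) (auto simp: L2_tendsto_def)
  have "(\<lambda>n. L2_norm M (\<lambda>x. (f n x - g x) + c *\<^sub>R (f' n x - g' x))) \<longlonglongrightarrow> 0"
  proof (rule tendsto_sandwich[OF _ _ tendsto_const])
    show "\<forall>\<^sub>F n in sequentially. L2_norm M (\<lambda>x. (f n x - g x) + c *\<^sub>R (f' n x - g' x)) \<le> 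
      L2_norm M (\<lambda>x. f n x - g x) + \<bar>c\<bar> * L2_norm M (\<lambda>x. f' n x - g' x)"
      using L2_norm_triangle[OF d(1) L2_scale[OF d(2)]] by (auto simp only: L2_norm_scale eventually_sequentially)
  qed (use lim in auto)
  then show ?thesis
    unfolding L2_tendsto_def eq using L2_comb[OF d] by simp
qed

lemma L2_tendsto_norm:
  fixes g :: "'a \<Rightarrow> 'b::{second_countable_topology, banach}"
  assumes "L2_tendsto M f g" "\<And>n. f n \<in> L2 M" "g \<in> L2 M"
  shows "(\<lambda>n. L2_norm M (f n)) \<longlonglongrightarrow> L2_norm M g"
proof (rule LIM_zero_cancel, rule Lim_null_comparison)
  show "(\<lambda>n. L2_norm M (\<lambda>x. f n x - g x)) \<longlonglongrightarrow> 0" using assms(1) by (simp add: L2_tendsto_def)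
  show "\<forall>\<^sub>F n in sequentially. norm (L2_norm M (f n) - L2_norm M g) \<le> L2_norm M (\<lambda>x. f n x - g x)"
    using L2_norm_diff_abs_le[OF assms(2,3)] by auto
qed

lemma L2_tendsto_ip:
  fixes g :: "'a \<Rightarrow> 'b::{second_countable_topology, banach, real_inner}"
  assumes "L2_tendsto M f g" "\<And>n. f n \<in> L2 M" "g \<in> L2 M"
    and "L2_tendsto M f' g'" "\<And>n. f' n \<in> L2 M" "g' \<in> L2 M"
  shows "(\<lambda>n. L2_ip M (f n) (f' n)) \<longlonglongrightarrow> L2_ip M g g'"
proof (rule LIM_zero_cancel, rule Lim_null_comparison)
  let ?a = "\<lambda>n. L2_norm M (\<lambda>x. f n x - g x)" and ?b = "\<lambda>n. L2_norm M (\<lambda>x. f' n x - g' x)"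
  have "(\<lambda>n. ?a n * L2_norm M (f' n) + ?b n * L2_norm M g) \<longlonglongrightarrow> 0 * L2_norm M g' + 0 * L2_norm M g"
    using assms(1,4) L2_tendsto_norm[OF assms(4-6)]
    by (intro tendsto_intros) (auto simp: L2_tendsto_def)
  then show "(\<lambda>n. ?a n * L2_norm M (f' n) + ?b n * L2_norm M g) \<longlonglongrightarrow> 0" by simp
  have "\<bar>L2_ip M (f n) (f' n) - L2_ip M g g'\<bar> \<le> ?a n * L2_norm M (f' n) + ?b n * L2_norm M g" for n
  proof -
    have "L2_ip M (f n) (f' n) - L2_ip M g g' = L2_ip M (\<lambda>x. f n x - g x) (f' n) + L2_ip M (\<lambda>x. f' n x - g' x) g"
      using L2_ip_comb_left[OF assms(2)[of n] assms(3) assms(5)[of n], of "-1"]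
        L2_ip_comb_left[OF assms(5)[of n] assms(6) assms(3), of "-1"]
      by (simp add: L2_ip_commute)
    then show ?thesis
      using L2_Cauchy_Schwarz[OF L2_diff[OF assms(2)[of n] assms(3)] assms(5)[of n]]
        L2_Cauchy_Schwarz[OF L2_diff[OF assms(5)[of n] assms(6)] assms(3)] by linarith
  qed
  then show "\<forall>\<^sub>F n in sequentially. norm (L2_ip M (f n) (f' n) - L2_ip M g g') \<le> ?a n * L2_norm M (f' n) + ?b n * L2_norm M g"
    by simp
qed

section \<open>Almost everywhere limits and completeness of L2\<close>

lemma L2_Fatou:
  fixes f :: "nat \<Rightarrow> 'a \<Rightarrow> 'b::{second_countable_topology, banach}"
  assumes "\<And>n. f n \<in> L2 M" "\<And>n. L2_norm M (f n) \<le> c" 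
    and [measurable]: "g \<in> borel_measurable M" and "AE x in M. (\<lambda>n. f n x) \<longlonglongrightarrow> g x"
  shows "g \<in> L2 M \<and> L2_norm M g \<le> c"
proof -
  have c0: "0 \<le> c" using assms(2)[of 0] L2_norm_nonneg order_trans by blast
  have [measurable]: "f n \<in> borel_measurable M" for n using assms(1) L2_measurable by blast
  have "(\<integral>\<^sup>+x. ennreal ((norm (g x))\<^sup>2) \<partial>M) = (\<integral>\<^sup>+x. liminf (\<lambda>n. ennreal ((norm (f n x))\<^sup>2)) \<partial>M)"
  proof (rule nn_integral_cong_AE, use assms(4) in eventually_elim)
    fix x assume "(\<lambda>n. f n x) \<longlonglongrightarrow> g x"
    then have "(\<lambda>n. ennreal ((norm (f n x))\<^sup>2)) \<longlonglongrightarrow> ennreal ((norm (g x))\<^sup>2)"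
      by (intro tendsto_intros tendsto_ennrealI)
    then show "ennreal ((norm (g x))\<^sup>2) = liminf (\<lambda>n. ennreal ((norm (f n x))\<^sup>2))"
      by (intro lim_imp_Liminf[symmetric]) auto
  qed
  also have "\<dots> \<le> liminf (\<lambda>n. \<integral>\<^sup>+x. ennreal ((norm (f n x))\<^sup>2) \<partial>M)"
    by (rule nn_integral_liminf) measurable
  also have "\<dots> \<le> ennreal (c\<^sup>2)"
  proof -
    have "(\<integral>\<^sup>+x. ennreal ((norm (f n x))\<^sup>2) \<partial>M) \<le> ennreal (c\<^sup>2)" for n
    proof -
      have "(\<integral>\<^sup>+x. ennreal ((norm (f n x))\<^sup>2) \<partial>M) = ennreal ((L2_norm M (f n))\<^sup>2)"
        using L2_integrable[OF assms(1)[of n]] by (simp add: nn_integral_eq_integral L2_norm_sq)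
      also have "\<dots> \<le> ennreal (c\<^sup>2)"
        using assms(2)[of n] by (intro ennreal_leI power_mono) auto
      finally show ?thesis .
    qed
    then have "liminf (\<lambda>n. \<integral>\<^sup>+x. ennreal ((norm (f n x))\<^sup>2) \<partial>M) \<le> liminf (\<lambda>n::nat. ennreal (c\<^sup>2))"
      by (intro Liminf_mono) auto
    then show ?thesis by (simp add: Liminf_const)
  qed
  finally have *: "(\<integral>\<^sup>+x. ennreal ((norm (g x))\<^sup>2) \<partial>M) \<le> ennreal (c\<^sup>2)" .
  then have int: "integrable M (\<lambda>x. (norm (g x))\<^sup>2)"
    by (intro integrableI_bounded) (auto simp: le_less_trans)
  then have "(\<integral>x. (norm (g x))\<^sup>2 \<partial>M) \<le> c\<^sup>2"
    using * by (simp add: nn_integral_eq_integral integral_nonneg_AE)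
  with int show ?thesis using c0 by (simp add: L2_def L2_norm_le_iff)
qed

text \<open>The squared increments decay like 4^-n in the mean. Half of this is spent on summing:
  with weight 2^n the integrals still form a geometric series, so the weighted sum is finite almost
  everywhere. Its terms are then bounded, which leaves a decay of (1 / sqrt 2)^n for the increments
  at the point.\<close>

lemma L2_fast_Cauchy_AE:
  fixes f :: "nat \<Rightarrow> 'a \<Rightarrow> 'b::{second_countable_topology, banach}"
  assumes f: "\<And>n. f n \<in> L2 M" and b: "\<And>n. L2_norm M (\<lambda>x. f (Suc n) x - f n x) \<le> (1/2)^n"
  shows "AE x in M. Cauchy (\<lambda>n. f n x)"
proof -
  have [measurable]: "f n \<in> borel_measurable M" for n using f L2_measurable by blast
  let ?d = "\<lambda>n x. (norm (f (Suc n) x - f n x))\<^sup>2"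
  have "(\<integral>\<^sup>+x. (\<Sum>n. ennreal (2^n * ?d n x)) \<partial>M) = (\<Sum>n. \<integral>\<^sup>+x. ennreal (2^n * ?d n x) \<partial>M)"
    by (rule nn_integral_suminf) measurable
  also have "\<dots> \<le> (\<Sum>n. ennreal ((1/2)^n))"
  proof (rule suminf_le)
    fix n
    have I: "integrable M (?d n)" using L2_integrable[OF L2_diff[OF f f]] .
    have "(\<integral>\<^sup>+x. ennreal (2^n * ?d n x) \<partial>M) = ennreal (2^n * (L2_norm M (\<lambda>x. f (Suc n) x - f n x))\<^sup>2)"
      using I by (subst nn_integral_eq_integral) (auto simp: L2_norm_sq)
    also have "2^n * (L2_norm M (\<lambda>x. f (Suc n) x - f n x))\<^sup>2 \<le> 2^n * ((1/2)^n)\<^sup>2"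
      using b[of n] by (intro mult_left_mono power_mono) auto
    also have "2^n * ((1/2)^n)\<^sup>2 = (1/2::real)^n"
      by (simp add: power2_eq_square power_one_over field_simps)
    finally show "(\<integral>\<^sup>+x. ennreal (2^n * ?d n x) \<partial>M) \<le> ennreal ((1/2)^n)" by (simp add: ennreal_leI)
  qed auto
  also have "\<dots> < \<infinity>"
    by (subst suminf_ennreal2) auto
  finally have "AE x in M. (\<Sum>n. ennreal (2^n * ?d n x)) \<noteq> \<infinity>"
    by (intro nn_integral_PInf_AE) auto
  then show ?thesis
  proof eventually_elim
    fix x assume "(\<Sum>n. ennreal (2^n * ?d n x)) \<noteq> \<infinity>"
    then have sm: "summable (\<lambda>n. 2^n * ?d n x)"
      by (intro summable_suminf_not_top) auto
    from summable_imp_Bseq[OF sm] obtain K where K: "\<And>n. norm (2^n * ?d n x) \<le> K"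
      unfolding Bseq_def by blast
    have K0: "0 \<le> K" using K[of 0] norm_ge_zero order_trans by blast
    have le: "norm (f (Suc n) x - f n x) \<le> sqrt K * (1 / sqrt 2)^n" for n
    proof -
      have "?d n x \<le> K * (1/2)^n"
        using K[of n] by (simp add: field_simps)
      then have "sqrt (?d n x) \<le> sqrt (K * (1/2)^n)" by (rule real_sqrt_le_mono)
      also have "\<dots> = sqrt K * (1 / sqrt 2)^n"
        by (simp add: real_sqrt_mult real_sqrt_power real_sqrt_divide)
      finally show ?thesis by simp
    qed
    have "summable (\<lambda>n. sqrt K * (1 / sqrt 2)^n)"
      by (intro summable_mult summable_geometric) simp
    then have "summable (\<lambda>n. f (Suc n) x - f n x)"
      by (rule summable_comparison_test'[where N=0]) (use le in auto)
    then have "convergent (\<lambda>n. \<Sum>i<n. f (Suc i) x - f i x)"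
      by (simp add: summable_iff_convergent)
    then have "convergent (\<lambda>n. f n x - f 0 x)"
      using sum_lessThan_telescope[of "\<lambda>i. f i x"] by simp
    then obtain l where "(\<lambda>n. f n x - f 0 x) \<longlonglongrightarrow> l" by (auto simp: convergent_def)
    from tendsto_add[OF this tendsto_const[of "f 0 x"]]
    have "(\<lambda>n. f n x) \<longlonglongrightarrow> l + f 0 x" by simp
    then show "Cauchy (\<lambda>n. f n x)" by (rule LIMSEQ_imp_Cauchy)
  qed
qed

lemma L2_complete:
  fixes f :: "nat \<Rightarrow> 'a \<Rightarrow> 'b::{second_countable_topology, banach}"
  assumes f: "\<And>n. f n \<in> L2 M"
    and C: "\<And>e. 0 < e \<Longrightarrow> \<exists>N. \<forall>m\<ge>N. \<forall>n\<ge>N. L2_norm M (\<lambda>x. f m x - f n x) < e"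
  obtains g where "g \<in> L2 M" "L2_tendsto M f g"
proof -
  have [measurable]: "f n \<in> borel_measurable M" for n using f L2_measurable by blast
  have "\<forall>k. \<exists>N. \<forall>m\<ge>N. \<forall>n\<ge>N. L2_norm M (\<lambda>x. f m x - f n x) < (1/2)^k"
    using C by simp
  then obtain N where N: "\<And>k m n. m \<ge> N k \<Longrightarrow> n \<ge> N k \<Longrightarrow> L2_norm M (\<lambda>x. f m x - f n x) < (1/2)^k"
    by metis
  \<comment> \<open>The partial sums make \<open>r\<close> increasing while keeping it above
    \<open>N k\<close>, so consecutive terms of the subsequence \<open>f (r k)\<close> are within
    (1/2)^k of each other.\<close>
  define r where "r k = (\<Sum>i\<le>k. N i) + k" for k
  have rN: "N k \<le> r k" for k
    unfolding r_def using member_le_sum[of k "{..k}" N] by (simp add: trans_le_add1)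
  have rS: "r k \<le> r (Suc k)" "k \<le> r k" for k by (auto simp: r_def)
  have "AE x in M. Cauchy (\<lambda>n. f (r n) x)"
  proof (rule L2_fast_Cauchy_AE)
    show "L2_norm M (\<lambda>x. f (r (Suc n)) x - f (r n) x) \<le> (1/2)^n" for n
      using N[of n "r (Suc n)" "r n"] rN[of n] rS(1)[of n] by simp
  qed (rule f)
  then have conv: "AE x in M. (\<lambda>n. f (r n) x) \<longlonglongrightarrow> lim (\<lambda>n. f (r n) x)"
    by eventually_elim (simp add: Cauchy_convergent_iff convergent_LIMSEQ_iff)
  define g where "g x = lim (\<lambda>n. f (r n) x)" for x
  have [measurable]: "g \<in> borel_measurable M" unfolding g_def by measurable
  have conv: "AE x in M. (\<lambda>n. f (r n) x) \<longlonglongrightarrow> g x" using conv by (simp add: g_def)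
  \<comment> \<open>Fatou's lemma in the second index: \<open>f n - f (r (m + k))\<close> has norm
    at most (1/2)^k for every \<open>m\<close> and tends to \<open>f n - g\<close> as
    \<open>m\<close> grows. This reaches the whole sequence and not only the subsequence.\<close>
  have key: "(\<lambda>x. f n x - g x) \<in> L2 M \<and> L2_norm M (\<lambda>x. f n x - g x) \<le> (1/2)^k" if "n \<ge> N k" for n k
  proof (rule L2_Fatou)
    show "(\<lambda>x. f n x - f (r (m + k)) x) \<in> L2 M" for m by (intro L2_diff f)
    have "N k \<le> r (m + k)" for m
    proof -
      have "r k \<le> r (m + k)" by (rule lift_Suc_mono_le[of r]) (use rS in auto)
      then show ?thesis using rN[of k] by simp
    qed
    then show "L2_norm M (\<lambda>x. f n x - f (r (m + k)) x) \<le> (1/2)^k" for m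
      using N that less_imp_le by blast
    show "(\<lambda>x. f n x - g x) \<in> borel_measurable M" by measurable
    show "AE x in M. (\<lambda>m. f n x - f (r (m + k)) x) \<longlonglongrightarrow> f n x - g x"
      using conv by eventually_elim (intro tendsto_intros LIMSEQ_ignore_initial_segment)
  qed
  have d: "(\<lambda>x. f n x - g x) \<in> L2 M" for n
  proof -
    have "(\<lambda>x. f (N 0) x - g x) \<in> L2 M" using key[of 0 "N 0"] by simp
    from L2_add[OF L2_diff[OF f[of n] f[of "N 0"]] this]
    show ?thesis by simp
  qed
  have "g \<in> L2 M"
    using L2_diff[OF f[of 0] d[of 0]] by simp
  moreover have "L2_tendsto M f g"
    unfolding L2_tendsto_def
  proof (intro conjI allI d LIMSEQ_I)
    fix e :: real assume "0 < e"
    then obtain k where "(1/2)^k < e" using real_arch_pow_inv[of e "1/2"] by auto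
    then show "\<exists>no. \<forall>n\<ge>no. norm (L2_norm M (\<lambda>x. f n x - g x) - 0) < e"
      using key by (intro exI[of _ "N k"]) (auto intro: le_less_trans)
  qed
  ultimately show ?thesis by (rule that)
qed

lemma L2_tendsto_Cauchy:
  fixes f :: "nat \<Rightarrow> 'a \<Rightarrow> 'b::{second_countable_topology, banach}"
  assumes "L2_tendsto M f g" "0 < e"
  shows "\<exists>N. \<forall>m\<ge>N. \<forall>n\<ge>N. L2_norm M (\<lambda>x. f m x - f n x) < e"
proof -
  have d: "(\<lambda>x. f n x - g x) \<in> L2 M" for n
    using assms by (auto simp: L2_tendsto_def)
  have "(\<lambda>n. L2_norm M (\<lambda>x. f n x - g x)) \<longlonglongrightarrow> 0"
    using assms by (simp add: L2_tendsto_def)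
  then have "\<forall>\<^sub>F n in sequentially. L2_norm M (\<lambda>x. f n x - g x) < e / 2"
    using assms(2) by (intro order_tendstoD) auto
  then obtain N where N: "\<And>n. n \<ge> N \<Longrightarrow> L2_norm M (\<lambda>x. f n x - g x) < e / 2"
    unfolding eventually_sequentially by blast
  have "L2_norm M (\<lambda>x. f m x - f n x) < e" if "m \<ge> N" "n \<ge> N" for m n
  proof -
    have "L2_norm M (\<lambda>x. f m x - f n x) \<le> L2_norm M (\<lambda>x. f m x - g x) + L2_norm M (\<lambda>x. f n x - g x)"
      using L2_norm_triangle[OF d[of m] L2_scale[OF d[of n], of "-1"]]
        L2_norm_scale[of M "-1" "\<lambda>x. f n x - g x"] by simp
    then show ?thesis using N[OF that(1)] N[OF that(2)] by simp
  qed
  then show ?thesis by blast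
qed

lemma L2_norm_mono:
  assumes "f \<in> L2 M" "g \<in> L2 M" and le: "\<And>x. norm (f x) \<le> norm (g x)"
  shows "L2_norm M f \<le> L2_norm M g"
proof -
  have "(norm (f x))\<^sup>2 \<le> (norm (g x))\<^sup>2" for x by (rule power_mono[OF le norm_ge_zero])
  then show ?thesis
    unfolding L2_norm_def by (intro real_sqrt_le_mono integral_mono L2_integrable assms(1,2))
qed

lemma L2_cong:
  assumes "\<And>x. x \<in> space M \<Longrightarrow> f x = g x"
  shows "L2_norm M f = L2_norm M g" "f \<in> L2 M \<longleftrightarrow> g \<in> L2 M"
proof -
  show "L2_norm M f = L2_norm M g"
    unfolding L2_norm_def using assms by (intro arg_cong[where f = sqrt] Bochner_Integration.integral_cong) auto
  have "f \<in> borel_measurable M \<longleftrightarrow> g \<in> borel_measurable M" by (rule measurable_cong) (rule assms)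
  moreover have "integrable M (\<lambda>x. (norm (f x))\<^sup>2) \<longleftrightarrow> integrable M (\<lambda>x. (norm (g x))\<^sup>2)"
    by (rule Bochner_Integration.integrable_cong) (simp_all add: assms)
  ultimately show "f \<in> L2 M \<longleftrightarrow> g \<in> L2 M" by (simp add: L2_def)
qed

lemma L2_comb_real:
  fixes u :: "'a \<Rightarrow> real"
  shows "u \<in> L2 M \<Longrightarrow> v \<in> L2 M \<Longrightarrow> (\<lambda>x. u x + c * v x) \<in> L2 M"
  using L2_comb[of u M v c] by simp

section \<open>Translations\<close>

lemma lborel_integral_translate:
  fixes f :: "real \<Rightarrow> 'a::{banach, second_countable_topology}"
  shows "(\<integral>x. f (h + x) \<partial>lborel) = (\<integral>x. f x \<partial>lborel)"
  using lborel_integral_real_affine[of 1 f h] by simp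

lemma lborel_integrable_translate:
  fixes f :: "real \<Rightarrow> 'a::{banach, second_countable_topology}"
  shows "integrable lborel f \<Longrightarrow> integrable lborel (\<lambda>x. f (h + x))"
  using lborel_integrable_real_affine[of f 1 h] by simp

lemma lborel_integral_reflect:
  fixes f :: "real \<Rightarrow> 'a::{banach, second_countable_topology}"
  shows "(\<integral>x. f (h - x) \<partial>lborel) = (\<integral>x. f x \<partial>lborel)"
  using lborel_integral_real_affine[of "-1" f h] by simp

lemma lborel_integrable_reflect:
  fixes f :: "real \<Rightarrow> 'a::{banach, second_countable_topology}"
  shows "integrable lborel f \<Longrightarrow> integrable lborel (\<lambda>x. f (h - x))"
  using lborel_integrable_real_affine[of f "-1" h] by simp

abbreviation translation_error :: "(real \<Rightarrow> real) \<Rightarrow> real \<Rightarrow> real" where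
  "translation_error f h \<equiv> \<integral>x. \<bar>f (h + x) - f x\<bar> \<partial>lborel"

text \<open>The error \<open>f - g\<close> enters at \<open>x\<close> and at \<open>h + x\<close>,
  each time with the same integral by translation invariance; hence the factor 2.\<close>

lemma translation_error_approx:
  assumes f: "integrable lborel f" and g: "integrable lborel g"
  shows "translation_error f h \<le> translation_error g h + 2 * (\<integral>x. \<bar>f x - g x\<bar> \<partial>lborel)"
proof -
  let ?d = "\<lambda>x. \<bar>f x - g x\<bar>"
  have d: "integrable lborel ?d" using f g by simp
  note dh = lborel_integrable_translate[OF d, of h]
  note I = lborel_integrable_translate[OF f, of h] lborel_integrable_translate[OF g, of h] f g
  have "translation_error f h \<le> (\<integral>x. \<bar>g (h + x) - g x\<bar> + (?d (h + x) + ?d x) \<partial>lborel)"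
    by (rule integral_mono) (use I d dh in auto)
  also have "\<dots> = translation_error g h + ((\<integral>x. ?d (h + x) \<partial>lborel) + (\<integral>x. ?d x \<partial>lborel))"
    using I d dh by simp
  also have "(\<integral>x. ?d (h + x) \<partial>lborel) = (\<integral>x. ?d x \<partial>lborel)"
    by (rule lborel_integral_translate)
  finally show ?thesis by simp
qed

text \<open>The functions on which translation is continuous form a closed set in L1, so a dense
  family is enough. An approximation within \<open>e / 4\<close> costs \<open>e / 2\<close> by the
  previous lemma.\<close>

lemma translation_error_closed:
  assumes h: "h \<longlonglongrightarrow> 0" and f: "integrable lborel f"
    and approx: "\<And>e. 0 < e \<Longrightarrow> \<exists>g. integrable lborel g \<and> (\<lambda>n. translation_error g (h n)) \<longlonglongrightarrow> 0 \<and>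
      (\<integral>x. \<bar>f x - g x\<bar> \<partial>lborel) < e"
  shows "(\<lambda>n. translation_error f (h n)) \<longlonglongrightarrow> 0"
proof (rule LIMSEQ_I)
  fix e :: real assume e: "0 < e"
  then obtain g where g: "integrable lborel g" "(\<lambda>n. translation_error g (h n)) \<longlonglongrightarrow> 0"
      "(\<integral>x. \<bar>f x - g x\<bar> \<partial>lborel) < e / 4"
    using approx[of "e/4"] by auto
  have "\<forall>\<^sub>F n in sequentially. translation_error g (h n) < e / 2"
    using g(2) e by (intro order_tendstoD) auto
  then obtain N where N: "\<And>n. n \<ge> N \<Longrightarrow> translation_error g (h n) < e / 2"
    unfolding eventually_sequentially by blast
  have "norm (translation_error f (h n) - 0) < e" if "n \<ge> N" for n
  proof -
    have "translation_error f (h n) < e"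
      using translation_error_approx[OF f g(1), of "h n"] N[OF that] g(3) by linarith
    moreover have "0 \<le> translation_error f (h n)" by simp
    ultimately show ?thesis by simp
  qed
  then show "\<exists>no. \<forall>n\<ge>no. norm (translation_error f (h n) - 0) < e" by blast
qed

text \<open>Openness gives convergence of the overlap at every point: a point of \<open>U\<close>
  stays in \<open>U\<close> under small shifts, and outside \<open>U\<close> the factor
  \<open>?i x\<close> is 0. For a general Borel set this pointwise convergence may fail.\<close>

lemma translation_error_open:
  assumes h: "h \<longlonglongrightarrow> 0" and U: "open U" "emeasure lborel U < \<infinity>"
  shows "(\<lambda>n. translation_error (indicat_real U) (h n)) \<longlonglongrightarrow> 0"
proof -
  let ?i = "indicat_real U"
  have [measurable]: "U \<in> sets borel" using U(1) by simp
  have i: "integrable lborel ?i" using U by (intro integrable_real_indicator) auto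
  note ih = lborel_integrable_translate[OF i]
  have p: "integrable lborel (\<lambda>x. ?i (k + x) * ?i x)" for k
    by (rule Bochner_Integration.integrable_bound[OF i]) (auto simp: indicator_def)
  have "(\<lambda>n. \<integral>x. ?i (h n + x) * ?i x \<partial>lborel) \<longlonglongrightarrow> (\<integral>x. ?i x \<partial>lborel)"
  proof (rule integral_dominated_convergence[where w = ?i])
    show "AE x in lborel. (\<lambda>n. ?i (h n + x) * ?i x) \<longlonglongrightarrow> ?i x"
    proof (rule AE_I2)
      fix x :: real
      show "(\<lambda>n. ?i (h n + x) * ?i x) \<longlonglongrightarrow> ?i x"
      proof (cases "x \<in> U")
        case True
        have "(\<lambda>n. h n + x) \<longlonglongrightarrow> 0 + x" by (intro tendsto_intros h)
        then have "\<forall>\<^sub>F n in sequentially. h n + x \<in> U"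
          using True by (intro topological_tendstoD[OF _ U(1)]) simp_all
        then have "\<forall>\<^sub>F n in sequentially. ?i (h n + x) * ?i x = ?i x"
          by eventually_elim (simp add: True)
        then show ?thesis by (rule tendsto_eventually)
      qed simp
    qed
  qed (use i in \<open>auto simp: indicator_def\<close>)
  then have "(\<lambda>n. 2 * (\<integral>x. ?i x \<partial>lborel) - 2 * (\<integral>x. ?i (h n + x) * ?i x \<partial>lborel)) \<longlonglongrightarrow>
      2 * (\<integral>x. ?i x \<partial>lborel) - 2 * (\<integral>x. ?i x \<partial>lborel)"
    by (intro tendsto_intros)
  moreover have "translation_error ?i k = 2 * (\<integral>x. ?i x \<partial>lborel) - 2 * (\<integral>x. ?i (k + x) * ?i x \<partial>lborel)" for k
  proof -
    \<comment> \<open>For values in {0, 1}, |a - b| = a + b - 2 a b.\<close>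
    have "translation_error ?i k = (\<integral>x. (?i (k + x) + ?i x) - 2 * (?i (k + x) * ?i x) \<partial>lborel)"
      by (rule Bochner_Integration.integral_cong) (auto simp: indicator_def)
    also have "\<dots> = ((\<integral>x. ?i (k + x) \<partial>lborel) + (\<integral>x. ?i x \<partial>lborel)) - 2 * (\<integral>x. ?i (k + x) * ?i x \<partial>lborel)"
      using i ih[of k] p[of k] by simp
    also have "(\<integral>x. ?i (k + x) \<partial>lborel) = (\<integral>x. ?i x \<partial>lborel)"
      by (rule lborel_integral_translate)
    finally show ?thesis by simp
  qed
  ultimately show ?thesis by simp
qed

text \<open>Indicators are reduced to open sets by outer regularity of Lebesgue measure; sums and
  dominated limits follow from the triangle inequality and from
  \<open>translation_error_closed\<close>.\<close>

lemma translation_continuous_L1: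
  assumes "integrable lborel f" and h: "h \<longlonglongrightarrow> 0"
  shows "(\<lambda>n. translation_error f (h n)) \<longlonglongrightarrow> 0"
  using assms(1)
proof (induct f rule: integrable_induct)
  case (base A c)
  have A: "A \<in> sets borel" "emeasure lborel A < \<infinity>" using base by auto
  note [measurable] = A(1)
  have "(\<lambda>n. translation_error (indicat_real A) (h n)) \<longlonglongrightarrow> 0"
  proof (rule translation_error_closed[OF h])
    show "integrable lborel (indicat_real A)" using A by (intro integrable_real_indicator) auto
    fix e :: real assume e: "0 < e"
    from outer_regular_lborel[OF A(1) e] obtain U where U: "open U" "A \<subseteq> U" "emeasure lborel (U - A) < e"
      by blast
    have [measurable]: "U \<in> sets borel" using U(1) by simp
    have fin: "emeasure lborel U < \<infinity>"
    proof -
      have "emeasure lborel U = emeasure lborel ((U - A) \<union> A)" using U(2) by (simp add: Un_absorb2)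
      also have "\<dots> = emeasure lborel (U - A) + emeasure lborel A"
        by (rule plus_emeasure[symmetric]) auto
      also have "\<dots> < \<infinity>" using U(3) A(2) by (auto simp: less_top[symmetric])
      finally show ?thesis .
    qed
    have "(\<integral>x. \<bar>indicat_real A x - indicat_real U x\<bar> \<partial>lborel) = (\<integral>x. indicat_real (U - A) x \<partial>lborel)"
      by (rule Bochner_Integration.integral_cong) (use U(2) in \<open>auto simp: indicator_def\<close>)
    also have "\<dots> = measure lborel (U - A)" by simp
    also have "\<dots> < e" using U(3) less_trans[OF U(3) ennreal_less_top] by (simp add: measure_def)
    finally show "\<exists>g. integrable lborel g \<and> (\<lambda>n. translation_error g (h n)) \<longlonglongrightarrow> 0 \<and>
      (\<integral>x. \<bar>indicat_real A x - g x\<bar> \<partial>lborel) < e"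
      using translation_error_open[OF h U(1) fin] fin
      by (intro exI[of _ "indicat_real U"] conjI integrable_real_indicator) auto
  qed
  then have "(\<lambda>n. \<bar>c\<bar> * translation_error (indicat_real A) (h n)) \<longlonglongrightarrow> \<bar>c\<bar> * 0"
    by (intro tendsto_intros)
  moreover have "translation_error (\<lambda>x. indicat_real A x *\<^sub>R c) k = \<bar>c\<bar> * translation_error (indicat_real A) k" for k
  proof -
    have "translation_error (\<lambda>x. indicat_real A x *\<^sub>R c) k = (\<integral>x. \<bar>c\<bar> * \<bar>indicat_real A (k + x) - indicat_real A x\<bar> \<partial>lborel)"
      by (rule Bochner_Integration.integral_cong) (auto simp: indicator_def)
    then show ?thesis by simp
  qed
  ultimately show ?case by simp
next
  case (add f g)
  have "(\<lambda>n. translation_error f (h n) + translation_error g (h n)) \<longlonglongrightarrow> 0 + 0"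
    by (intro tendsto_add add)
  then have lim: "(\<lambda>n. translation_error f (h n) + translation_error g (h n)) \<longlonglongrightarrow> 0" by simp
  have "translation_error (\<lambda>x. f x + g x) k \<le> translation_error f k + translation_error g k" for k
  proof -
    note I = lborel_integrable_translate[OF add(1), of k] lborel_integrable_translate[OF add(3), of k] add(1,3)
    have "translation_error (\<lambda>x. f x + g x) k \<le> (\<integral>x. \<bar>f (k + x) - f x\<bar> + \<bar>g (k + x) - g x\<bar> \<partial>lborel)"
      by (rule integral_mono) (use I in auto)
    also have "\<dots> = translation_error f k + translation_error g k" using I by simp
    finally show ?thesis .
  qed
  then show ?case
    by (intro tendsto_sandwich[OF _ _ tendsto_const lim]) auto
next
  case (lim f s)
  show ?case
  proof (rule translation_error_closed[OF h lim(5)])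
    fix e :: real assume e: "0 < e"
    have [measurable]: "f \<in> borel_measurable borel" "s i \<in> borel_measurable borel" for i
      using lim(1)[of i] lim(5) by auto
    have "(\<lambda>i. \<integral>x. \<bar>f x - s i x\<bar> \<partial>lborel) \<longlonglongrightarrow> (\<integral>x. \<bar>f x - f x\<bar> \<partial>lborel)"
    proof (rule integral_dominated_convergence[where w = "\<lambda>x. 3 * \<bar>f x\<bar>"])
      show "AE x in lborel. (\<lambda>i. \<bar>f x - s i x\<bar>) \<longlonglongrightarrow> \<bar>f x - f x\<bar>"
        by (intro AE_I2 tendsto_intros lim(3)) simp
      fix i
      have "norm \<bar>f x - s i x\<bar> \<le> 3 * \<bar>f x\<bar>" for x
        using lim(4)[of x i] by simp
      then show "AE x in lborel. norm \<bar>f x - s i x\<bar> \<le> 3 * \<bar>f x\<bar>" by simp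
    qed (use lim(5) in auto)
    then have "\<forall>\<^sub>F i in sequentially. (\<integral>x. \<bar>f x - s i x\<bar> \<partial>lborel) < e"
      using e by (intro order_tendstoD) auto
    then obtain i where "(\<integral>x. \<bar>f x - s i x\<bar> \<partial>lborel) < e"
      by (auto simp: eventually_sequentially)
    then show "\<exists>g. integrable lborel g \<and> (\<lambda>n. translation_error g (h n)) \<longlonglongrightarrow> 0 \<and>
      (\<integral>x. \<bar>f x - g x\<bar> \<partial>lborel) < e"
      using lim(1,2) by blast
  qed
qed

text \<open>This carries continuity of translations from L1 to L2 by way of the signed square
  \<open>u x * \<bar>u x\<bar>\<close>; the plain square would not see a change of sign. For equal
  signs |a - b| \<le> |a + b|, and for opposite signs the moduli of the signed squares add
  up.\<close>

lemma sq_diff_le_signed_squares: "(a - b)\<^sup>2 \<le> 2 * \<bar>a * \<bar>a\<bar> - b * \<bar>b\<bar>\<bar>" for a b :: real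
proof -
  have same: "(a - b)\<^sup>2 \<le> \<bar>a * a - b * b\<bar>" if "0 \<le> a" "0 \<le> b" for a b :: real
  proof -
    have "(a - b)\<^sup>2 = \<bar>a - b\<bar> * \<bar>a - b\<bar>" by (simp add: power2_eq_square)
    also have "\<dots> \<le> \<bar>a - b\<bar> * \<bar>a + b\<bar>" using that by (intro mult_left_mono) auto
    also have "\<dots> = \<bar>a * a - b * b\<bar>" by (simp add: abs_mult[symmetric] algebra_simps)
    finally show ?thesis .
  qed
  have opp: "(a + b)\<^sup>2 \<le> 2 * (a * a + b * b)" for a b :: real
    using sum_squares_bound[of a b] by (simp add: power2_eq_square algebra_simps)
  consider "0 \<le> a" "0 \<le> b" | "0 \<le> a" "b \<le> 0" | "a \<le> 0" "0 \<le> b" | "a \<le> 0" "b \<le> 0" by linarith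
  then show ?thesis
  proof cases
    case 1
    then have "\<bar>a * \<bar>a\<bar> - b * \<bar>b\<bar>\<bar> = \<bar>a * a - b * b\<bar>" by simp
    then show ?thesis using order_trans[OF same[OF 1], of "2 * \<bar>a * a - b * b\<bar>"] by simp
  next
    case 2
    then have "\<bar>a * \<bar>a\<bar> - b * \<bar>b\<bar>\<bar> = a * a + b * b" by simp
    then show ?thesis using opp[of a "-b"] by simp
  next
    case 3
    then have "a * \<bar>a\<bar> - b * \<bar>b\<bar> = - (a * a + b * b)" by simp
    then have "\<bar>a * \<bar>a\<bar> - b * \<bar>b\<bar>\<bar> = a * a + b * b" by simp
    then show ?thesis using opp[of a "-b"] by simp
  next
    case 4
    then have "\<bar>a * \<bar>a\<bar> - b * \<bar>b\<bar>\<bar> = \<bar>(-a) * (-a) - (-b) * (-b)\<bar>" by (simp add: abs_minus_commute)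
    moreover have "(a - b)\<^sup>2 = (-a - -b)\<^sup>2" by (simp add: power2_commute)
    moreover have "(-a - -b)\<^sup>2 \<le> \<bar>(-a) * (-a) - (-b) * (-b)\<bar>" using same[of "-a" "-b"] 4 by simp
    ultimately show ?thesis
      using order_trans[of "(a - b)\<^sup>2" "\<bar>(-a) * (-a) - (-b) * (-b)\<bar>" "2 * \<bar>(-a) * (-a) - (-b) * (-b)\<bar>"] by simp
  qed
qed

lemma L2_translate:
  fixes u :: "real \<Rightarrow> real"
  assumes "u \<in> L2 lborel"
  shows "(\<lambda>x. u (h + x)) \<in> L2 lborel" "L2_norm lborel (\<lambda>x. u (h + x)) = L2_norm lborel u"
proof -
  have [measurable]: "u \<in> borel_measurable borel" using L2_measurable[OF assms] by simp
  show "(\<lambda>x. u (h + x)) \<in> L2 lborel"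
    using lborel_integrable_translate[OF L2_integrable[OF assms], of h] by (simp add: L2_def)
  show "L2_norm lborel (\<lambda>x. u (h + x)) = L2_norm lborel u"
    using lborel_integral_translate[of "\<lambda>x. (norm (u x))\<^sup>2" h] by (simp add: L2_norm_def)
qed

lemma translation_continuous_L2:
  fixes u :: "real \<Rightarrow> real"
  assumes u: "u \<in> L2 lborel" and h: "h \<longlonglongrightarrow> 0"
  shows "(\<lambda>n. L2_norm lborel (\<lambda>x. u (h n + x) - u x)) \<longlonglongrightarrow> 0"
proof -
  have [measurable]: "u \<in> borel_measurable borel" using L2_measurable[OF u] by simp
  let ?v = "\<lambda>x. u x * \<bar>u x\<bar>"
  have v: "integrable lborel ?v"
    by (rule Bochner_Integration.integrable_bound[OF L2_integrable[OF u]])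
       (auto simp: power2_eq_square abs_mult)
  have le: "(L2_norm lborel (\<lambda>x. u (k + x) - u x))\<^sup>2 \<le> 2 * translation_error ?v k" for k
  proof -
    have "(L2_norm lborel (\<lambda>x. u (k + x) - u x))\<^sup>2 = (\<integral>x. (u (k + x) - u x)\<^sup>2 \<partial>lborel)"
      by (simp add: L2_norm_sq)
    also have "\<dots> \<le> (\<integral>x. 2 * \<bar>?v (k + x) - ?v x\<bar> \<partial>lborel)"
    proof (rule integral_mono)
      show "integrable lborel (\<lambda>x. (u (k + x) - u x)\<^sup>2)"
        using L2_integrable[OF L2_diff[OF L2_translate(1)[OF u] u]] by simp
      show "integrable lborel (\<lambda>x. 2 * \<bar>?v (k + x) - ?v x\<bar>)"
        using v lborel_integrable_translate[OF v, of k] by simp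
    qed (rule sq_diff_le_signed_squares)
    finally show ?thesis by simp
  qed
  have "(\<lambda>n. 2 * translation_error ?v (h n)) \<longlonglongrightarrow> 2 * 0"
    by (rule tendsto_mult_left[OF translation_continuous_L1[OF v h]])
  then have lim: "(\<lambda>n. 2 * translation_error ?v (h n)) \<longlonglongrightarrow> 0" by simp
  have "(\<lambda>n. (L2_norm lborel (\<lambda>x. u (h n + x) - u x))\<^sup>2) \<longlonglongrightarrow> 0"
    by (rule tendsto_sandwich[OF _ _ tendsto_const lim]) (use le in \<open>simp_all only: zero_le_power2 eventually_True\<close>)
  then have "(\<lambda>n. sqrt ((L2_norm lborel (\<lambda>x. u (h n + x) - u x))\<^sup>2)) \<longlonglongrightarrow> sqrt 0"
    by (rule tendsto_real_sqrt)
  then show ?thesis by simp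
qed

definition autocorr :: "(real \<Rightarrow> real) \<Rightarrow> real \<Rightarrow> real" where
  "autocorr u h = (\<integral>x. u (h + x) * u x \<partial>lborel)"

lemma autocorr_bound:
  assumes "u \<in> L2 lborel" shows "\<bar>autocorr u h\<bar> \<le> (L2_norm lborel u)\<^sup>2"
  using L2_Cauchy_Schwarz[OF L2_translate(1)[OF assms, of h] assms] L2_translate(2)[OF assms, of h]
  by (simp add: autocorr_def L2_ip_def power2_eq_square)

text \<open>The value of the autocorrelation at 0 is the squared norm. Its continuity there is what
  Plancherel's theorem below rests on.\<close>

lemma autocorr_tendsto:
  assumes u: "u \<in> L2 lborel" and h: "h \<longlonglongrightarrow> 0"
  shows "(\<lambda>n. autocorr u (h n)) \<longlonglongrightarrow> (L2_norm lborel u)\<^sup>2"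
proof (rule LIM_zero_cancel, rule Lim_null_comparison)
  have "(\<lambda>n. L2_norm lborel (\<lambda>x. u (h n + x) - u x) * L2_norm lborel u) \<longlonglongrightarrow> 0 * L2_norm lborel u"
    by (intro tendsto_intros translation_continuous_L2 u h)
  then show "(\<lambda>n. L2_norm lborel (\<lambda>x. u (h n + x) - u x) * L2_norm lborel u) \<longlonglongrightarrow> 0" by simp
  have "\<bar>autocorr u k - (L2_norm lborel u)\<^sup>2\<bar> \<le> L2_norm lborel (\<lambda>x. u (k + x) - u x) * L2_norm lborel u" for k
  proof -
    have "autocorr u k - (L2_norm lborel u)\<^sup>2 = L2_ip lborel (\<lambda>x. u (k + x) - u x) u"
      using L2_ip_comb_left[OF L2_translate(1)[OF u, of k] u u, of "-1"]
      by (simp add: L2_ip_self autocorr_def) (simp add: L2_ip_def)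
    then show ?thesis
      using L2_Cauchy_Schwarz[OF L2_diff[OF L2_translate(1)[OF u, of k] u] u] by simp
  qed
  then show "\<forall>\<^sub>F n in sequentially. norm (autocorr u (h n) - (L2_norm lborel u)\<^sup>2)
      \<le> L2_norm lborel (\<lambda>x. u (h n + x) - u x) * L2_norm lborel u" by simp
qed

section \<open>The Fourier integral\<close>

lemma cis_measurable [measurable]: "cis \<in> borel_measurable borel"
  by (intro borel_measurable_continuous_onI continuous_intros)

text \<open>The transform as an absolutely convergent integral, for integrable \<open>f\<close>. By
  \<open>fourier_eq_fint\<close> it agrees almost everywhere with \<open>fourier f\<close> if
  \<open>f\<close> is square integrable as well.\<close>

definition fint :: "(real \<Rightarrow> real) \<Rightarrow> real \<Rightarrow> complex" where
  "fint f \<omega> = complex_of_real (1 / sqrt (2 * pi)) * (\<integral>x. complex_of_real (f x) * cis (- (\<omega> * x)) \<partial>lborel)"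

lemma fint_integrand_integrable:
  assumes "integrable lborel f"
  shows "integrable lborel (\<lambda>x. complex_of_real (f x) * cis (- (\<omega> * x)))"
proof (rule Bochner_Integration.integrable_bound[OF assms])
  have [measurable]: "f \<in> borel_measurable borel" using assms by auto
  show "(\<lambda>x. complex_of_real (f x) * cis (- (\<omega> * x))) \<in> borel_measurable lborel" by measurable
qed (simp add: norm_mult)

lemma fint_measurable [measurable]:
  assumes [measurable]: "f \<in> borel_measurable borel"
  shows "fint f \<in> borel_measurable borel"
  unfolding fint_def by measurable

lemma fint_comb:
  assumes "integrable lborel f" "integrable lborel g"
  shows "fint (\<lambda>x. f x + c * g x) \<omega> = fint f \<omega> + c *\<^sub>R fint g \<omega>"
proof -
  have "(\<integral>x. complex_of_real (f x + c * g x) * cis (- (\<omega> * x)) \<partial>lborel)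
      = (\<integral>x. complex_of_real (f x) * cis (- (\<omega> * x)) + complex_of_real c * (complex_of_real (g x) * cis (- (\<omega> * x))) \<partial>lborel)"
    by (rule Bochner_Integration.integral_cong) (auto simp: algebra_simps)
  also have "\<dots> = (\<integral>x. complex_of_real (f x) * cis (- (\<omega> * x)) \<partial>lborel)
      + complex_of_real c * (\<integral>x. complex_of_real (g x) * cis (- (\<omega> * x)) \<partial>lborel)"
    using fint_integrand_integrable[OF assms(1), of \<omega>] fint_integrand_integrable[OF assms(2), of \<omega>] by simp
  finally show ?thesis by (simp add: fint_def scaleR_conv_of_real algebra_simps add_divide_distrib)
qed

lemma fint_bound:
  assumes "integrable lborel f"
  shows "norm (fint f \<omega>) \<le> 1 / sqrt (2 * pi) * (\<integral>x. \<bar>f x\<bar> \<partial>lborel)"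
proof -
  have "norm (\<integral>x. complex_of_real (f x) * cis (- (\<omega> * x)) \<partial>lborel) \<le> (\<integral>x. norm (complex_of_real (f x) * cis (- (\<omega> * x))) \<partial>lborel)"
    by (rule integral_norm_bound)
  also have "\<dots> = (\<integral>x. \<bar>f x\<bar> \<partial>lborel)" by (simp add: norm_mult)
  finally show ?thesis
    unfolding fint_def norm_mult norm_of_real by (intro mult_mono) auto
qed

text \<open>The conjugate appears because \<open>f\<close> is real valued. Needed for the
  autocorrelation and for the mirrored kernel of the right derivative.\<close>

lemma fint_reflect: "fint (\<lambda>x. f (- x)) \<omega> = cnj (fint f \<omega>)"
proof -
  have "(\<integral>x. complex_of_real (f (- x)) * cis (- (\<omega> * x)) \<partial>lborel) = (\<integral>x. complex_of_real (f x) * cis (\<omega> * x) \<partial>lborel)"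
    using lborel_integral_reflect[of "\<lambda>x. complex_of_real (f x) * cis (\<omega> * x)" 0] by simp
  also have "\<dots> = (\<integral>x. cnj (complex_of_real (f x) * cis (- (\<omega> * x))) \<partial>lborel)"
    by (simp add: cis_cnj)
  also have "\<dots> = cnj (\<integral>x. complex_of_real (f x) * cis (- (\<omega> * x)) \<partial>lborel)"
    by (rule Bochner_Integration.integral_cnj)
  finally show ?thesis by (simp add: fint_def)
qed

section \<open>Convolution and the multiplication formula\<close>

definition conv :: "(real \<Rightarrow> real) \<Rightarrow> (real \<Rightarrow> real) \<Rightarrow> real \<Rightarrow> real" where
  "conv k g x = (\<integral>y. k y * g (x - y) \<partial>lborel)"

lemma conv_measurable [measurable]:
  assumes [measurable]: "k \<in> borel_measurable borel" "g \<in> borel_measurable borel"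
  shows "conv k g \<in> borel_measurable borel"
  unfolding conv_def by measurable

lemma
  assumes k: "integrable lborel k" and g: "integrable lborel g"
  shows conv_integrable: "integrable lborel (conv k g)"
    and fint_conv: "fint (conv k g) \<omega> = complex_of_real (sqrt (2 * pi)) * fint k \<omega> * fint g \<omega>"
proof -
  have [measurable]: "k \<in> borel_measurable borel" "g \<in> borel_measurable borel" using k g by auto
  let ?F = "\<lambda>y x. complex_of_real (k y * g (x - y)) * cis (- (\<omega> * x))"
  have gy: "integrable lborel (\<lambda>x. g (x - y))" for y
    using lborel_integrable_translate[OF g, of "-y"] by simp
  have int0: "integrable (lborel \<Otimes>\<^sub>M lborel) (\<lambda>(y, x). k y * g (x - y))"
  proof (rule lborel_pair.Fubini_integrable)
    show "(\<lambda>(y, x). k y * g (x - y)) \<in> borel_measurable (lborel \<Otimes>\<^sub>M lborel)" by measurable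
    have "(\<integral>x. \<bar>g (x - y)\<bar> \<partial>lborel) = (\<integral>x. \<bar>g x\<bar> \<partial>lborel)" for y
      using lborel_integral_translate[of "\<lambda>x. \<bar>g x\<bar>" "-y"] by simp
    then have "(\<lambda>y. \<integral>x. norm (case (y, x) of (y, x) \<Rightarrow> k y * g (x - y)) \<partial>lborel) = (\<lambda>y. \<bar>k y\<bar> * (\<integral>x. \<bar>g x\<bar> \<partial>lborel))"
      by (simp add: abs_mult)
    then show "integrable lborel (\<lambda>y. \<integral>x. norm (case (y, x) of (y, x) \<Rightarrow> k y * g (x - y)) \<partial>lborel)"
      using k by simp
    show "AE y in lborel. integrable lborel (\<lambda>x. case (y, x) of (y, x) \<Rightarrow> k y * g (x - y))"
      using gy by simp
  qed
  show "integrable lborel (conv k g)"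
    unfolding conv_def using lborel_pair.integrable_snd[OF int0] .
  have int: "integrable (lborel \<Otimes>\<^sub>M lborel) (\<lambda>(y, x). ?F y x)"
    by (rule Bochner_Integration.integrable_bound[OF int0]) (auto simp: norm_mult)
  have "(\<integral>x. complex_of_real (conv k g x) * cis (- (\<omega> * x)) \<partial>lborel) = (\<integral>x. \<integral>y. ?F y x \<partial>lborel \<partial>lborel)"
    unfolding conv_def by (simp flip: integral_complex_of_real)
  also have "\<dots> = (\<integral>y. \<integral>x. ?F y x \<partial>lborel \<partial>lborel)"
    by (rule lborel_pair.Fubini_integral[OF int])
  also have "\<dots> = (\<integral>y. (complex_of_real (k y) * cis (- (\<omega> * y))) * (\<integral>x. complex_of_real (g x) * cis (- (\<omega> * x)) \<partial>lborel) \<partial>lborel)"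
  proof (rule Bochner_Integration.integral_cong[OF refl])
    fix y :: real
    have "(\<integral>x. ?F y x \<partial>lborel) = (\<integral>x. ?F y (y + x) \<partial>lborel)"
      by (rule lborel_integral_translate[symmetric])
    also have "\<dots> = (\<integral>x. (complex_of_real (k y) * cis (- (\<omega> * y))) * (complex_of_real (g x) * cis (- (\<omega> * x))) \<partial>lborel)"
      by (rule Bochner_Integration.integral_cong[OF refl]) (simp add: cis_mult algebra_simps)
    also have "\<dots> = (complex_of_real (k y) * cis (- (\<omega> * y))) * (\<integral>x. complex_of_real (g x) * cis (- (\<omega> * x)) \<partial>lborel)"
      by simp
    finally show "(\<integral>x. ?F y x \<partial>lborel) = \<dots>" .
  qed
  also have "\<dots> = (\<integral>y. complex_of_real (k y) * cis (- (\<omega> * y)) \<partial>lborel) * (\<integral>x. complex_of_real (g x) * cis (- (\<omega> * x)) \<partial>lborel)"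
    by simp
  finally have eq: "(\<integral>x. complex_of_real (conv k g x) * cis (- (\<omega> * x)) \<partial>lborel) = \<dots>" .
  \<comment> \<open>The unitary normalisation puts one factor \<open>1 / sqrt (2 * pi)\<close> on
    the left and two on the right; \<open>sqrt (2 * pi)\<close> makes up for the difference.\<close>
  have "complex_of_real (1 / sqrt (2 * pi)) = complex_of_real (sqrt (2 * pi)) * complex_of_real (1 / sqrt (2 * pi)) * complex_of_real (1 / sqrt (2 * pi))"
    by (simp flip: of_real_mult)
  moreover have "S * (c * X) * (c * Y) = (S * c * c) * (X * Y)" for S c X Y :: complex
    by (simp only: mult_ac)
  ultimately show "fint (conv k g) \<omega> = complex_of_real (sqrt (2 * pi)) * fint k \<omega> * fint g \<omega>"
    unfolding fint_def eq by presburger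
qed

text \<open>Fubini's theorem, as the kernel \<open>cis (- (\<omega> * h))\<close> is symmetric in
  its two variables. With a Gaussian \<open>g\<close> it yields averages of a transform without any
  inversion formula.\<close>

lemma fint_multiplication:
  assumes A: "integrable lborel A" and g: "integrable lborel g"
  shows "(\<integral>\<omega>. complex_of_real (g \<omega>) * fint A \<omega> \<partial>lborel) = (\<integral>h. complex_of_real (A h) * fint g h \<partial>lborel)"
proof -
  have [measurable]: "A \<in> borel_measurable borel" "g \<in> borel_measurable borel" using A g by auto
  let ?c = "complex_of_real (1 / sqrt (2 * pi))"
  let ?F = "\<lambda>h \<omega>. complex_of_real (g \<omega>) * (?c * (complex_of_real (A h) * cis (- (\<omega> * h))))"
  have int: "integrable (lborel \<Otimes>\<^sub>M lborel) (\<lambda>(h, \<omega>). ?F h \<omega>)"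
  proof (rule lborel_pair.Fubini_integrable)
    show "(\<lambda>(h, \<omega>). ?F h \<omega>) \<in> borel_measurable (lborel \<Otimes>\<^sub>M lborel)" by measurable
    have "(\<lambda>h. \<integral>\<omega>. norm (case (h, \<omega>) of (h, \<omega>) \<Rightarrow> ?F h \<omega>) \<partial>lborel)
        = (\<lambda>h. (\<integral>\<omega>. \<bar>g \<omega>\<bar> \<partial>lborel) * (1 / sqrt (2 * pi)) * \<bar>A h\<bar>)"
    proof
      fix h
      have "(\<integral>\<omega>. norm (case (h, \<omega>) of (h, \<omega>) \<Rightarrow> ?F h \<omega>) \<partial>lborel) = (\<integral>\<omega>. \<bar>g \<omega>\<bar> * ((1 / sqrt (2 * pi)) * \<bar>A h\<bar>) \<partial>lborel)"
        by (rule Bochner_Integration.integral_cong) (auto simp: norm_mult norm_divide)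
      then show "(\<integral>\<omega>. norm (case (h, \<omega>) of (h, \<omega>) \<Rightarrow> ?F h \<omega>) \<partial>lborel) = (\<integral>\<omega>. \<bar>g \<omega>\<bar> \<partial>lborel) * (1 / sqrt (2 * pi)) * \<bar>A h\<bar>"
        by simp
    qed
    then show "integrable lborel (\<lambda>h. \<integral>\<omega>. norm (case (h, \<omega>) of (h, \<omega>) \<Rightarrow> ?F h \<omega>) \<partial>lborel)"
      using A by simp
    show "AE h in lborel. integrable lborel (\<lambda>\<omega>. case (h, \<omega>) of (h, \<omega>) \<Rightarrow> ?F h \<omega>)"
    proof (rule AE_I2)
      fix h :: real
      have "integrable lborel (\<lambda>\<omega>. (?c * complex_of_real (A h)) * (complex_of_real (g \<omega>) * cis (- (h * \<omega>))))"
        using fint_integrand_integrable[OF g, of h] by (rule integrable_mult_right)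
      then show "integrable lborel (\<lambda>\<omega>. case (h, \<omega>) of (h, \<omega>) \<Rightarrow> ?F h \<omega>)"
        by (simp add: mult_ac)
    qed
  qed
  have "(\<integral>\<omega>. complex_of_real (g \<omega>) * fint A \<omega> \<partial>lborel) = (\<integral>\<omega>. \<integral>h. ?F h \<omega> \<partial>lborel \<partial>lborel)"
    by (simp add: fint_def)
  also have "\<dots> = (\<integral>h. \<integral>\<omega>. ?F h \<omega> \<partial>lborel \<partial>lborel)"
    by (rule lborel_pair.Fubini_integral[OF int])
  also have "\<dots> = (\<integral>h. complex_of_real (A h) * fint g h \<partial>lborel)"
  proof (rule Bochner_Integration.integral_cong[OF refl])
    fix h :: real
    have "(\<integral>\<omega>. ?F h \<omega> \<partial>lborel) = (\<integral>\<omega>. (complex_of_real (A h) * ?c) * (complex_of_real (g \<omega>) * cis (- (h * \<omega>))) \<partial>lborel)"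
      by (rule Bochner_Integration.integral_cong) (auto simp: mult_ac)
    also have "\<dots> = (complex_of_real (A h) * ?c) * (\<integral>\<omega>. complex_of_real (g \<omega>) * cis (- (h * \<omega>)) \<partial>lborel)"
      by (rule integral_mult_right_zero)
    finally show "(\<integral>\<omega>. ?F h \<omega> \<partial>lborel) = complex_of_real (A h) * fint g h"
      by (simp add: fint_def)
  qed
  finally show ?thesis .
qed

section \<open>Plancherel's theorem for integrable functions\<close>

lemma autocorr_conv: "autocorr u = conv u (\<lambda>x. u (- x))"
proof
  fix h
  have "conv u (\<lambda>x. u (- x)) h = (\<integral>y. u y * u (y - h) \<partial>lborel)" by (simp add: conv_def)
  also have "\<dots> = (\<integral>y. u (h + y) * u ((h + y) - h) \<partial>lborel)"
    by (rule lborel_integral_translate[symmetric])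
  finally show "autocorr u h = conv u (\<lambda>x. u (- x)) h" by (simp add: autocorr_def)
qed

text \<open>Convolution with the reflected function multiplies the transform by its conjugate (the
  Wiener-Khinchin relation).\<close>

lemma
  assumes u: "integrable lborel u"
  shows autocorr_integrable: "integrable lborel (autocorr u)"
    and fint_autocorr: "fint (autocorr u) \<omega> = complex_of_real (sqrt (2 * pi) * (norm (fint u \<omega>))\<^sup>2)"
proof -
  have u': "integrable lborel (\<lambda>x. u (- x))" using lborel_integrable_reflect[OF u, of 0] by simp
  show "integrable lborel (autocorr u)"
    unfolding autocorr_conv by (rule conv_integrable[OF u u'])
  show "fint (autocorr u) \<omega> = complex_of_real (sqrt (2 * pi) * (norm (fint u \<omega>))\<^sup>2)"
    unfolding autocorr_conv fint_conv[OF u u'] fint_reflect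
    by (simp add: complex_norm_square[symmetric] mult.assoc)
qed

text \<open>The characteristic function of the standard normal distribution, rescaled by
  \<open>e\<close>.\<close>

lemma fint_std_normal:
  assumes e: "0 < (e::real)"
  shows "fint (\<lambda>\<omega>. exp (- (e * \<omega>)\<^sup>2 / 2)) h = complex_of_real (1 / e * exp (- (h / e)\<^sup>2 / 2))"
proof -
  let ?n = "std_normal_density"
  have "complex_of_real (exp (- (h / e)\<^sup>2 / 2)) = char std_normal_distribution (- h / e)"
    by (simp add: char_std_normal_distribution)
  also have "\<dots> = (\<integral>x. ?n x *\<^sub>R iexp ((- h / e) * x) \<partial>lborel)"
    unfolding char_def
    by (subst integral_density) (auto simp: normal_density_nonneg)
  also have "\<dots> = \<bar>e\<bar> *\<^sub>R (\<integral>x. ?n (0 + e * x) *\<^sub>R iexp ((- h / e) * (0 + e * x)) \<partial>lborel)"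
    by (rule lborel_integral_real_affine) (use e in simp)
  also have "(\<lambda>x. ?n (0 + e * x) *\<^sub>R iexp ((- h / e) * (0 + e * x)))
      = (\<lambda>x. complex_of_real (1 / sqrt (2 * pi)) * (complex_of_real (exp (- (e * x)\<^sup>2 / 2)) * cis (- (h * x))))"
    using e by (auto simp: fun_eq_iff std_normal_density_def scaleR_conv_of_real cis_conv_exp mult_ac)
  finally have "complex_of_real (exp (- (h / e)\<^sup>2 / 2)) = e *\<^sub>R fint (\<lambda>\<omega>. exp (- (e * \<omega>)\<^sup>2 / 2)) h"
    using e by (simp add: fint_def)
  then show ?thesis using e by (simp add: scaleR_conv_of_real field_simps)
qed

lemma gaussian_integrable:
  assumes e: "0 < (e::real)"
  shows "integrable lborel (\<lambda>\<omega>. exp (- (e * \<omega>)\<^sup>2 / 2))"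
proof -
  have "integrable lborel (\<lambda>x. sqrt (2 * pi) * std_normal_density (0 + e * x))"
    by (intro integrable_mult_right lborel_integrable_real_affine integrable_normal_density) (use e in auto)
  then show ?thesis by (simp add: std_normal_density_def)
qed

text \<open>The Gaussian makes the integral finite, since \<open>fint u\<close> is so far only known
  to be bounded. The multiplication formula turns it into an average of the autocorrelation over a
  Gaussian of width \<open>e\<close>, an approximate identity as \<open>e\<close> tends to
  0.\<close>

lemma gaussian_mean_fint:
  assumes u: "integrable lborel u" "u \<in> L2 lborel" and e: "0 < e"
  shows "integrable lborel (\<lambda>\<omega>. exp (- (e * \<omega>)\<^sup>2 / 2) * (norm (fint u \<omega>))\<^sup>2)"
    and "(\<integral>\<omega>. exp (- (e * \<omega>)\<^sup>2 / 2) * (norm (fint u \<omega>))\<^sup>2 \<partial>lborel)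
      = (\<integral>z. autocorr u (e * z) * std_normal_density z \<partial>lborel)"
proof -
  have [measurable]: "u \<in> borel_measurable borel" using u by auto
  let ?g = "\<lambda>\<omega>. exp (- (e * \<omega>)\<^sup>2 / 2)"
  have s: "sqrt (2 * pi) > 0" by simp
  let ?I = "1 / sqrt (2 * pi) * (\<integral>x. \<bar>u x\<bar> \<partial>lborel)"
  show "integrable lborel (\<lambda>\<omega>. ?g \<omega> * (norm (fint u \<omega>))\<^sup>2)"
  proof (rule Bochner_Integration.integrable_bound)
    show "integrable lborel (\<lambda>\<omega>. ?g \<omega> * ?I\<^sup>2)" using gaussian_integrable[OF e] by (rule integrable_mult_left)
    have "norm (?g \<omega> * (norm (fint u \<omega>))\<^sup>2) \<le> norm (?g \<omega> * ?I\<^sup>2)" for \<omega>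
      using power_mono[OF fint_bound[OF u(1), of \<omega>] norm_ge_zero, of 2] by simp
    then show "AE \<omega> in lborel. norm (?g \<omega> * (norm (fint u \<omega>))\<^sup>2) \<le> norm (?g \<omega> * ?I\<^sup>2)" by simp
  qed measurable
  have "complex_of_real (\<integral>\<omega>. ?g \<omega> * (norm (fint u \<omega>))\<^sup>2 \<partial>lborel)
      = (\<integral>\<omega>. complex_of_real (1 / sqrt (2 * pi)) * (complex_of_real (?g \<omega>) * fint (autocorr u) \<omega>) \<partial>lborel)"
    unfolding integral_complex_of_real[symmetric] fint_autocorr[OF u(1)]
  proof (rule Bochner_Integration.integral_cong[OF refl])
    fix \<omega>
    have "?g \<omega> * (norm (fint u \<omega>))\<^sup>2 = 1 / sqrt (2 * pi) * (?g \<omega> * (sqrt (2 * pi) * (norm (fint u \<omega>))\<^sup>2))"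
      by simp
    then show "complex_of_real (?g \<omega> * (norm (fint u \<omega>))\<^sup>2)
        = complex_of_real (1 / sqrt (2 * pi)) * (complex_of_real (?g \<omega>) * complex_of_real (sqrt (2 * pi) * (norm (fint u \<omega>))\<^sup>2))"
      by (simp only: of_real_mult[symmetric])
  qed
  also have "\<dots> = complex_of_real (1 / sqrt (2 * pi)) * (\<integral>h. complex_of_real (autocorr u h) * fint ?g h \<partial>lborel)"
    using fint_multiplication[OF autocorr_integrable[OF u(1)] gaussian_integrable[OF e]] by simp
  also have "\<dots> = complex_of_real (1 / sqrt (2 * pi) * (\<integral>h. autocorr u h * (1 / e * exp (- (h / e)\<^sup>2 / 2)) \<partial>lborel))"
    unfolding fint_std_normal[OF e] of_real_mult[symmetric] integral_complex_of_real ..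
  finally have "(\<integral>\<omega>. ?g \<omega> * (norm (fint u \<omega>))\<^sup>2 \<partial>lborel)
      = 1 / sqrt (2 * pi) * (\<integral>h. autocorr u h * (1 / e * exp (- (h / e)\<^sup>2 / 2)) \<partial>lborel)"
    by (simp only: of_real_eq_iff)
  also have "(\<integral>h. autocorr u h * (1 / e * exp (- (h / e)\<^sup>2 / 2)) \<partial>lborel)
      = \<bar>e\<bar> *\<^sub>R (\<integral>z. autocorr u (0 + e * z) * (1 / e * exp (- ((0 + e * z) / e)\<^sup>2 / 2)) \<partial>lborel)"
    by (rule lborel_integral_real_affine) (use e in simp)
  also have "1 / sqrt (2 * pi) * \<dots> = (\<integral>z. autocorr u (e * z) * std_normal_density z \<partial>lborel)"
    using e unfolding real_scaleR_def integral_mult_right_zero[symmetric]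
    by (intro Bochner_Integration.integral_cong) (auto simp: std_normal_density_def)
  finally show "(\<integral>\<omega>. ?g \<omega> * (norm (fint u \<omega>))\<^sup>2 \<partial>lborel) = (\<integral>z. autocorr u (e * z) * std_normal_density z \<partial>lborel)" .
qed

text \<open>As \<open>e\<close> decreases to 0, the left side of \<open>gaussian_mean_fint\<close>
  increases to the squared norm of the transform, and the right side tends to the autocorrelation at
  0. Monotone convergence also supplies the integrability of the limit, which is not known
  beforehand.\<close>

lemma
  assumes u: "integrable lborel u" "u \<in> L2 lborel"
  shows fint_L2: "fint u \<in> L2 lborel" and Plancherel_fint: "L2_norm lborel (fint u) = L2_norm lborel u"
proof -
  have [measurable]: "u \<in> borel_measurable borel" using u by auto
  have [measurable]: "autocorr u \<in> borel_measurable borel" using autocorr_integrable[OF u(1)] by auto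
  define e where "e k = 1 / real (Suc k)" for k
  have e: "0 < e k" for k by (simp add: e_def)
  have e0: "e \<longlonglongrightarrow> 0" unfolding e_def by (rule LIMSEQ_inverse_real_of_nat[unfolded inverse_eq_divide])
  have "(\<lambda>k. \<integral>z. autocorr u (e k * z) * std_normal_density z \<partial>lborel)
      \<longlonglongrightarrow> (\<integral>z. (L2_norm lborel u)\<^sup>2 * std_normal_density z \<partial>lborel)"
  proof (rule integral_dominated_convergence[where w = "\<lambda>z. (L2_norm lborel u)\<^sup>2 * std_normal_density z"])
    show "AE z in lborel. (\<lambda>k. autocorr u (e k * z) * std_normal_density z) \<longlonglongrightarrow> (L2_norm lborel u)\<^sup>2 * std_normal_density z"
    proof (intro AE_I2 tendsto_intros autocorr_tendsto u(2))
      fix z :: real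
      have "(\<lambda>k. e k * z) \<longlonglongrightarrow> 0 * z" by (intro tendsto_intros e0)
      then show "(\<lambda>k. e k * z) \<longlonglongrightarrow> 0" by simp
    qed
    fix k
    have "norm (autocorr u (e k * z) * std_normal_density z) \<le> (L2_norm lborel u)\<^sup>2 * std_normal_density z" for z
      using autocorr_bound[OF u(2), of "e k * z"] by (auto simp: abs_mult normal_density_nonneg intro!: mult_mono)
    then show "AE z in lborel. norm (autocorr u (e k * z) * std_normal_density z) \<le> (L2_norm lborel u)\<^sup>2 * std_normal_density z"
      by simp
  qed auto
  then have "(\<lambda>k. \<integral>z. autocorr u (e k * z) * std_normal_density z \<partial>lborel) \<longlonglongrightarrow> (L2_norm lborel u)\<^sup>2"
    by simp
  then have lim: "(\<lambda>k. \<integral>\<omega>. exp (- (e k * \<omega>)\<^sup>2 / 2) * (norm (fint u \<omega>))\<^sup>2 \<partial>lborel) \<longlonglongrightarrow> (L2_norm lborel u)\<^sup>2"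
    unfolding gaussian_mean_fint(2)[OF u e] .
  have mono: "AE \<omega> in lborel. mono (\<lambda>k. exp (- (e k * \<omega>)\<^sup>2 / 2) * (norm (fint u \<omega>))\<^sup>2)"
  proof (intro AE_I2 monoI mult_right_mono)
    fix \<omega> :: real and k l :: nat assume "k \<le> l"
    then have "e l \<le> e k" by (simp add: e_def frac_le)
    then have "(e l)\<^sup>2 \<le> (e k)\<^sup>2" using e[of l] by (intro power_mono) auto
    then show "exp (- (e k * \<omega>)\<^sup>2 / 2) \<le> exp (- (e l * \<omega>)\<^sup>2 / 2)"
      by (simp add: power_mult_distrib mult_right_mono)
  qed simp
  have ptw: "AE \<omega> in lborel. (\<lambda>k. exp (- (e k * \<omega>)\<^sup>2 / 2) * (norm (fint u \<omega>))\<^sup>2) \<longlonglongrightarrow> (norm (fint u \<omega>))\<^sup>2"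
  proof (rule AE_I2)
    fix \<omega> :: real
    have "(\<lambda>k. exp (- (e k * \<omega>)\<^sup>2 / 2) * (norm (fint u \<omega>))\<^sup>2) \<longlonglongrightarrow> exp (- (0 * \<omega>)\<^sup>2 / 2) * (norm (fint u \<omega>))\<^sup>2"
      by (intro tendsto_intros e0) simp
    then show "(\<lambda>k. exp (- (e k * \<omega>)\<^sup>2 / 2) * (norm (fint u \<omega>))\<^sup>2) \<longlonglongrightarrow> (norm (fint u \<omega>))\<^sup>2" by simp
  qed
  note mc = integral_monotone_convergence_nonneg[OF gaussian_mean_fint(1)[OF u e] mono _ ptw lim]
  show "fint u \<in> L2 lborel" unfolding L2_def using mc(1) by simp
  show "L2_norm lborel (fint u) = L2_norm lborel u"
    using mc(2) by (simp add: L2_norm_def[of lborel "fint u"])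
qed

section \<open>The Fourier transform on square integrable functions\<close>

abbreviation trunc :: "(real \<Rightarrow> real) \<Rightarrow> nat \<Rightarrow> real \<Rightarrow> real" where
  "trunc u n \<equiv> \<lambda>x. indicat_real {- real n..real n} x * u x"

lemma truncated_fourier_eq: "truncated_fourier u n = fint (trunc u n)"
proof
  fix \<omega>
  have "(LINT x:{- real n..real n}|lborel. complex_of_real (u x) * cis (- (\<omega> * x)))
      = (\<integral>x. complex_of_real (trunc u n x) * cis (- (\<omega> * x)) \<partial>lborel)"
    unfolding set_lebesgue_integral_def
    by (rule Bochner_Integration.integral_cong) (auto simp: scaleR_conv_of_real)
  then show "truncated_fourier u n \<omega> = fint (trunc u n) \<omega>"
    by (simp add: truncated_fourier_def fint_def)
qed

lemma L2_mult_indicator: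
  fixes u :: "real \<Rightarrow> real"
  assumes "u \<in> L2 lborel" and [measurable]: "S \<in> sets borel"
  shows "(\<lambda>x. indicat_real S x * u x) \<in> L2 lborel"
proof (rule L2_bound[OF assms(1), where c = 1])
  have [measurable]: "u \<in> borel_measurable borel" using L2_measurable[OF assms(1)] by simp
  show "(\<lambda>x. indicat_real S x * u x) \<in> borel_measurable lborel" by measurable
qed (auto simp: indicator_def)

text \<open>The Cauchy-Schwarz inequality against the indicator. On the unit interval it bounds the
  L1 norm by the L2 norm, which the Poincare inequality uses.\<close>

lemma L2_integrable_on_bounded:
  fixes u :: "real \<Rightarrow> real"
  assumes u: "u \<in> L2 lborel" 
  shows "integrable lborel (\<lambda>x. indicat_real {a..b} x * u x)"
    and "(\<integral>x. \<bar>indicat_real {a..b} x * u x\<bar> \<partial>lborel) \<le> sqrt (max 0 (b - a)) * L2_norm lborel u"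
proof -
  have [measurable]: "u \<in> borel_measurable borel" using L2_measurable[OF u] by simp
  have i: "indicat_real {a..b} \<in> L2 lborel" "(L2_norm lborel (indicat_real {a..b}))\<^sup>2 = max 0 (b - a)"
  proof -
    have eq: "(\<lambda>x. (norm (indicat_real {a..b} x))\<^sup>2) = indicat_real {a..b}"
      by (auto simp: fun_eq_iff indicator_def)
    have "integrable lborel (indicat_real {a..b})" by (intro integrable_real_indicator) (auto simp: emeasure_lborel_Icc_eq)
    then show "indicat_real {a..b} \<in> L2 lborel" unfolding L2_def mem_Collect_eq eq by simp
    show "(L2_norm lborel (indicat_real {a..b}))\<^sup>2 = max 0 (b - a)" unfolding L2_norm_sq eq by simp
  qed
  have "integrable lborel (\<lambda>x. \<bar>indicat_real {a..b} x\<bar> * \<bar>u x\<bar>)"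
    using L2_mult_integrable[OF i(1) u] by simp
  then show "integrable lborel (\<lambda>x. indicat_real {a..b} x * u x)"
    by (rule Bochner_Integration.integrable_bound) (auto simp: abs_mult)
  have "L2_norm lborel (indicat_real {a..b}) = sqrt (max 0 (b - a))"
    unfolding i(2)[symmetric] by simp
  then show "(\<integral>x. \<bar>indicat_real {a..b} x * u x\<bar> \<partial>lborel) \<le> sqrt (max 0 (b - a)) * L2_norm lborel u"
    using L2_norm_mult_le[OF i(1) u] by (simp add: abs_mult)
qed

lemma trunc_tendsto:
  assumes u: "u \<in> L2 lborel"
  shows "L2_tendsto lborel (trunc u) u"
proof -
  have [measurable]: "u \<in> borel_measurable borel" using L2_measurable[OF u] by simp
  have d: "(\<lambda>x. trunc u n x - u x) \<in> L2 lborel" for n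
    by (intro L2_diff L2_mult_indicator u) simp
  have "(\<lambda>n. \<integral>x. (norm (trunc u n x - u x))\<^sup>2 \<partial>lborel) \<longlonglongrightarrow> (\<integral>x. 0 \<partial>(lborel :: real measure))"
  proof (rule integral_dominated_convergence[where w = "\<lambda>x. (norm (u x))\<^sup>2"])
    show "AE x in lborel. (\<lambda>n. (norm (trunc u n x - u x))\<^sup>2) \<longlonglongrightarrow> 0"
    proof (rule AE_I2)
      fix x :: real
      obtain N where "\<bar>x\<bar> \<le> real N" using real_arch_simple by blast
      then have "\<forall>\<^sub>F n in sequentially. (norm (trunc u n x - u x))\<^sup>2 = 0"
        by (intro eventually_sequentiallyI[of N]) (auto simp: indicator_def)
      then show "(\<lambda>n. (norm (trunc u n x - u x))\<^sup>2) \<longlonglongrightarrow> 0" by (rule tendsto_eventually)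
    qed
    show "AE x in lborel. norm ((norm (trunc u n x - u x))\<^sup>2) \<le> (norm (u x))\<^sup>2" for n
      by (auto simp: indicator_def)
    show "integrable lborel (\<lambda>x. (norm (u x))\<^sup>2)" by (rule L2_integrable[OF u])
  qed auto
  then have "(\<lambda>n. sqrt (\<integral>x. (norm (trunc u n x - u x))\<^sup>2 \<partial>lborel)) \<longlonglongrightarrow> sqrt 0"
    by (intro tendsto_real_sqrt) simp
  then show ?thesis using d by (simp add: L2_tendsto_def L2_norm_def)
qed

lemma fint_diff:
  assumes "integrable lborel f" "integrable lborel g"
  shows "fint f \<omega> - fint g \<omega> = fint (\<lambda>x. f x - g x) \<omega>"
  using fint_comb[OF assms, of "-1"] by simp

text \<open>Truncations of \<open>u\<close> are integrable and square integrable, so Plancherel's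
  identity for \<open>fint\<close> applies to their differences and carries their Cauchy property
  over to the truncated transforms.\<close>

lemma has_fourier_exists:
  assumes u: "u \<in> L2 lborel"
  shows "\<exists>F. has_fourier u F \<and> L2_norm lborel F = L2_norm lborel u"
proof -
  have i: "integrable lborel (trunc u n)" "trunc u n \<in> L2 lborel" for n
    by (rule L2_integrable_on_bounded[OF u], rule L2_mult_indicator[OF u]) simp
  have d: "L2_norm lborel (\<lambda>\<omega>. fint (trunc u m) \<omega> - fint (trunc u n) \<omega>) = L2_norm lborel (\<lambda>x. trunc u m x - trunc u n x)" for m n
    unfolding fint_diff[OF i(1) i(1)] by (intro Plancherel_fint Bochner_Integration.integrable_diff i L2_diff)
  have t: "fint (trunc u n) \<in> L2 lborel" for n by (rule fint_L2[OF i])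
  obtain F where F: "F \<in> L2 lborel" "L2_tendsto lborel (\<lambda>n. fint (trunc u n)) F"
    using L2_complete[OF t, unfolded d, OF L2_tendsto_Cauchy[OF trunc_tendsto[OF u]]] by blast
  have "(\<lambda>n. L2_norm lborel (trunc u n)) \<longlonglongrightarrow> L2_norm lborel F"
    using L2_tendsto_norm[OF F(2) t F(1)] by (simp add: Plancherel_fint[OF i])
  from LIMSEQ_unique[OF this L2_tendsto_norm[OF trunc_tendsto[OF u] i(2) u]]
  have "L2_norm lborel F = L2_norm lborel u" .
  with F show ?thesis by (auto simp: has_fourier_def truncated_fourier_eq[abs_def])
qed

lemma has_fourier_unique: "has_fourier u F \<Longrightarrow> has_fourier u G \<Longrightarrow> AE \<omega> in lborel. F \<omega> = G \<omega>"
  by (auto simp: has_fourier_def intro: L2_tendsto_unique)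

lemma has_fourier_fourier: "u \<in> L2 lborel \<Longrightarrow> has_fourier u (fourier u)"
  unfolding fourier_def using has_fourier_exists[of u] by (metis someI_ex)

lemma fourier_L2: "u \<in> L2 lborel \<Longrightarrow> fourier u \<in> L2 lborel"
  using has_fourier_fourier by (simp add: has_fourier_def)

lemma fourier_measurable: "u \<in> L2 lborel \<Longrightarrow> fourier u \<in> borel_measurable borel"
  using L2_measurable[OF fourier_L2] by simp

lemma Plancherel:
  assumes "u \<in> L2 lborel" shows "L2_norm lborel (fourier u) = L2_norm lborel u"
proof -
  obtain F where F: "has_fourier u F" "L2_norm lborel F = L2_norm lborel u"
    using has_fourier_exists[OF assms] by blast
  have "L2_norm lborel (fourier u) = L2_norm lborel F"
    using has_fourier_unique[OF has_fourier_fourier[OF assms] F(1)] F(1) fourier_measurable[OF assms]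
    by (intro L2_norm_cong_AE) (auto simp: has_fourier_def L2_def)
  with F(2) show ?thesis by simp
qed

lemma fourier_comb:
  assumes u: "u \<in> L2 lborel" and v: "v \<in> L2 lborel"
  shows "AE \<omega> in lborel. fourier (\<lambda>x. u x + c * v x) \<omega> = fourier u \<omega> + c *\<^sub>R fourier v \<omega>"
proof (rule has_fourier_unique)
  show "has_fourier (\<lambda>x. u x + c * v x) (fourier (\<lambda>x. u x + c * v x))"
    using L2_comb[OF u v, of c] by (intro has_fourier_fourier) simp
  have "truncated_fourier (\<lambda>x. u x + c * v x) = (\<lambda>n \<omega>. truncated_fourier u n \<omega> + c *\<^sub>R truncated_fourier v n \<omega>)"
    unfolding truncated_fourier_eq[abs_def]
    using fint_comb[OF L2_integrable_on_bounded(1)[OF u] L2_integrable_on_bounded(1)[OF v]]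
    by (simp add: algebra_simps fun_eq_iff)
  then show "has_fourier (\<lambda>x. u x + c * v x) (\<lambda>\<omega>. fourier u \<omega> + c *\<^sub>R fourier v \<omega>)"
    using L2_tendsto_comb[of lborel "truncated_fourier u" "fourier u" "truncated_fourier v" "fourier v" c]
      has_fourier_fourier[OF u] has_fourier_fourier[OF v] L2_comb[OF fourier_L2[OF u] fourier_L2[OF v], of c]
    by (simp add: has_fourier_def)
qed

text \<open>Gives pointwise access to the transform: the symbols of the derivatives and the Poincare
  inequality work with the integral, while the Sobolev norm is defined by the L2 limit.\<close>

lemma fourier_eq_fint:
  assumes u: "integrable lborel u" "u \<in> L2 lborel"
  shows "AE \<omega> in lborel. fourier u \<omega> = fint u \<omega>"
proof (rule has_fourier_unique[OF has_fourier_fourier[OF u(2)]])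
  have i: "integrable lborel (trunc u n)" "trunc u n \<in> L2 lborel" for n
    by (rule L2_integrable_on_bounded[OF u(2)], rule L2_mult_indicator[OF u(2)]) simp
  have d: "L2_norm lborel (\<lambda>\<omega>. fint (trunc u n) \<omega> - fint u \<omega>) = L2_norm lborel (\<lambda>x. trunc u n x - u x)" for n
    unfolding fint_diff[OF i(1) u(1)] by (intro Plancherel_fint Bochner_Integration.integrable_diff i u L2_diff)
  have "(\<lambda>\<omega>. fint (trunc u n) \<omega> - fint u \<omega>) \<in> L2 lborel" for n
    by (intro L2_diff fint_L2 i u)
  with d show "has_fourier u (fint u)"
    using fint_L2[OF u] trunc_tendsto[OF u(2)] by (simp add: has_fourier_def L2_tendsto_def truncated_fourier_eq)
qed

lemma Plancherel_ip:
  assumes u: "integrable lborel u" "u \<in> L2 lborel" and v: "integrable lborel v" "v \<in> L2 lborel"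
  shows "L2_ip lborel u v = L2_ip lborel (fint u) (fint v)"
proof -
  \<comment> \<open>Polarisation, stated for a general codomain because it is applied to real
    functions and to their transforms.\<close>
  have pol: "4 * L2_ip lborel f g = (L2_norm lborel (\<lambda>x. f x + 1 *\<^sub>R g x))\<^sup>2 - (L2_norm lborel (\<lambda>x. f x + (-1) *\<^sub>R g x))\<^sup>2"
    if fg: "f \<in> L2 lborel" "g \<in> L2 lborel" for f g :: "real \<Rightarrow> 'b::{second_countable_topology, banach, real_inner}"
    unfolding L2_ip_self[symmetric] L2_ip_comb_left[OF fg L2_comb[OF fg]]
    unfolding L2_ip_commute[of lborel _ "\<lambda>x. f x + c *\<^sub>R g x" for c] L2_ip_comb_left[OF fg fg(1)] L2_ip_comb_left[OF fg fg(2)]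
    by (simp add: L2_ip_commute[of lborel g f])
  have n: "L2_norm lborel (\<lambda>x. fint u x + c *\<^sub>R fint v x) = L2_norm lborel (\<lambda>x. u x + c *\<^sub>R v x)" for c
  proof -
    have eq: "(\<lambda>x. fint u x + c *\<^sub>R fint v x) = fint (\<lambda>x. u x + c * v x)"
      using fint_comb[OF u(1) v(1)] by auto
    have "L2_norm lborel (fint (\<lambda>x. u x + c * v x)) = L2_norm lborel (\<lambda>x. u x + c * v x)"
      using u v L2_comb[OF u(2) v(2), of c] by (intro Plancherel_fint) auto
    then show ?thesis unfolding eq by simp
  qed
  show ?thesis
    using pol[OF u(2) v(2)] pol[OF fint_L2[OF u] fint_L2[OF v]] unfolding n by simp
qed

section \<open>The Laplace transform of a power\<close>

lemma has_vector_derivative_iff_quotient: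
  "(f has_vector_derivative D) (at x) \<longleftrightarrow> ((\<lambda>t. (f t - f x) /\<^sub>R (t - x)) \<longlongrightarrow> D) (at x)"
proof -
  have "norm ((f t - f x) - (t - x) *\<^sub>R D) / norm (t - x) = norm ((f t - f x) /\<^sub>R (t - x) - D)" if "t \<noteq> x" for t
  proof -
    have "(f t - f x) /\<^sub>R (t - x) - D = ((f t - f x) - (t - x) *\<^sub>R D) /\<^sub>R (t - x)"
      using that by (simp add: scaleR_diff_right)
    then show ?thesis by (simp add: divide_inverse mult.commute)
  qed
  then have "((\<lambda>t. norm ((f t - f x) - (t - x) *\<^sub>R D) / norm (t - x)) \<longlongrightarrow> 0) (at x)
      \<longleftrightarrow> ((\<lambda>t. norm ((f t - f x) /\<^sub>R (t - x) - D)) \<longlongrightarrow> 0) (at x)"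
    by (intro tendsto_cong) (auto simp: eventually_at_filter)
  then show ?thesis
    by (simp add: has_vector_derivative_def has_derivative_iff_norm bounded_linear_scaleR_left tendsto_norm_zero_iff LIM_zero_iff)
qed

text \<open>The mean value inequality on the ball bounds every difference quotient by
  \<open>w\<close>, so dominated convergence applies along any sequence tending to
  \<open>t0\<close>.\<close>

lemma has_vector_derivative_integral:
  fixes f f' :: "real \<Rightarrow> 'a \<Rightarrow> 'b::{banach, second_countable_topology}"
  assumes \<delta>: "0 < \<delta>"
    and int: "\<And>t. t \<in> ball t0 \<delta> \<Longrightarrow> integrable M (f t)"
    and der: "\<And>t x. t \<in> ball t0 \<delta> \<Longrightarrow> x \<in> space M \<Longrightarrow> ((\<lambda>t. f t x) has_vector_derivative f' t x) (at t)"
    and bound: "\<And>t x. t \<in> ball t0 \<delta> \<Longrightarrow> x \<in> space M \<Longrightarrow> norm (f' t x) \<le> w x"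
    and w: "integrable M w" and meas: "f' t0 \<in> borel_measurable M"
  shows "((\<lambda>t. \<integral>x. f t x \<partial>M) has_vector_derivative (\<integral>x. f' t0 x \<partial>M)) (at t0)"
proof -
  let ?F = "\<lambda>t. \<integral>x. f t x \<partial>M"
  have t0: "t0 \<in> ball t0 \<delta>" using \<delta> by simp
  have int': "integrable M (f' t0)"
    by (rule Bochner_Integration.integrable_bound[OF w meas]) (use bound[OF t0] in \<open>auto intro!: AE_I2 intro: order_trans[OF _ abs_ge_self]\<close>)
  have "((\<lambda>t. (?F t - ?F t0) /\<^sub>R (t - t0)) \<longlongrightarrow> (\<integral>x. f' t0 x \<partial>M)) (at t0)"
    unfolding tendsto_at_iff_sequentially
  proof (intro allI impI)
    fix X :: "nat \<Rightarrow> real" assume X: "\<forall>i. X i \<in> UNIV - {t0}" "X \<longlonglongrightarrow> t0"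
    have "\<forall>\<^sub>F n in sequentially. X n \<in> ball t0 \<delta>"
      using X(2) t0 by (intro topological_tendstoD) auto
    then obtain N where N: "\<And>n. n \<ge> N \<Longrightarrow> X n \<in> ball t0 \<delta>" by (auto simp: eventually_sequentially)
    let ?q = "\<lambda>n x. (f (X n) x - f t0 x) /\<^sub>R (X n - t0)"
    have lim: "(\<lambda>n. \<integral>x. ?q (n + N) x \<partial>M) \<longlonglongrightarrow> (\<integral>x. f' t0 x \<partial>M)"
    proof (rule integral_dominated_convergence[OF meas _ w])
      show "?q (n + N) \<in> borel_measurable M" for n
        using int[OF N[of "n + N"]] int[OF t0] by auto
      show "AE x in M. (\<lambda>n. ?q (n + N) x) \<longlonglongrightarrow> f' t0 x"
      proof (rule AE_I2)
        fix x assume x: "x \<in> space M"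
        have "((\<lambda>t. (f t x - f t0 x) /\<^sub>R (t - t0)) \<longlongrightarrow> f' t0 x) (at t0)"
          using der[OF t0 x] by (simp only: has_vector_derivative_iff_quotient)
        then have "(\<lambda>n. ?q n x) \<longlonglongrightarrow> f' t0 x"
          unfolding tendsto_at_iff_sequentially using X by (auto simp: o_def)
        then show "(\<lambda>n. ?q (n + N) x) \<longlonglongrightarrow> f' t0 x" by (rule LIMSEQ_ignore_initial_segment)
      qed
      show "AE x in M. norm (?q (n + N) x) \<le> w x" for n
      proof (rule AE_I2)
        fix x assume x: "x \<in> space M"
        have "norm (f (X (n + N)) x - f t0 x) \<le> w x * norm (X (n + N) - t0)"
        proof (rule differentiable_bound[where S = "ball t0 \<delta>" and f' = "\<lambda>t h. h *\<^sub>R f' t x"])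
          fix t assume t: "t \<in> ball t0 \<delta>"
          show "((\<lambda>t. f t x) has_derivative (\<lambda>h. h *\<^sub>R f' t x)) (at t within ball t0 \<delta>)"
            using der[OF t x] unfolding has_vector_derivative_def by (rule has_derivative_at_withinI)
          show "onorm (\<lambda>h. h *\<^sub>R f' t x) \<le> w x"
            using bound[OF t x] by (intro onorm_le) (simp add: mult.commute mult_left_mono)
        qed (use N[of "n + N"] t0 in auto)
        moreover have "X (n + N) \<noteq> t0" using X(1) by auto
        ultimately show "norm (?q (n + N) x) \<le> w x"
          by (simp add: divide_inverse[symmetric] divide_le_eq mult.commute[of "inverse _"])
      qed
    qed
    have "(\<integral>x. ?q (n + N) x \<partial>M) = (?F (X (n + N)) - ?F t0) /\<^sub>R (X (n + N) - t0)" for n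
      by (simp only: integral_scaleR_right Bochner_Integration.integral_diff[OF int[OF N[OF le_add2]] int[OF t0]])
    with lim have "(\<lambda>n. (?F (X (n + N)) - ?F t0) /\<^sub>R (X (n + N) - t0)) \<longlonglongrightarrow> (\<integral>x. f' t0 x \<partial>M)"
      by (simp only:)
    then show "((\<lambda>t. (?F t - ?F t0) /\<^sub>R (t - t0)) \<circ> X) \<longlonglongrightarrow> (\<integral>x. f' t0 x \<partial>M)"
      unfolding o_def by (rule LIMSEQ_offset)
  qed
  then show ?thesis by (simp only: has_vector_derivative_iff_quotient)
qed

text \<open>The unnormalised Gamma density, set to 0 on the left half-line so that all integrals
  range over the line. With \<epsilon> = 0 it is the bare power.\<close>

definition power_exp :: "real \<Rightarrow> real \<Rightarrow> real \<Rightarrow> real" where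
  "power_exp a \<epsilon> y = (if 0 < y then y powr (a - 1) * exp (- \<epsilon> * y) else 0)"

lemma power_exp_measurable [measurable]: "power_exp a \<epsilon> \<in> borel_measurable borel"
  unfolding power_exp_def[abs_def] by measurable

lemma power_exp_nonneg: "0 \<le> power_exp a \<epsilon> y"
  by (simp add: power_exp_def)

lemma power_exp_one:
  assumes "0 < a"
  shows "integrable lborel (power_exp a 1)" "(\<integral>y. power_exp a 1 y \<partial>lborel) = Gamma a"
proof -
  have "(\<integral>\<^sup>+y. ennreal (power_exp a 1 y) \<partial>lborel) = (\<integral>\<^sup>+t. ennreal (indicator {0..} t * t powr (a - 1) / exp t) \<partial>lborel)"
    by (intro nn_integral_cong arg_cong[where f = ennreal])
       (auto simp: power_exp_def indicator_def exp_minus field_simps)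
  also have "\<dots> = ennreal (Gamma a)" using Gamma_conv_nn_integral_real[OF assms] by simp
  finally have nn: "(\<integral>\<^sup>+y. ennreal (power_exp a 1 y) \<partial>lborel) = ennreal (Gamma a)" .
  show "integrable lborel (power_exp a 1)"
    by (rule integrableI_nonneg) (auto simp: power_exp_nonneg nn)
  show "(\<integral>y. power_exp a 1 y \<partial>lborel) = Gamma a"
    using assms by (intro integral_eq_nn_integral[THEN trans]) (auto simp: power_exp_nonneg nn Gamma_real_pos less_imp_le)
qed

lemma power_exp_scale:
  assumes "0 < \<epsilon>" shows "power_exp a 1 (0 + \<epsilon> * y) = \<epsilon> powr (a - 1) * power_exp a \<epsilon> y"
  using assms by (auto simp: power_exp_def powr_mult zero_less_mult_iff)

lemma
  assumes "0 < a" "0 < \<epsilon>"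
  shows power_exp_integrable: "integrable lborel (power_exp a \<epsilon>)"
    and power_exp_integral: "(\<integral>y. power_exp a \<epsilon> y \<partial>lborel) = Gamma a * \<epsilon> powr (- a)"
proof -
  have p: "\<epsilon> powr (a - 1) > 0" using assms by simp
  have "integrable lborel (\<lambda>y. \<epsilon> powr (a - 1) * power_exp a \<epsilon> y)"
    using lborel_integrable_real_affine[OF power_exp_one(1)[OF assms(1)], of \<epsilon> 0] assms
    unfolding power_exp_scale[OF assms(2)] by simp
  then show "integrable lborel (power_exp a \<epsilon>)" using p by simp
  have "Gamma a = \<bar>\<epsilon>\<bar> *\<^sub>R (\<integral>y. \<epsilon> powr (a - 1) * power_exp a \<epsilon> y \<partial>lborel)"
    using lborel_integral_real_affine[of \<epsilon> "power_exp a 1" 0] assms power_exp_one(2)[OF assms(1)]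
    unfolding power_exp_scale[OF assms(2)] by simp
  also have "\<dots> = \<epsilon> powr a * (\<integral>y. power_exp a \<epsilon> y \<partial>lborel)"
    using assms by (simp add: powr_diff)
  finally show "(\<integral>y. power_exp a \<epsilon> y \<partial>lborel) = Gamma a * \<epsilon> powr (- a)"
    using assms by (simp add: powr_minus field_simps)
qed

text \<open>Without the factor \<open>1 / sqrt (2 * pi)\<close>, so that this is the Laplace
  transform of a power at \<epsilon> + i \<omega>.\<close>

definition power_exp_fourier :: "real \<Rightarrow> real \<Rightarrow> real \<Rightarrow> complex" where
  "power_exp_fourier a \<epsilon> \<omega> = (\<integral>y. complex_of_real (power_exp a \<epsilon> y) * cis (- (\<omega> * y)) \<partial>lborel)"

lemma power_exp_suc: "y * power_exp a \<epsilon> y = power_exp (a + 1) \<epsilon> y"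
  by (auto simp: power_exp_def powr_diff)

lemma power_exp_fourier_deriv:
  assumes "0 < a" "0 < \<epsilon>"
  shows "(power_exp_fourier a \<epsilon> has_vector_derivative - \<i> * power_exp_fourier (a + 1) \<epsilon> \<omega>) (at \<omega>)"
proof -
  let ?f = "\<lambda>\<omega> y. complex_of_real (power_exp a \<epsilon> y) * cis (- (\<omega> * y))"
  let ?f' = "\<lambda>\<omega> y. - \<i> * (complex_of_real (power_exp (a + 1) \<epsilon> y) * cis (- (\<omega> * y)))"
  have "((\<lambda>\<omega>. \<integral>y. ?f \<omega> y \<partial>lborel) has_vector_derivative (\<integral>y. ?f' \<omega> y \<partial>lborel)) (at \<omega>)"
  proof (rule has_vector_derivative_integral[where \<delta> = 1 and w = "power_exp (a + 1) \<epsilon>"])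
    show "integrable lborel (?f t)" for t
      by (rule fint_integrand_integrable[OF power_exp_integrable[OF assms]])
    show "integrable lborel (power_exp (a + 1) \<epsilon>)" using assms by (intro power_exp_integrable) auto
    show "?f' \<omega> \<in> borel_measurable lborel" by measurable
    show "norm (?f' t y) \<le> power_exp (a + 1) \<epsilon> y" for t y
      by (simp add: norm_mult power_exp_nonneg)
    show "((\<lambda>t. ?f t y) has_vector_derivative ?f' t y) (at t)" for t y
    proof -
      have "((\<lambda>t. cis (- (t * y))) has_vector_derivative (- y) *\<^sub>R (\<i> * cis (- (t * y)))) (at t)"
        unfolding cis_conv_exp
        by (auto intro!: derivative_eq_intros has_vector_derivative_real_field simp: scaleR_conv_of_real)
      from has_vector_derivative_mult_right[OF this, of "complex_of_real (power_exp a \<epsilon> y)"]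
      show ?thesis by (simp add: power_exp_suc[symmetric] scaleR_conv_of_real mult_ac)
    qed
  qed simp
  then show ?thesis by (simp add: power_exp_fourier_def[abs_def])
qed

text \<open>Integration by parts: y^a exp (- (\<epsilon> + i \<omega>) y) vanishes at 0 because a >
  0 and at infinity because \<epsilon> > 0, so its derivative integrates to 0.\<close>

lemma power_exp_fourier_parts:
  assumes "0 < a" "0 < \<epsilon>"
  shows "(complex_of_real \<epsilon> + \<i> * \<omega>) * power_exp_fourier (a + 1) \<epsilon> \<omega> = of_real a * power_exp_fourier a \<epsilon> \<omega>"
proof -
  let ?p = "complex_of_real \<epsilon> + \<i> * complex_of_real \<omega>"
  let ?F = "\<lambda>y. complex_of_real (y powr a) * exp (- ?p * complex_of_real y)"
  let ?f = "\<lambda>y. complex_of_real a * (complex_of_real (power_exp a \<epsilon> y) * cis (- (\<omega> * y))) - ?p * (complex_of_real (power_exp (a + 1) \<epsilon> y) * cis (- (\<omega> * y)))"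
  have I: "integrable lborel (\<lambda>y. complex_of_real (power_exp a \<epsilon> y) * cis (- (\<omega> * y)))"
    "integrable lborel (\<lambda>y. complex_of_real (power_exp (a + 1) \<epsilon> y) * cis (- (\<omega> * y)))"
    using assms by (intro fint_integrand_integrable power_exp_integrable; simp)+
  then have int: "integrable lborel ?f" by simp
  have e: "exp (- ?p * complex_of_real y) = complex_of_real (exp (- \<epsilon> * y)) * cis (- (\<omega> * y))" for y
  proof -
    have "- ?p * complex_of_real y = complex_of_real (- \<epsilon> * y) + \<i> * complex_of_real (- (\<omega> * y))"
      by (simp add: algebra_simps)
    then show ?thesis by (simp only: exp_add cis_conv_exp exp_of_real)
  qed
  have nF: "norm (?F y) = y powr a * exp (- \<epsilon> * y)" for y
    unfolding e by (simp add: norm_mult)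
  have "(LBINT y=0..\<infinity>. ?f y) = 0 - 0"
  proof (rule interval_integral_FTC_integrable[where F = ?F])
    fix y :: real assume "0 < ereal y" "ereal y < \<infinity>"
    then have y: "0 < y" by simp
    have pe: "((\<lambda>y. exp (- ?p * complex_of_real y)) has_vector_derivative - ?p * exp (- ?p * complex_of_real y)) (at y)"
      by (rule has_vector_derivative_real_field) (auto intro!: derivative_eq_intros)
    have pp: "((\<lambda>y. complex_of_real (y powr a)) has_vector_derivative complex_of_real (a * y powr (a - 1))) (at y)"
      using has_real_derivative_powr[OF y, of a]
      by (intro has_vector_derivative_of_real) (simp add: has_real_derivative_iff_has_vector_derivative)
    have eq: "?f y = complex_of_real (y powr a) * (- ?p * exp (- ?p * complex_of_real y))
        + complex_of_real (a * y powr (a - 1)) * exp (- ?p * complex_of_real y)"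
    proof -
      have pw: "power_exp a \<epsilon> y = y powr (a - 1) * exp (- \<epsilon> * y)" "power_exp (a + 1) \<epsilon> y = y powr a * exp (- \<epsilon> * y)"
        using y by (simp_all add: power_exp_def)
      have "b * (complex_of_real (u * g) * c) - p * (complex_of_real (v * g) * c)
          = complex_of_real v * (- p * (complex_of_real g * c)) + (b * complex_of_real u) * (complex_of_real g * c)"
        for b c p and u v g :: real
        by (simp add: algebra_simps)
      then show ?thesis unfolding pw e of_real_mult[of a] .
    qed
    from has_vector_derivative_mult[OF pp pe]
    show "(?F has_vector_derivative ?f y) (at y)" by (simp only: eq)
    \<comment> \<open>\<open>power_exp\<close> is defined by cases; near a positive \<open>y\<close>
      the case is fixed, and the closed form \<open>?g\<close> is visibly continuous.\<close>
    let ?g = "\<lambda>y. complex_of_real a * (complex_of_real (y powr (a - 1) * exp (- \<epsilon> * y)) * cis (- (\<omega> * y)))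
        - ?p * (complex_of_real (y powr a * exp (- \<epsilon> * y)) * cis (- (\<omega> * y)))"
    have "\<forall>\<^sub>F z in nhds y. z \<in> {0<..}" using y by (intro eventually_nhds_in_open) auto
    then have "\<forall>\<^sub>F z in nhds y. ?f z = ?g z"
      by eventually_elim (simp add: power_exp_def)
    moreover have "continuous_on {0<..} ?g"
      by (intro continuous_intros) auto
    then have "isCont ?g y"
      using y by (simp add: continuous_on_eq_continuous_at)
    ultimately show "isCont ?f y" by (simp only: isCont_cong)
  next
    show "set_integrable lborel (einterval 0 \<infinity>) ?f"
      unfolding set_integrable_def using int by (intro integrable_mult_indicator) auto
    have "((\<lambda>y. norm (?F y)) \<longlongrightarrow> 0) (at_right 0)"
      unfolding nF using assms by real_asymp
    then have "(?F \<longlongrightarrow> 0) (at_right 0)" by (rule tendsto_norm_zero_cancel)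
    then show "((?F \<circ> real_of_ereal) \<longlongrightarrow> 0) (at_right 0)"
      unfolding zero_ereal_def ereal_tendsto_simps .
    have "((\<lambda>y. norm (?F y)) \<longlongrightarrow> 0) at_top"
      unfolding nF using assms by real_asymp
    then have "(?F \<longlongrightarrow> 0) at_top" by (rule tendsto_norm_zero_cancel)
    then show "((?F \<circ> real_of_ereal) \<longlongrightarrow> 0) (at_left \<infinity>)"
      unfolding ereal_tendsto_simps .
  qed simp
  moreover have "(LBINT y=0..\<infinity>. ?f y) = (\<integral>y. ?f y \<partial>lborel)"
    unfolding interval_lebesgue_integral_def set_lebesgue_integral_def
    by (auto intro!: Bochner_Integration.integral_cong simp: indicator_def einterval_def power_exp_def)
  ultimately have "(\<integral>y. ?f y \<partial>lborel) = 0" by simp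
  then show ?thesis using I by (simp add: power_exp_fourier_def)
qed

text \<open>The derivative in \<omega> and the integration by parts combine into a first order
  differential equation saying that the transform times (\<epsilon> + i \<omega>)^a is constant. The
  constant is read off at \<omega> = 0 from the Gamma integral, so no contour has to be rotated.
  Since \<epsilon> > 0, the base stays off the branch cut.\<close>

lemma power_exp_fourier_eq:
  assumes a: "0 < a" and \<epsilon>: "0 < \<epsilon>"
  shows "power_exp_fourier a \<epsilon> \<omega> = complex_of_real (Gamma a) * (complex_of_real \<epsilon> + \<i> * complex_of_real \<omega>) powr (- complex_of_real a)"
proof -
  let ?p = "\<lambda>\<omega>. complex_of_real \<epsilon> + \<i> * complex_of_real \<omega>"
  let ?A = "complex_of_real a"
  have p: "?p \<omega> \<notin> \<real>\<^sub>\<le>\<^sub>0" "?p \<omega> \<noteq> 0" for \<omega>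
    using \<epsilon> by (auto simp: complex_nonpos_Reals_iff complex_eq_iff)
  have "((\<lambda>\<omega>. power_exp_fourier a \<epsilon> \<omega> * ?p \<omega> powr ?A) has_vector_derivative 0) (at \<omega>)" for \<omega>
  proof -
    have "((\<lambda>z. (complex_of_real \<epsilon> + \<i> * z) powr ?A) has_field_derivative ?A * ?p \<omega> powr (?A - 1) * \<i>) (at (complex_of_real \<omega>))"
      using p by (auto intro!: derivative_eq_intros)
    then have d: "((\<lambda>\<omega>. ?p \<omega> powr ?A) has_vector_derivative ?A * ?p \<omega> powr (?A - 1) * \<i>) (at \<omega>)"
      by (rule has_vector_derivative_real_field)
    have "power_exp_fourier (a + 1) \<epsilon> \<omega> = ?A * power_exp_fourier a \<epsilon> \<omega> / ?p \<omega>"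
      using power_exp_fourier_parts[OF a \<epsilon>, of \<omega>] p(2)[of \<omega>]
      by (subst nonzero_eq_divide_eq) (simp_all add: mult.commute)
    moreover have "?p \<omega> powr (?A - 1) = ?p \<omega> powr ?A / ?p \<omega>"
      using p(2)[of \<omega>] by (simp add: powr_diff)
    ultimately have "power_exp_fourier a \<epsilon> \<omega> * (?A * ?p \<omega> powr (?A - 1) * \<i>) + - \<i> * power_exp_fourier (a + 1) \<epsilon> \<omega> * ?p \<omega> powr ?A = 0"
      by simp
    with has_vector_derivative_mult[OF power_exp_fourier_deriv[OF a \<epsilon>] d] show ?thesis
      by (simp only:)
  qed
  then have "power_exp_fourier a \<epsilon> \<omega> * ?p \<omega> powr ?A = power_exp_fourier a \<epsilon> 0 * ?p 0 powr ?A"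
    using has_vector_derivative_zero_constant[of UNIV "\<lambda>\<omega>. power_exp_fourier a \<epsilon> \<omega> * ?p \<omega> powr ?A"]
    by (metis UNIV_I convex_UNIV)
  also have "power_exp_fourier a \<epsilon> 0 = complex_of_real (Gamma a * \<epsilon> powr (- a))"
    unfolding power_exp_integral[OF a \<epsilon>, symmetric] by (simp add: power_exp_fourier_def)
  also have "?p 0 powr ?A = complex_of_real (\<epsilon> powr a)"
    using \<epsilon> by (simp add: powr_of_real)
  also have "complex_of_real (Gamma a * \<epsilon> powr (- a)) * \<dots> = complex_of_real (Gamma a * (\<epsilon> powr (- a) * \<epsilon> powr a))"
    by (simp only: of_real_mult mult.assoc)
  also have "\<epsilon> powr (- a) * \<epsilon> powr a = 1"
    using \<epsilon> by (simp add: powr_add[symmetric])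
  finally have "power_exp_fourier a \<epsilon> \<omega> * ?p \<omega> powr ?A = complex_of_real (Gamma a)" by (simp only: mult_1_right)
  moreover have "?p \<omega> powr ?A \<noteq> 0" using p(2)[of \<omega>] by (simp add: powr_eq_0_iff)
  ultimately have "power_exp_fourier a \<epsilon> \<omega> = complex_of_real (Gamma a) / ?p \<omega> powr ?A"
    by (subst nonzero_eq_divide_eq) simp_all
  then show ?thesis by (simp only: powr_minus divide_inverse)
qed

section \<open>Riemann--Liouville derivatives of smooth functions\<close>

lemma Om_integral:
  fixes f :: "real \<Rightarrow> 'b::{banach, second_countable_topology}"
  shows "(\<integral>x. f x \<partial>Om) = (\<integral>x. indicat_real {0<..<1} x *\<^sub>R f x \<partial>lborel)"
  by (rule integral_restrict_space) simp

lemma Om_integrable: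
  fixes f :: "real \<Rightarrow> 'b::{banach, second_countable_topology}"
  shows "integrable Om f \<longleftrightarrow> integrable lborel (\<lambda>x. indicat_real {0<..<1} x *\<^sub>R f x)"
  by (rule integrable_restrict_space) simp

lemma space_Om [simp]: "space Om = {0<..<1}"
  by (simp add: space_restrict_space)

lemma finite_measure_Om: "finite_measure Om"
  by (rule finite_measureI) (simp add: emeasure_restrict_space)

lemma Om_measurable: "f \<in> borel_measurable borel \<Longrightarrow> f \<in> borel_measurable Om"
  by (rule measurable_restrict_space1) simp

lemma L2_Om:
  fixes f :: "real \<Rightarrow> 'b::{banach, second_countable_topology}"
  assumes "f \<in> L2 lborel"
  shows "f \<in> L2 Om" "L2_norm Om f \<le> L2_norm lborel f"
proof -
  have m: "f \<in> borel_measurable borel" using L2_measurable[OF assms] by simp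
  have i: "integrable lborel (\<lambda>x. indicat_real {0<..<1} x *\<^sub>R (norm (f x))\<^sup>2)"
    using L2_integrable[OF assms] by (intro integrable_mult_indicator) auto
  show "f \<in> L2 Om"
    unfolding L2_def mem_Collect_eq Om_integrable by (intro conjI Om_measurable m i)
  show "L2_norm Om f \<le> L2_norm lborel f"
    unfolding L2_norm_def Om_integral
    by (intro real_sqrt_le_mono integral_mono i L2_integrable[OF assms]) (auto simp: indicator_def)
qed

section \<open>Continuously differentiable functions supported in the interval\<close>

lemma continuous_supported:
  fixes g :: "real \<Rightarrow> real"
  assumes g: "continuous_on UNIV g" and supp: "\<And>x. x \<notin> {0<..<1} \<Longrightarrow> g x = 0"
  shows "\<exists>M. \<forall>x. \<bar>g x\<bar> \<le> M" "g \<in> borel_measurable borel" "integrable lborel g" "g \<in> L2 lborel"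
proof -
  have "compact (g ` {0..1})" by (intro compact_continuous_image continuous_on_subset[OF g]) auto
  then have "bounded (g ` {0..1})" by (rule compact_imp_bounded)
  then obtain M where "\<forall>y\<in>g ` {0..1}. norm y \<le> M" unfolding bounded_iff by blast
  then have M: "\<And>x. x \<in> {0..1} \<Longrightarrow> norm (g x) \<le> M" by blast
  have M0: "0 \<le> M" using M[of 0] norm_ge_zero[of "g 0"] by simp
  have bd: "\<bar>g x\<bar> \<le> M" for x using M[of x] M0 supp[of x] by (cases "x \<in> {0<..<1}") auto
  then show "\<exists>M. \<forall>x. \<bar>g x\<bar> \<le> M" by blast
  show m: "g \<in> borel_measurable borel" by (rule borel_measurable_continuous_onI[OF g])
  have c: "integrable lborel (\<lambda>x. indicat_real {0..1::real} x *\<^sub>R M)"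
    by (intro integrable_scaleR_left integrable_real_indicator) auto
  show i: "integrable lborel g"
    by (rule Bochner_Integration.integrable_bound[OF c]) (use m bd M0 supp in \<open>auto simp: indicator_def intro!: AE_I2\<close>)
  have "integrable lborel (\<lambda>x. (norm (g x))\<^sup>2)"
  proof (rule Bochner_Integration.integrable_bound)
    show "integrable lborel (\<lambda>x. M * \<bar>g x\<bar>)" using i by simp
    show "(\<lambda>x. (norm (g x))\<^sup>2) \<in> borel_measurable lborel" using m by measurable
    have "norm ((norm (g x))\<^sup>2) \<le> norm (M * \<bar>g x\<bar>)" for x
      using mult_right_mono[OF bd[of x] abs_ge_zero[of "g x"]] M0 by (simp add: power2_eq_square abs_mult)
    then show "AE x in lborel. norm ((norm (g x))\<^sup>2) \<le> norm (M * \<bar>g x\<bar>)" by simp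
  qed
  then show "g \<in> L2 lborel" using m by (simp add: L2_def)
qed

text \<open>What the fractional calculus uses of a test function. The derivative is carried along as
  a second argument because most formulas below convolve with it.\<close>

definition C1_supported :: "(real \<Rightarrow> real) \<Rightarrow> (real \<Rightarrow> real) \<Rightarrow> bool" where
  "C1_supported \<phi> \<psi> \<longleftrightarrow> (\<forall>x. (\<phi> has_real_derivative \<psi> x) (at x)) \<and> continuous_on UNIV \<psi> \<and>
     (\<forall>x. x \<notin> {0<..<1} \<longrightarrow> \<phi> x = 0 \<and> \<psi> x = 0)"

lemma C1_supported_props:
  assumes "C1_supported \<phi> \<psi>"
  shows "(\<phi> has_real_derivative \<psi> x) (at x)" "continuous_on UNIV \<psi>" "continuous_on UNIV \<phi>"
    "x \<notin> {0<..<1} \<Longrightarrow> \<phi> x = 0" "x \<notin> {0<..<1} \<Longrightarrow> \<psi> x = 0"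
  using assms unfolding C1_supported_def
  by (auto intro!: DERIV_isCont continuous_at_imp_continuous_on)

lemmas C1_supported_fun = continuous_supported[OF C1_supported_props(3) C1_supported_props(4)]
lemmas C1_supported_derivative = continuous_supported[OF C1_supported_props(2) C1_supported_props(5)]

text \<open>Integration by parts on [0, 1]; the boundary terms vanish because \<phi> is 0 at both
  ends.\<close>

lemma fint_derivative:
  assumes "C1_supported \<phi> \<psi>"
  shows "fint \<psi> \<omega> = \<i> * of_real \<omega> * fint \<phi> \<omega>"
proof -
  note C = C1_supported_props[OF assms]
  let ?e = "\<lambda>x. cis (- (\<omega> * x))"
  let ?F = "\<lambda>x. complex_of_real (\<phi> x) * ?e x"
  let ?f = "\<lambda>x. complex_of_real (\<psi> x) * ?e x - \<i> * of_real \<omega> * (complex_of_real (\<phi> x) * ?e x)"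
  have i: "integrable lborel (\<lambda>x. complex_of_real (\<psi> x) * ?e x)" "integrable lborel (\<lambda>x. complex_of_real (\<phi> x) * ?e x)"
    using fint_integrand_integrable C1_supported_fun(3)[OF assms assms] C1_supported_derivative(3)[OF assms assms] by blast+
  have "(\<integral>x. indicat_real {0..1} x *\<^sub>R ?f x \<partial>lborel) = ?F 1 - ?F 0"
  proof (rule integral_FTC_Icc)
    fix x :: real
    have d1: "((\<lambda>x. complex_of_real (\<phi> x)) has_vector_derivative complex_of_real (\<psi> x)) (at x)"
      using C(1)[of x] by (intro has_vector_derivative_of_real) (simp add: has_real_derivative_iff_has_vector_derivative)
    have d2: "(?e has_vector_derivative (- \<omega>) *\<^sub>R (\<i> * ?e x)) (at x)"
      unfolding cis_conv_exp
      by (auto intro!: derivative_eq_intros has_vector_derivative_real_field simp: scaleR_conv_of_real)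
    have "(?F has_vector_derivative complex_of_real (\<phi> x) * ((- \<omega>) *\<^sub>R (\<i> * ?e x)) + complex_of_real (\<psi> x) * ?e x) (at x)"
      by (rule has_vector_derivative_mult[OF d1 d2])
    moreover have "complex_of_real (\<phi> x) * ((- \<omega>) *\<^sub>R (\<i> * ?e x)) + complex_of_real (\<psi> x) * ?e x = ?f x"
      by (simp add: scaleR_conv_of_real)
    ultimately have "(?F has_vector_derivative ?f x) (at x)" by (simp only:)
    then show "(?F has_vector_derivative ?f x) (at x within {0..1})"
      by (rule has_vector_derivative_at_within)
  next
    have c: "continuous_on {0..1} \<phi>" "continuous_on {0..1} \<psi>"
      using C(2,3) continuous_on_subset by blast+
    show "continuous_on {0..1} ?f"
      by (intro continuous_on_diff continuous_on_mult continuous_on_of_real c continuous_on_cis continuous_on_const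
          continuous_on_minus continuous_on_id)
  qed simp
  also have "(\<lambda>x. indicat_real {0..1} x *\<^sub>R ?f x) = ?f"
    using C(4,5) by (auto simp: fun_eq_iff indicator_def)
  finally have "(\<integral>x. ?f x \<partial>lborel) = 0" using C(4)[of 0] C(4)[of 1] by simp
  then have "(\<integral>x. complex_of_real (\<psi> x) * ?e x \<partial>lborel) = \<i> * of_real \<omega> * (\<integral>x. complex_of_real (\<phi> x) * ?e x \<partial>lborel)"
    using i by simp
  then show ?thesis by (simp add: fint_def)
qed

section \<open>Convolution with integrable and with locally integrable kernels\<close>

lemma conv_bounded_L2:
  assumes k: "integrable lborel k" and g: "integrable lborel g" and M: "\<And>x. \<bar>g x\<bar> \<le> M"
  shows "conv k g \<in> L2 lborel"
proof -
  have [measurable]: "k \<in> borel_measurable borel" "g \<in> borel_measurable borel" using k g by auto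
  have M0: "0 \<le> M" using M[of 0] abs_ge_zero order_trans by blast
  let ?B = "\<integral>y. \<bar>k y\<bar> * M \<partial>lborel"
  have bd: "\<bar>conv k g x\<bar> \<le> ?B" for x
    unfolding conv_def
  proof (rule order_trans[OF integral_abs_bound], rule integral_mono_AE')
    show "integrable lborel (\<lambda>y. \<bar>k y\<bar> * M)" using k by simp
    have "\<bar>k y * g (x - y)\<bar> \<le> \<bar>k y\<bar> * M" for y
      unfolding abs_mult by (intro mult_left_mono M) simp
    then show "AE y in lborel. \<bar>k y * g (x - y)\<bar> \<le> \<bar>k y\<bar> * M" by simp
  qed (use M0 in auto)
  \<comment> \<open>A bounded integrable function is square integrable: its square is at most the
    bound times its modulus.\<close>
  have "integrable lborel (\<lambda>x. (norm (conv k g x))\<^sup>2)"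
  proof (rule Bochner_Integration.integrable_bound)
    show "integrable lborel (\<lambda>x. ?B * \<bar>conv k g x\<bar>)" using conv_integrable[OF k g] by simp
    have "norm ((norm (conv k g x))\<^sup>2) \<le> norm (?B * \<bar>conv k g x\<bar>)" for x
      using mult_right_mono[OF order_trans[OF bd[of x] abs_ge_self] abs_ge_zero[of "conv k g x"]]
      by (simp add: power2_eq_square abs_mult)
    then show "AE x in lborel. norm ((norm (conv k g x))\<^sup>2) \<le> norm (?B * \<bar>conv k g x\<bar>)" by simp
  qed measurable
  then show ?thesis by (simp add: L2_def)
qed

text \<open>\<open>g\<close> lives on (0, 1), so the kernel is seen only for \<open>z\<close>
  between \<open>x - 1\<close> and \<open>x\<close>; for \<open>x\<close> in (-1, 2) this lies in
  [-2, 2]. Bounds on the kernel are therefore asked only there, which admits the undamped power. The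
  interval (-1, 2) leaves room for a unit ball about every point of (0, 1), as differentiation
  requires.\<close>

lemma
  assumes g: "\<And>x. \<bar>g x\<bar> \<le> M" "\<And>x. x \<notin> {0<..<1} \<Longrightarrow> g x = 0" and [measurable]: "g \<in> borel_measurable borel"
    and w: "integrable lborel w" and w0: "\<And>z. 0 \<le> w z"
    and [measurable]: "\<And>n. k n \<in> borel_measurable borel"
    and bd: "\<And>n z. \<bar>z\<bar> \<le> 2 \<Longrightarrow> \<bar>k n z\<bar> \<le> w z" and x: "x \<in> {-1<..<2::real}"
  shows conv_local_integrable: "integrable lborel (\<lambda>z. k n z * g (x - z))"
    and conv_local_bound: "\<bar>conv (k n) g x\<bar> \<le> M * (\<integral>z. w z \<partial>lborel)"
    and conv_local_tendsto: "k0 \<in> borel_measurable borel \<Longrightarrow> (\<And>z. (\<lambda>n. k n z) \<longlonglongrightarrow> k0 z) \<Longrightarrow> (\<lambda>n. conv (k n) g x) \<longlonglongrightarrow> conv k0 g x"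
proof -
  have M0: "0 \<le> M" using g(1)[of 0] abs_ge_zero order_trans by blast
  have le: "\<bar>k n z * g (x - z)\<bar> \<le> M * w z" for n z
  proof (cases "x - z \<in> {0<..<1}")
    case True
    then have "\<bar>z\<bar> \<le> 2" using x by auto
    then show ?thesis using mult_mono[OF bd[of z n] g(1)[of "x - z"]] w0[of z] by (simp add: abs_mult mult.commute)
  next
    case False
    then show ?thesis using g(2) M0 w0[of z] by simp
  qed
  have wi: "integrable lborel (\<lambda>z. M * w z)" using w by simp
  show i: "integrable lborel (\<lambda>z. k n z * g (x - z))"
    by (rule Bochner_Integration.integrable_bound[OF wi]) (use le in \<open>auto intro!: AE_I2 intro: order_trans[OF _ abs_ge_self]\<close>)
  have "\<bar>conv (k n) g x\<bar> \<le> (\<integral>z. M * w z \<partial>lborel)"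
    unfolding conv_def
    by (rule order_trans[OF integral_abs_bound], rule integral_mono) (use i wi le in auto)
  then show "\<bar>conv (k n) g x\<bar> \<le> M * (\<integral>z. w z \<partial>lborel)" by simp
  assume [measurable]: "k0 \<in> borel_measurable borel" and lim: "\<And>z. (\<lambda>n. k n z) \<longlonglongrightarrow> k0 z"
  show "(\<lambda>n. conv (k n) g x) \<longlonglongrightarrow> conv k0 g x"
    unfolding conv_def
    by (rule integral_dominated_convergence[OF _ _ wi]) (use le lim in \<open>auto intro!: AE_I2 tendsto_mult_right\<close>)
qed

text \<open>The fractional kernel is singular at 0, so the derivative is put on the smooth factor,
  where the integrable majorant of the kernel controls it.\<close>

lemma conv_has_derivative:
  assumes \<phi>: "C1_supported \<phi> \<psi>" and w: "integrable lborel w" "\<And>z. 0 \<le> w z"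
    and k [measurable]: "k \<in> borel_measurable borel" and bd: "\<And>z. \<bar>z\<bar> \<le> 2 \<Longrightarrow> \<bar>k z\<bar> \<le> w z" and x: "x \<in> {0<..<1}"
  shows "(conv k \<phi> has_real_derivative conv k \<psi> x) (at x)"
proof -
  note C = C1_supported_props[OF \<phi>]
  obtain M where M: "\<And>x. \<bar>\<phi> x\<bar> \<le> M" using C1_supported_fun(1)[OF \<phi> \<phi>] by blast
  obtain M' where M': "\<And>x. \<bar>\<psi> x\<bar> \<le> M'" using C1_supported_derivative(1)[OF \<phi> \<phi>] by blast
  have M0: "0 \<le> M'" using M'[of 0] abs_ge_zero order_trans by blast
  have [measurable]: "\<phi> \<in> borel_measurable borel" "\<psi> \<in> borel_measurable borel"
    using C1_supported_fun(2)[OF \<phi> \<phi>] C1_supported_derivative(2)[OF \<phi> \<phi>] by auto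
  have "((\<lambda>t. \<integral>z. k z * \<phi> (t - z) \<partial>lborel) has_vector_derivative (\<integral>z. k z * \<psi> (x - z) \<partial>lborel)) (at x)"
  proof (rule has_vector_derivative_integral[where \<delta> = 1 and w = "\<lambda>z. M' * w z"])
    fix t :: real assume "t \<in> ball x 1"
    then have t: "t \<in> {-1<..<2}" using x by (auto simp: dist_real_def)
    show "integrable lborel (\<lambda>z. k z * \<phi> (t - z))"
      by (rule conv_local_integrable[OF M C(4) _ w, where k = "\<lambda>_. k"]) (use bd t in auto)
    fix z :: real
    have "((\<lambda>t. k z * \<phi> (t - z)) has_real_derivative k z * \<psi> (t - z)) (at t)"
      by (rule DERIV_cmult) (use DERIV_shift[of \<phi> "\<psi> (t - z)" t "- z"] C(1) in simp)
    then show "((\<lambda>t. k z * \<phi> (t - z)) has_vector_derivative k z * \<psi> (t - z)) (at t)"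
      by (simp add: has_real_derivative_iff_has_vector_derivative)
    show "norm (k z * \<psi> (t - z)) \<le> M' * w z"
    proof (cases "t - z \<in> {0<..<1}")
      case True
      then have "\<bar>z\<bar> \<le> 2" using t by auto
      then show ?thesis using mult_mono[OF bd[of z] M'[of "t - z"]] w(2)[of z] by (simp add: abs_mult mult.commute)
    next
      case False
      then show ?thesis using C(5) M0 w(2)[of z] by simp
    qed
  qed (use w in auto)
  then show ?thesis by (simp add: has_real_derivative_iff_has_vector_derivative conv_def[abs_def])
qed

text \<open>For \<epsilon> = 0 the kernel of the Riemann-Liouville integral of order 1 - \<sigma>,
  with exponent - \<sigma>; for \<epsilon> > 0 its damped version.\<close>

definition frac_kernel :: "real \<Rightarrow> real \<Rightarrow> real \<Rightarrow> real" where
  "frac_kernel \<sigma> \<epsilon> z = power_exp (1 - \<sigma>) \<epsilon> z / Gamma (1 - \<sigma>)"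

lemma frac_kernel_measurable [measurable]: "frac_kernel \<sigma> \<epsilon> \<in> borel_measurable borel"
  unfolding frac_kernel_def[abs_def] by measurable

lemma frac_kernel_nonneg: "\<sigma> < 1 \<Longrightarrow> 0 \<le> frac_kernel \<sigma> \<epsilon> z"
  by (simp add: frac_kernel_def power_exp_nonneg Gamma_real_nonneg)

lemma frac_kernel_integrable: "\<sigma> < 1 \<Longrightarrow> 0 < \<epsilon> \<Longrightarrow> integrable lborel (frac_kernel \<sigma> \<epsilon>)"
  unfolding frac_kernel_def[abs_def] by (intro integrable_divide power_exp_integrable) auto

lemma frac_kernel_local_bound:
  assumes "\<sigma> < 1" "0 \<le> \<epsilon>" "\<bar>z\<bar> \<le> 2"
  shows "\<bar>frac_kernel \<sigma> \<epsilon> z\<bar> \<le> exp 2 * frac_kernel \<sigma> 1 z"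
proof -
  have "power_exp (1 - \<sigma>) \<epsilon> z \<le> exp 2 * power_exp (1 - \<sigma>) 1 z"
  proof (cases "0 < z")
    case True
    have "0 \<le> \<epsilon> * z" using assms True by simp
    \<comment> \<open>The left side is at most 1 and \<open>2 - z\<close> is nonnegative. This is
      the origin of \<open>exp 2\<close>: it turns the kernel with damping 1 into an integrable
      majorant that does not depend on \<epsilon>.\<close>
    then have "exp (- \<epsilon> * z) \<le> exp (2 + - 1 * z)" using assms(3) by simp
    then have "exp (- \<epsilon> * z) \<le> exp 2 * exp (- 1 * z)" by (simp only: exp_add)
    then have "z powr (1 - \<sigma> - 1) * exp (- \<epsilon> * z) \<le> z powr (1 - \<sigma> - 1) * (exp 2 * exp (- 1 * z))"
      by (rule mult_left_mono) simp
    then show ?thesis using True by (simp add: power_exp_def mult_ac)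
  qed (simp add: power_exp_def)
  then have "power_exp (1 - \<sigma>) \<epsilon> z / Gamma (1 - \<sigma>) \<le> exp 2 * power_exp (1 - \<sigma>) 1 z / Gamma (1 - \<sigma>)"
    using assms(1) by (intro divide_right_mono Gamma_real_nonneg) auto
  then show ?thesis using frac_kernel_nonneg[OF assms(1), of \<epsilon> z] by (simp add: frac_kernel_def)
qed

lemma frac_kernel_tendsto:
  assumes "e \<longlonglongrightarrow> 0" shows "(\<lambda>n. frac_kernel \<sigma> (e n) z) \<longlonglongrightarrow> frac_kernel \<sigma> 0 z"
proof (cases "0 < z")
  case True
  have "(\<lambda>n. z powr (1 - \<sigma> - 1) * exp (- e n * z) / Gamma (1 - \<sigma>)) \<longlonglongrightarrow> z powr (1 - \<sigma> - 1) * exp (- 0 * z) / Gamma (1 - \<sigma>)"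
    unfolding divide_inverse by (intro tendsto_mult tendsto_exp tendsto_minus tendsto_const assms)
  then show ?thesis using True by (simp add: frac_kernel_def power_exp_def)
qed (simp add: frac_kernel_def power_exp_def)

text \<open>The substitution \<open>t = y - z\<close> moves the variable from the kernel into
  \<phi>, and the derivative follows it. The right side is the Caputo derivative, which coincides
  with the Riemann-Liouville one for functions vanishing at the ends.\<close>

lemma RL_left_eq:
  assumes \<phi>: "C1_supported \<phi> \<psi>" and \<sigma>: "\<sigma> < 1" and x: "x \<in> {0<..<1}"
  shows "RL_left \<sigma> \<phi> x = conv (frac_kernel \<sigma> 0) \<psi> x"
proof -
  let ?J = "\<lambda>y. 1 / Gamma (1 - \<sigma>) * (LINT t:{0..y}|lborel. (y - t) powr (- \<sigma>) * \<phi> t)"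
  have J: "conv (frac_kernel \<sigma> 0) \<phi> y = ?J y" if "y \<in> {0<..<1}" for y
  proof -
    have "(LINT t:{0..y}|lborel. (y - t) powr (- \<sigma>) * \<phi> t)
        = (\<integral>z. indicat_real {0..y} (y - z) *\<^sub>R ((y - (y - z)) powr (- \<sigma>) * \<phi> (y - z)) \<partial>lborel)"
      unfolding set_lebesgue_integral_def by (rule lborel_integral_reflect[symmetric])
    also have "\<dots> = (\<integral>z. power_exp (1 - \<sigma>) 0 z * \<phi> (y - z) \<partial>lborel)"
      using that C1_supported_props(4)[OF \<phi>]
      by (intro Bochner_Integration.integral_cong) (auto simp: indicator_def power_exp_def)
    finally show ?thesis by (simp add: conv_def frac_kernel_def)
  qed
  have "(conv (frac_kernel \<sigma> 0) \<phi> has_real_derivative conv (frac_kernel \<sigma> 0) \<psi> x) (at x)"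
    by (rule conv_has_derivative[OF \<phi>, where w = "\<lambda>z. exp 2 * frac_kernel \<sigma> 1 z"])
       (use \<sigma> x frac_kernel_integrable[of \<sigma> 1] frac_kernel_local_bound[of \<sigma> 0] frac_kernel_nonneg[OF \<sigma>] in auto)
  then have "(?J has_real_derivative conv (frac_kernel \<sigma> 0) \<psi> x) (at x)"
    by (rule has_field_derivative_transform_within_open[where S = "{0<..<1}"]) (use x J in auto)
  then show ?thesis unfolding RL_left_def by (rule DERIV_imp_deriv)
qed

lemma RL_right_eq:
  assumes \<phi>: "C1_supported \<phi> \<psi>" and \<sigma>: "\<sigma> < 1" and x: "x \<in> {0<..<1}"
  shows "RL_right \<sigma> \<phi> x = - conv (\<lambda>z. frac_kernel \<sigma> 0 (- z)) \<psi> x"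
proof -
  let ?J = "\<lambda>y. 1 / Gamma (1 - \<sigma>) * (LINT t:{y..1}|lborel. (t - y) powr (- \<sigma>) * \<phi> t)"
  let ?k = "\<lambda>z. frac_kernel \<sigma> 0 (- z)"
  have J: "conv ?k \<phi> y = ?J y" if "y \<in> {0<..<1}" for y
  proof -
    have "(LINT t:{y..1}|lborel. (t - y) powr (- \<sigma>) * \<phi> t)
        = (\<integral>z. indicat_real {y..1} (y - z) *\<^sub>R ((y - z - y) powr (- \<sigma>) * \<phi> (y - z)) \<partial>lborel)"
      unfolding set_lebesgue_integral_def by (rule lborel_integral_reflect[symmetric])
    also have "\<dots> = (\<integral>z. power_exp (1 - \<sigma>) 0 (- z) * \<phi> (y - z) \<partial>lborel)"
      using that C1_supported_props(4)[OF \<phi>]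
      by (intro Bochner_Integration.integral_cong) (auto simp: indicator_def power_exp_def)
    finally show ?thesis by (simp add: conv_def frac_kernel_def)
  qed
  have wi: "integrable lborel (\<lambda>z. exp 2 * frac_kernel \<sigma> 1 (- z))"
    using lborel_integrable_reflect[OF frac_kernel_integrable[OF \<sigma>, of 1], of 0] by simp
  have "(conv ?k \<phi> has_real_derivative conv ?k \<psi> x) (at x)"
    by (rule conv_has_derivative[OF \<phi> wi])
       (use \<sigma> x frac_kernel_local_bound[of \<sigma> 0] frac_kernel_nonneg[OF \<sigma>] in auto)
  then have "(?J has_real_derivative conv ?k \<psi> x) (at x)"
    by (rule has_field_derivative_transform_within_open[where S = "{0<..<1}"]) (use x J in auto)
  then show ?thesis unfolding RL_right_def by (simp add: DERIV_imp_deriv)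
qed

text \<open>This is E(u) of the overview. Its argument is a transform and not a function, so that
  \<open>fint\<close> and \<open>fourier\<close> can both be inserted.\<close>

definition seminorm_energy :: "real \<Rightarrow> (real \<Rightarrow> complex) \<Rightarrow> real" where
  "seminorm_energy \<sigma> F = (\<integral>\<omega>. \<bar>\<omega>\<bar> powr (2 * \<sigma>) * (norm (F \<omega>))\<^sup>2 \<partial>lborel)"

section \<open>Estimates and limit of the damped symbol\<close>

lemma powr_le_one_plus_square:
  fixes \<omega> :: real
  assumes "0 < \<sigma>" "\<sigma> < 1" shows "\<bar>\<omega>\<bar> powr (2 * \<sigma>) \<le> 1 + \<omega>\<^sup>2"
proof (cases "\<bar>\<omega>\<bar> \<le> 1")
  case True
  then have "\<bar>\<omega>\<bar> powr (2 * \<sigma>) \<le> 1" using assms by (intro powr_le1) auto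
  then show ?thesis by (simp add: add_increasing2)
next
  case False
  then have "\<bar>\<omega>\<bar> powr (2 * \<sigma>) \<le> \<bar>\<omega>\<bar> powr 2" using assms by (intro powr_mono) auto
  then show ?thesis using False by simp
qed

text \<open>The Fourier symbol of the fractional integral of order \<open>1 - \<sigma>\<close>, damped by \<open>\<epsilon>\<close>.\<close>

definition frac_symbol :: "real \<Rightarrow> real \<Rightarrow> real \<Rightarrow> complex" where
  "frac_symbol \<sigma> \<epsilon> \<omega> = (complex_of_real \<epsilon> + \<i> * complex_of_real \<omega>) powr (- complex_of_real (1 - \<sigma>))"

lemma fint_frac_kernel:
  assumes "\<sigma> < 1" "0 < \<epsilon>"
  shows "complex_of_real (sqrt (2 * pi)) * fint (frac_kernel \<sigma> \<epsilon>) \<omega> = frac_symbol \<sigma> \<epsilon> \<omega>"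
proof -
  have "0 < Gamma (1 - \<sigma>)" using assms by (intro Gamma_real_pos) simp
  then have G: "Gamma (1 - \<sigma>) \<noteq> 0" by simp
  have "(\<integral>x. complex_of_real (frac_kernel \<sigma> \<epsilon> x) * cis (- (\<omega> * x)) \<partial>lborel)
      = (\<integral>x. complex_of_real (1 / Gamma (1 - \<sigma>)) * (complex_of_real (power_exp (1 - \<sigma>) \<epsilon> x) * cis (- (\<omega> * x))) \<partial>lborel)"
    by (rule Bochner_Integration.integral_cong) (auto simp: frac_kernel_def)
  also have "\<dots> = complex_of_real (1 / Gamma (1 - \<sigma>)) * power_exp_fourier (1 - \<sigma>) \<epsilon> \<omega>"
    unfolding power_exp_fourier_def by (rule integral_mult_right_zero)
  also have "\<dots> = frac_symbol \<sigma> \<epsilon> \<omega>"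
    using power_exp_fourier_eq[of "1 - \<sigma>" \<epsilon> \<omega>] assms G by (simp add: frac_symbol_def)
  finally have "(\<integral>x. complex_of_real (frac_kernel \<sigma> \<epsilon> x) * cis (- (\<omega> * x)) \<partial>lborel) = frac_symbol \<sigma> \<epsilon> \<omega>" .
  moreover have "complex_of_real (sqrt (2 * pi)) * complex_of_real (1 / sqrt (2 * pi)) = 1"
    by (simp flip: of_real_mult)
  ultimately show ?thesis unfolding fint_def by (simp only: mult.assoc[symmetric] mult_1_left)
qed

text \<open>Measurability is read off from the parameter integral, which spares an argument about
  complex powers.\<close>

lemma frac_symbol_measurable:
  assumes "\<sigma> < 1" "0 < \<epsilon>" shows "frac_symbol \<sigma> \<epsilon> \<in> borel_measurable borel"
  unfolding fint_frac_kernel[OF assms, symmetric, abs_def] by measurable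

lemma norm_frac_symbol:
  assumes "\<omega> \<noteq> 0"
  shows "norm (frac_symbol \<sigma> \<epsilon> \<omega>) = norm (complex_of_real \<epsilon> + \<i> * complex_of_real \<omega>) powr (\<sigma> - 1)"
proof -
  have "complex_of_real \<epsilon> + \<i> * complex_of_real \<omega> \<noteq> 0" using assms by (auto simp: complex_eq_iff)
  then show ?thesis
    by (simp add: frac_symbol_def powr_def algebra_simps)
qed

text \<open>|\<epsilon> + i \<omega>| \<ge> |\<omega>| and the exponent \<sigma> - 1 is negative, so
  damping only shrinks the symbol. The bound is uniform in \<epsilon>: it gives the norm estimates
  and is the majorant when \<epsilon> tends to 0.\<close>

lemma norm_frac_symbol_le:
  assumes "\<omega> \<noteq> 0" "\<sigma> < 1"
  shows "(norm (frac_symbol \<sigma> \<epsilon> \<omega>))\<^sup>2 * \<omega>\<^sup>2 \<le> \<bar>\<omega>\<bar> powr (2 * \<sigma>)"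
proof -
  let ?p = "complex_of_real \<epsilon> + \<i> * complex_of_real \<omega>"
  have "\<bar>\<omega>\<bar> \<le> norm ?p" using abs_Im_le_cmod[of ?p] by simp
  then have "norm ?p powr (\<sigma> - 1) \<le> \<bar>\<omega>\<bar> powr (\<sigma> - 1)"
    using assms by (intro powr_mono2') auto
  then have "(norm (frac_symbol \<sigma> \<epsilon> \<omega>))\<^sup>2 \<le> (\<bar>\<omega>\<bar> powr (\<sigma> - 1))\<^sup>2"
    unfolding norm_frac_symbol[OF assms(1)] by (intro power_mono) auto
  then have "(norm (frac_symbol \<sigma> \<epsilon> \<omega>))\<^sup>2 * \<omega>\<^sup>2 \<le> (\<bar>\<omega>\<bar> powr (\<sigma> - 1))\<^sup>2 * \<omega>\<^sup>2"
    by (rule mult_right_mono) simp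
  also have "\<dots> = (\<bar>\<omega>\<bar> powr (\<sigma> - 1) * \<bar>\<omega>\<bar> powr 1)\<^sup>2" by (simp add: power_mult_distrib)
  also have "\<dots> = (\<bar>\<omega>\<bar> powr \<sigma>)\<^sup>2" unfolding powr_add[symmetric] by simp
  also have "\<dots> = \<bar>\<omega>\<bar> powr (2 * \<sigma>)" by (simp add: power2_eq_square powr_add[symmetric])
  finally show ?thesis .
qed

lemma frac_symbol_tendsto:
  assumes \<omega>: "\<omega> \<noteq> 0" and e: "e \<longlonglongrightarrow> 0"
  shows "(\<lambda>n. Re ((frac_symbol \<sigma> (e n) \<omega>)\<^sup>2) * \<omega>\<^sup>2) \<longlonglongrightarrow> - cos (pi * \<sigma>) * \<bar>\<omega>\<bar> powr (2 * \<sigma>)"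
proof -
  let ?z = "\<i> * complex_of_real \<omega>"
  have z: "complex_of_real 0 + ?z \<notin> \<real>\<^sub>\<le>\<^sub>0" using \<omega> by (auto simp: complex_nonpos_Reals_iff)
  \<comment> \<open>The argument of i \<omega> is pi/2 or -pi/2 according to the sign of \<omega>.
    The power -2 (1 - \<sigma>) turns it into sgn \<omega> (pi \<sigma> - pi), and the sign
    disappears in the cosine.\<close>
  have Ln: "Ln ?z = Complex (ln \<bar>\<omega>\<bar>) (sgn \<omega> * (pi / 2))"
  proof (rule Ln_unique)
    have "exp (Complex (ln \<bar>\<omega>\<bar>) (sgn \<omega> * (pi / 2))) = complex_of_real \<bar>\<omega>\<bar> * cis (sgn \<omega> * (pi / 2))"
      using \<omega> by (simp add: exp_eq_polar exp_of_real)
    also have "\<dots> = ?z" using \<omega> by (cases "0 < \<omega>") (auto simp: complex_eq_iff)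
    finally show "exp (Complex (ln \<bar>\<omega>\<bar>) (sgn \<omega> * (pi / 2))) = ?z" .
    show "- pi < Im (Complex (ln \<bar>\<omega>\<bar>) (sgn \<omega> * (pi / 2)))" "Im (Complex (ln \<bar>\<omega>\<bar>) (sgn \<omega> * (pi / 2))) \<le> pi"
      using pi_gt_zero by (auto simp: sgn_if)
  qed
  have "(frac_symbol \<sigma> 0 \<omega>)\<^sup>2 = exp (2 * (- complex_of_real (1 - \<sigma>) * Ln ?z))"
    using \<omega> by (simp add: frac_symbol_def powr_def exp_double)
  also have "2 * (- complex_of_real (1 - \<sigma>) * Ln ?z) = Complex (2 * (\<sigma> - 1) * ln \<bar>\<omega>\<bar>) (sgn \<omega> * (pi * \<sigma> - pi))"
    unfolding Ln by (simp add: complex_eq_iff algebra_simps)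
  finally have "Re ((frac_symbol \<sigma> 0 \<omega>)\<^sup>2) = exp (2 * (\<sigma> - 1) * ln \<bar>\<omega>\<bar>) * cos (sgn \<omega> * (pi * \<sigma> - pi))"
    by (simp add: Re_exp)
  also have "cos (sgn \<omega> * (pi * \<sigma> - pi)) = cos (pi * \<sigma> - pi)"
    using \<omega> by (cases "0 < \<omega>") (simp_all add: cos_minus[of "pi * \<sigma> - pi", symmetric])
  also have "cos (pi * \<sigma> - pi) = - cos (pi * \<sigma>)" by (simp add: cos_diff)
  also have "exp (2 * (\<sigma> - 1) * ln \<bar>\<omega>\<bar>) = \<bar>\<omega>\<bar> powr (2 * \<sigma> - 2)"
    using \<omega> by (simp add: powr_def algebra_simps)
  finally have "Re ((frac_symbol \<sigma> 0 \<omega>)\<^sup>2) * \<omega>\<^sup>2 = - cos (pi * \<sigma>) * (\<bar>\<omega>\<bar> powr (2 * \<sigma> - 2) * \<bar>\<omega>\<bar> powr 2)"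
    using \<omega> by simp
  also have "\<bar>\<omega>\<bar> powr (2 * \<sigma> - 2) * \<bar>\<omega>\<bar> powr 2 = \<bar>\<omega>\<bar> powr (2 * \<sigma>)"
    unfolding powr_add[symmetric] by simp
  finally have eq: "Re ((frac_symbol \<sigma> 0 \<omega>)\<^sup>2) * \<omega>\<^sup>2 = - cos (pi * \<sigma>) * \<bar>\<omega>\<bar> powr (2 * \<sigma>)" .
  have "(\<lambda>n. complex_of_real (e n) + ?z) \<longlonglongrightarrow> complex_of_real 0 + ?z"
    by (intro tendsto_intros e)
  then have "(\<lambda>n. frac_symbol \<sigma> (e n) \<omega>) \<longlonglongrightarrow> frac_symbol \<sigma> 0 \<omega>"
    unfolding frac_symbol_def by (rule tendsto_powr_complex[OF z _ tendsto_const])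
  then have "(\<lambda>n. Re ((frac_symbol \<sigma> (e n) \<omega>)\<^sup>2) * \<omega>\<^sup>2) \<longlonglongrightarrow> Re ((frac_symbol \<sigma> 0 \<omega>)\<^sup>2) * \<omega>\<^sup>2"
    by (intro tendsto_intros)
  then show ?thesis unfolding eq .
qed

text \<open>\<omega> times the transform of \<phi> has the modulus of the transform of \<psi>, which
  is square integrable.\<close>

lemma C1_supported_fint:
  assumes \<phi>: "C1_supported \<phi> \<psi>"
  shows "integrable lborel (\<lambda>\<omega>. (1 + \<omega>\<^sup>2) * (norm (fint \<phi> \<omega>))\<^sup>2)"
proof -
  have "integrable lborel (\<lambda>\<omega>. (norm (fint \<phi> \<omega>))\<^sup>2)" "integrable lborel (\<lambda>\<omega>. (norm (fint \<psi> \<omega>))\<^sup>2)"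
    using L2_integrable[OF fint_L2[OF C1_supported_fun(3,4)[OF \<phi> \<phi>]]]
      L2_integrable[OF fint_L2[OF C1_supported_derivative(3,4)[OF \<phi> \<phi>]]] by auto
  moreover have "(norm (fint \<psi> \<omega>))\<^sup>2 = \<omega>\<^sup>2 * (norm (fint \<phi> \<omega>))\<^sup>2" for \<omega>
    by (simp add: fint_derivative[OF \<phi>] norm_mult power_mult_distrib)
  ultimately have "integrable lborel (\<lambda>\<omega>. (norm (fint \<phi> \<omega>))\<^sup>2 + \<omega>\<^sup>2 * (norm (fint \<phi> \<omega>))\<^sup>2)" by simp
  then show ?thesis by (simp add: algebra_simps)
qed

lemma C1_supported_energy_integrable:
  assumes \<phi>: "C1_supported \<phi> \<psi>" and \<sigma>: "0 < \<sigma>" "\<sigma> < 1"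
  shows "integrable lborel (\<lambda>\<omega>. \<bar>\<omega>\<bar> powr (2 * \<sigma>) * (norm (fint \<phi> \<omega>))\<^sup>2)"
proof (rule Bochner_Integration.integrable_bound[OF C1_supported_fint[OF \<phi>]])
  have [measurable]: "\<phi> \<in> borel_measurable borel" by (rule C1_supported_fun(2)[OF \<phi> \<phi>])
  show "(\<lambda>\<omega>. \<bar>\<omega>\<bar> powr (2 * \<sigma>) * (norm (fint \<phi> \<omega>))\<^sup>2) \<in> borel_measurable lborel" by measurable
  have "norm (\<bar>\<omega>\<bar> powr (2 * \<sigma>) * (norm (fint \<phi> \<omega>))\<^sup>2) \<le> norm ((1 + \<omega>\<^sup>2) * (norm (fint \<phi> \<omega>))\<^sup>2)" for \<omega>
    using mult_right_mono[OF powr_le_one_plus_square[OF \<sigma>, of \<omega>], of "(norm (fint \<phi> \<omega>))\<^sup>2"] by simp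
  then show "AE \<omega> in lborel. norm (\<bar>\<omega>\<bar> powr (2 * \<sigma>) * (norm (fint \<phi> \<omega>))\<^sup>2) \<le> norm ((1 + \<omega>\<^sup>2) * (norm (fint \<phi> \<omega>))\<^sup>2)"
    by simp
qed

section \<open>The damped derivatives and their limit\<close>

context
  fixes \<sigma> :: real and \<phi> \<psi> :: "real \<Rightarrow> real"
  assumes \<sigma>: "0 < \<sigma>" "\<sigma> < 1" and \<phi>: "C1_supported \<phi> \<psi>"
begin

text \<open>With \<epsilon> = 0, this and \<open>damped_right\<close> are the Riemann-Liouville
  derivatives on (0, 1), by \<open>RL_left_eq\<close> and \<open>RL_right_eq\<close>. For \<epsilon>
  > 0 the kernel is integrable, and both can be studied on the whole line.\<close>

definition damped_left :: "real \<Rightarrow> real \<Rightarrow> real" where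
  "damped_left \<epsilon> = conv (frac_kernel \<sigma> \<epsilon>) \<psi>"

definition damped_right :: "real \<Rightarrow> real \<Rightarrow> real" where
  "damped_right \<epsilon> x = - conv (\<lambda>z. frac_kernel \<sigma> \<epsilon> (- z)) \<psi> x"

lemma psi_props: "\<exists>M. \<forall>x. \<bar>\<psi> x\<bar> \<le> M" "\<psi> \<in> borel_measurable borel" "integrable lborel \<psi>" "\<psi> \<in> L2 lborel"
  using C1_supported_derivative[OF \<phi> \<phi>] by auto

lemma reflected_kernel_integrable: "0 < \<epsilon> \<Longrightarrow> integrable lborel (\<lambda>z. frac_kernel \<sigma> \<epsilon> (- z))"
  using lborel_integrable_reflect[OF frac_kernel_integrable[OF \<sigma>(2)], of \<epsilon> 0] by simp

lemma damped_measurable [measurable]: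
  "damped_left \<epsilon> \<in> borel_measurable borel" "damped_right \<epsilon> \<in> borel_measurable borel"
  using psi_props(2) unfolding damped_left_def damped_right_def[abs_def] by measurable

lemma damped_L1L2:
  assumes "0 < \<epsilon>"
  shows "integrable lborel (damped_left \<epsilon>)" "damped_left \<epsilon> \<in> L2 lborel"
    "integrable lborel (damped_right \<epsilon>)" "damped_right \<epsilon> \<in> L2 lborel"
proof -
  obtain M where M: "\<And>x. \<bar>\<psi> x\<bar> \<le> M" using psi_props(1) by blast
  note k = frac_kernel_integrable[OF \<sigma>(2) assms] reflected_kernel_integrable[OF assms]
  show "integrable lborel (damped_left \<epsilon>)" "damped_left \<epsilon> \<in> L2 lborel"
    unfolding damped_left_def by (intro conv_integrable conv_bounded_L2[OF _ _ M] k psi_props)+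
  show "integrable lborel (damped_right \<epsilon>)"
    unfolding damped_right_def[abs_def] by (intro Bochner_Integration.integrable_minus conv_integrable k psi_props)
  have "(\<lambda>x. (-1) *\<^sub>R conv (\<lambda>z. frac_kernel \<sigma> \<epsilon> (- z)) \<psi> x) \<in> L2 lborel"
    by (intro L2_scale conv_bounded_L2[OF _ _ M] k psi_props)
  then show "damped_right \<epsilon> \<in> L2 lborel"
    unfolding damped_right_def[abs_def] by simp
qed

lemma fint_damped:
  assumes "0 < \<epsilon>"
  shows "fint (damped_left \<epsilon>) \<omega> = frac_symbol \<sigma> \<epsilon> \<omega> * (\<i> * of_real \<omega> * fint \<phi> \<omega>)"
    and "fint (damped_right \<epsilon>) \<omega> = - (cnj (frac_symbol \<sigma> \<epsilon> \<omega>) * (\<i> * of_real \<omega> * fint \<phi> \<omega>))"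
proof -
  note k = frac_kernel_integrable[OF \<sigma>(2) assms] reflected_kernel_integrable[OF assms]
  show "fint (damped_left \<epsilon>) \<omega> = frac_symbol \<sigma> \<epsilon> \<omega> * (\<i> * of_real \<omega> * fint \<phi> \<omega>)"
    unfolding damped_left_def fint_conv[OF k(1) psi_props(3)] fint_derivative[OF \<phi>]
      fint_frac_kernel[OF \<sigma>(2) assms, symmetric] ..
  have "complex_of_real (sqrt (2 * pi)) * cnj (fint (frac_kernel \<sigma> \<epsilon>) \<omega>) = cnj (frac_symbol \<sigma> \<epsilon> \<omega>)"
    unfolding fint_frac_kernel[OF \<sigma>(2) assms, symmetric] by simp
  then have c: "fint (conv (\<lambda>z. frac_kernel \<sigma> \<epsilon> (- z)) \<psi>) \<omega> = cnj (frac_symbol \<sigma> \<epsilon> \<omega>) * (\<i> * of_real \<omega> * fint \<phi> \<omega>)"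
    unfolding fint_conv[OF k(2) psi_props(3)] fint_derivative[OF \<phi>] fint_reflect by simp
  \<comment> \<open>The minus sign of \<open>damped_right\<close> is handled by
    \<open>fint_comb\<close> with the zero function as first summand.\<close>
  have z: "integrable lborel (\<lambda>x::real. 0 :: real)" by simp
  have "fint (\<lambda>x. 0) \<omega> = 0" by (simp add: fint_def)
  then show "fint (damped_right \<epsilon>) \<omega> = - (cnj (frac_symbol \<sigma> \<epsilon> \<omega>) * (\<i> * of_real \<omega> * fint \<phi> \<omega>))"
    using fint_comb[OF z conv_integrable[OF k(2) psi_props(3)], of "-1" \<omega>] c
    unfolding damped_right_def[abs_def] by simp
qed

lemma damped_norm_le:
  assumes "0 < \<epsilon>"
  shows "(L2_norm lborel (damped_left \<epsilon>))\<^sup>2 \<le> seminorm_energy \<sigma> (fint \<phi>)"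
    and "(L2_norm lborel (damped_right \<epsilon>))\<^sup>2 \<le> seminorm_energy \<sigma> (fint \<phi>)"
proof -
  have le: "(norm (frac_symbol \<sigma> \<epsilon> \<omega> * (\<i> * of_real \<omega> * fint \<phi> \<omega>)))\<^sup>2 \<le> \<bar>\<omega>\<bar> powr (2 * \<sigma>) * (norm (fint \<phi> \<omega>))\<^sup>2" for \<omega>
  proof (cases "\<omega> = 0")
    case False
    from mult_right_mono[OF norm_frac_symbol_le[OF this \<sigma>(2), of \<epsilon>], of "(norm (fint \<phi> \<omega>))\<^sup>2"]
    show ?thesis by (simp add: norm_mult power_mult_distrib mult_ac)
  qed simp
  note D = damped_L1L2[OF assms]
  show "(L2_norm lborel (damped_left \<epsilon>))\<^sup>2 \<le> seminorm_energy \<sigma> (fint \<phi>)"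
    unfolding Plancherel_fint[OF D(1,2), symmetric] L2_norm_sq seminorm_energy_def
  proof (rule integral_mono)
    show "integrable lborel (\<lambda>\<omega>. (norm (fint (damped_left \<epsilon>) \<omega>))\<^sup>2)" by (intro L2_integrable fint_L2 D)
  qed (use C1_supported_energy_integrable[OF \<phi> \<sigma>] le fint_damped(1)[OF assms] in auto)
  show "(L2_norm lborel (damped_right \<epsilon>))\<^sup>2 \<le> seminorm_energy \<sigma> (fint \<phi>)"
    unfolding Plancherel_fint[OF D(3,4), symmetric] L2_norm_sq seminorm_energy_def
  proof (rule integral_mono)
    show "integrable lborel (\<lambda>\<omega>. (norm (fint (damped_right \<epsilon>) \<omega>))\<^sup>2)" by (intro L2_integrable fint_L2 D)
    show "(norm (fint (damped_right \<epsilon>) \<omega>))\<^sup>2 \<le> \<bar>\<omega>\<bar> powr (2 * \<sigma>) * (norm (fint \<phi> \<omega>))\<^sup>2" for \<omega>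
      using le[of \<omega>] by (simp add: fint_damped(2)[OF assms] norm_mult)
  qed (rule C1_supported_energy_integrable[OF \<phi> \<sigma>])
qed

lemma damped_ip:
  assumes "0 < \<epsilon>"
  shows "L2_ip lborel (damped_left \<epsilon>) (damped_right \<epsilon>)
    = (\<integral>\<omega>. - (Re ((frac_symbol \<sigma> \<epsilon> \<omega>)\<^sup>2) * \<omega>\<^sup>2) * (norm (fint \<phi> \<omega>))\<^sup>2 \<partial>lborel)"
proof -
  \<comment> \<open>The conjugation in the right transform cancels the one in the inner product, so
    the square of the symbol appears and not its squared modulus. Its argument is what becomes the
    cosine.\<close>
  have i: "inner (A * (\<i> * of_real \<omega> * w)) (- (cnj A * (\<i> * of_real \<omega> * w))) = - (Re (A\<^sup>2) * \<omega>\<^sup>2) * (norm w)\<^sup>2"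
    for A w :: complex and \<omega> :: real
    unfolding cmod_power2 by (simp add: inner_complex_def power2_eq_square algebra_simps)
  note D = damped_L1L2[OF assms]
  show ?thesis
    unfolding Plancherel_ip[OF D] unfolding L2_ip_def fint_damped[OF assms] i ..
qed

lemma damped_ip_tendsto:
  assumes e: "\<And>n. 0 < e n" "e \<longlonglongrightarrow> 0"
  shows "(\<lambda>n. L2_ip lborel (damped_left (e n)) (damped_right (e n))) \<longlonglongrightarrow> cos (pi * \<sigma>) * seminorm_energy \<sigma> (fint \<phi>)"
proof -
  have [measurable]: "\<phi> \<in> borel_measurable borel" by (rule C1_supported_fun(2)[OF \<phi> \<phi>])
  have [measurable]: "frac_symbol \<sigma> (e n) \<in> borel_measurable borel" for n
    by (rule frac_symbol_measurable[OF \<sigma>(2) e(1)])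
  have "(\<lambda>n. \<integral>\<omega>. - (Re ((frac_symbol \<sigma> (e n) \<omega>)\<^sup>2) * \<omega>\<^sup>2) * (norm (fint \<phi> \<omega>))\<^sup>2 \<partial>lborel)
    \<longlonglongrightarrow> (\<integral>\<omega>. cos (pi * \<sigma>) * (\<bar>\<omega>\<bar> powr (2 * \<sigma>) * (norm (fint \<phi> \<omega>))\<^sup>2) \<partial>lborel)"
  proof (rule integral_dominated_convergence[where w = "\<lambda>\<omega>. \<bar>\<omega>\<bar> powr (2 * \<sigma>) * (norm (fint \<phi> \<omega>))\<^sup>2"])
    have "(\<lambda>n. - (Re ((frac_symbol \<sigma> (e n) \<omega>)\<^sup>2) * \<omega>\<^sup>2) * (norm (fint \<phi> \<omega>))\<^sup>2)
        \<longlonglongrightarrow> cos (pi * \<sigma>) * (\<bar>\<omega>\<bar> powr (2 * \<sigma>) * (norm (fint \<phi> \<omega>))\<^sup>2)" for \<omega>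
    proof (cases "\<omega> = 0")
      case False
      have "(\<lambda>n. - (Re ((frac_symbol \<sigma> (e n) \<omega>)\<^sup>2) * \<omega>\<^sup>2) * (norm (fint \<phi> \<omega>))\<^sup>2)
        \<longlonglongrightarrow> - (- cos (pi * \<sigma>) * \<bar>\<omega>\<bar> powr (2 * \<sigma>)) * (norm (fint \<phi> \<omega>))\<^sup>2"
        by (intro tendsto_mult tendsto_minus tendsto_const frac_symbol_tendsto[OF False e(2), of \<sigma>])
      then show ?thesis by (simp add: mult.assoc)
    qed simp
    then show "AE \<omega> in lborel. (\<lambda>n. - (Re ((frac_symbol \<sigma> (e n) \<omega>)\<^sup>2) * \<omega>\<^sup>2) * (norm (fint \<phi> \<omega>))\<^sup>2)
        \<longlonglongrightarrow> cos (pi * \<sigma>) * (\<bar>\<omega>\<bar> powr (2 * \<sigma>) * (norm (fint \<phi> \<omega>))\<^sup>2)" by simp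
    fix n
    have "norm (- (Re ((frac_symbol \<sigma> (e n) \<omega>)\<^sup>2) * \<omega>\<^sup>2) * (norm (fint \<phi> \<omega>))\<^sup>2) \<le> \<bar>\<omega>\<bar> powr (2 * \<sigma>) * (norm (fint \<phi> \<omega>))\<^sup>2" for \<omega>
    proof (cases "\<omega> = 0")
      case False
      have "\<bar>Re ((frac_symbol \<sigma> (e n) \<omega>)\<^sup>2)\<bar> \<le> (norm (frac_symbol \<sigma> (e n) \<omega>))\<^sup>2"
        using abs_Re_le_cmod[of "(frac_symbol \<sigma> (e n) \<omega>)\<^sup>2"] by (simp add: norm_power)
      then have "\<bar>Re ((frac_symbol \<sigma> (e n) \<omega>)\<^sup>2)\<bar> * \<omega>\<^sup>2 \<le> \<bar>\<omega>\<bar> powr (2 * \<sigma>)"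
        using norm_frac_symbol_le[OF False \<sigma>(2), of "e n"] mult_right_mono[of _ _ "\<omega>\<^sup>2"] zero_le_power2 order_trans by blast
      from mult_right_mono[OF this, of "(norm (fint \<phi> \<omega>))\<^sup>2"] show ?thesis by (simp add: abs_mult)
    qed simp
    then show "AE \<omega> in lborel. norm (- (Re ((frac_symbol \<sigma> (e n) \<omega>)\<^sup>2) * \<omega>\<^sup>2) * (norm (fint \<phi> \<omega>))\<^sup>2)
        \<le> \<bar>\<omega>\<bar> powr (2 * \<sigma>) * (norm (fint \<phi> \<omega>))\<^sup>2" by simp
  qed (use C1_supported_energy_integrable[OF \<phi> \<sigma>] in auto)
  then show ?thesis by (simp add: damped_ip[OF e(1)] seminorm_energy_def)
qed

text \<open>On the interval the kernel enters only through [-2, 2], where one integrable majorant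
  serves all \<open>n\<close>; it gives the uniform bound and the pointwise limits.\<close>

lemma damped_limit:
  assumes e: "\<And>n. 0 < e n" "e \<longlonglongrightarrow> 0"
  obtains B where "\<And>n x. x \<in> {0<..<1} \<Longrightarrow> \<bar>damped_left (e n) x\<bar> \<le> B" "\<And>n x. x \<in> {0<..<1} \<Longrightarrow> \<bar>damped_right (e n) x\<bar> \<le> B"
    "\<And>x. x \<in> {0<..<1} \<Longrightarrow> (\<lambda>n. damped_left (e n) x) \<longlonglongrightarrow> RL_left \<sigma> \<phi> x"
    "\<And>x. x \<in> {0<..<1} \<Longrightarrow> (\<lambda>n. damped_right (e n) x) \<longlonglongrightarrow> RL_right \<sigma> \<phi> x"
proof -
  obtain M where M: "\<And>x. \<bar>\<psi> x\<bar> \<le> M" using psi_props(1) by blast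
  let ?w = "\<lambda>z. exp 2 * frac_kernel \<sigma> 1 z"
  note C = C1_supported_props[OF \<phi>]
  have w: "integrable lborel ?w" "integrable lborel (\<lambda>z. ?w (- z))"
    using frac_kernel_integrable[OF \<sigma>(2), of 1] reflected_kernel_integrable[of 1] by auto
  have w0: "0 \<le> ?w z" for z using frac_kernel_nonneg[OF \<sigma>(2)] by simp
  have wr: "(\<integral>z. ?w (- z) \<partial>lborel) = (\<integral>z. ?w z \<partial>lborel)" using lborel_integral_reflect[of ?w 0] by simp
  have bd: "\<bar>frac_kernel \<sigma> (e n) z\<bar> \<le> ?w z" if "\<bar>z\<bar> \<le> 2" for n z
    using frac_kernel_local_bound[OF \<sigma>(2) _ that, of "e n"] e(1)[of n] by simp
  have bd': "\<bar>frac_kernel \<sigma> (e n) (- z)\<bar> \<le> ?w (- z)" if "\<bar>z\<bar> \<le> 2" for n z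
    using bd[of "-z" n] that by simp
  note m = frac_kernel_measurable[of \<sigma>]
  have m': "(\<lambda>z. frac_kernel \<sigma> \<epsilon> (- z)) \<in> borel_measurable borel" for \<epsilon> by measurable
  show ?thesis
  proof (rule that[of "M * (\<integral>z. ?w z \<partial>lborel)"])
    fix x :: real assume x: "x \<in> {0<..<1}"
    then have x': "x \<in> {-1<..<2}" by auto
    show "\<bar>damped_left (e n) x\<bar> \<le> M * (\<integral>z. ?w z \<partial>lborel)" for n
      unfolding damped_left_def
      by (rule conv_local_bound[OF M C(5) psi_props(2) w(1) w0, where k = "\<lambda>n. frac_kernel \<sigma> (e n)"]) (use m bd x' in auto)
    show "\<bar>damped_right (e n) x\<bar> \<le> M * (\<integral>z. ?w z \<partial>lborel)" for n
      unfolding damped_right_def abs_minus_cancel wr[symmetric]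
      by (rule conv_local_bound[OF M C(5) psi_props(2) w(2) w0, where k = "\<lambda>n z. frac_kernel \<sigma> (e n) (- z)"]) (use m' bd' x' in auto)
    show "(\<lambda>n. damped_left (e n) x) \<longlonglongrightarrow> RL_left \<sigma> \<phi> x"
      unfolding damped_left_def RL_left_eq[OF \<phi> \<sigma>(2) x]
      by (rule conv_local_tendsto[OF M C(5) psi_props(2) w(1) w0]) (use m bd x' frac_kernel_tendsto[OF e(2)] in auto)
    show "(\<lambda>n. damped_right (e n) x) \<longlonglongrightarrow> RL_right \<sigma> \<phi> x"
      unfolding damped_right_def RL_right_eq[OF \<phi> \<sigma>(2) x]
      by (rule tendsto_minus, rule conv_local_tendsto[OF M C(5) psi_props(2) w(2) w0])
         (use m' bd' x' frac_kernel_tendsto[OF e(2)] in auto)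
  qed
qed

lemma damped_support:
  "x \<le> 0 \<Longrightarrow> damped_left \<epsilon> x = 0" "1 \<le> x \<Longrightarrow> damped_right \<epsilon> x = 0"
proof -
  note C = C1_supported_props[OF \<phi>]
  have "frac_kernel \<sigma> \<epsilon> z * \<psi> (x - z) = 0" if "x \<le> 0" for z
    using C(5)[of "x - z"] that by (cases "0 < z") (auto simp: frac_kernel_def power_exp_def)
  then show "x \<le> 0 \<Longrightarrow> damped_left \<epsilon> x = 0" unfolding damped_left_def conv_def by (simp only: integral_zero)
  have "frac_kernel \<sigma> \<epsilon> (- z) * \<psi> (x - z) = 0" if "1 \<le> x" for z
    using C(5)[of "x - z"] that by (cases "z < 0") (auto simp: frac_kernel_def power_exp_def)
  then show "1 \<le> x \<Longrightarrow> damped_right \<epsilon> x = 0" unfolding damped_right_def conv_def by (simp only: integral_zero minus_zero)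
qed

lemma RL_smooth:
  shows "RL_left \<sigma> \<phi> \<in> L2 Om"
    and "RL_right \<sigma> \<phi> \<in> L2 Om"
    and "(L2_norm Om (RL_left \<sigma> \<phi>))\<^sup>2 \<le> seminorm_energy \<sigma> (fint \<phi>)"
    and "(L2_norm Om (RL_right \<sigma> \<phi>))\<^sup>2 \<le> seminorm_energy \<sigma> (fint \<phi>)"
    and "L2_ip Om (RL_left \<sigma> \<phi>) (RL_right \<sigma> \<phi>) = cos (pi * \<sigma>) * seminorm_energy \<sigma> (fint \<phi>)"
proof -
  define e where "e n = 1 / real (Suc n)" for n
  have e: "0 < e n" for n by (simp add: e_def)
  have e0: "e \<longlonglongrightarrow> 0" unfolding e_def by (rule LIMSEQ_inverse_real_of_nat[unfolded inverse_eq_divide])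
  obtain B where B: "\<And>n x. x \<in> {0<..<1} \<Longrightarrow> \<bar>damped_left (e n) x\<bar> \<le> B" "\<And>n x. x \<in> {0<..<1} \<Longrightarrow> \<bar>damped_right (e n) x\<bar> \<le> B"
    and lim: "\<And>x. x \<in> {0<..<1} \<Longrightarrow> (\<lambda>n. damped_left (e n) x) \<longlonglongrightarrow> RL_left \<sigma> \<phi> x"
    "\<And>x. x \<in> {0<..<1} \<Longrightarrow> (\<lambda>n. damped_right (e n) x) \<longlonglongrightarrow> RL_right \<sigma> \<phi> x"
    using damped_limit[of e, OF e e0] by metis
  have dm [measurable]: "damped_left (e n) \<in> borel_measurable Om" "damped_right (e n) \<in> borel_measurable Om" for n
    by (intro Om_measurable damped_measurable)+
  have m [measurable]: "RL_left \<sigma> \<phi> \<in> borel_measurable Om" "RL_right \<sigma> \<phi> \<in> borel_measurable Om"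
    by (rule borel_measurable_LIMSEQ_metric[where f = "\<lambda>n. damped_left (e n)"], use dm lim in auto)
       (rule borel_measurable_LIMSEQ_metric[where f = "\<lambda>n. damped_right (e n)"], use dm lim in auto)
  let ?E = "seminorm_energy \<sigma> (fint \<phi>)"
  have E0: "0 \<le> ?E" by (simp add: seminorm_energy_def integral_nonneg_AE)
  \<comment> \<open>Plancherel's theorem bounds the norm on the line uniformly in \<open>n\<close>;
    restriction to the interval keeps the bound, and Fatou's lemma hands it to the pointwise
    limit.\<close>
  have "L2_norm Om (damped_left (e n)) \<le> sqrt ?E" for n
    using L2_Om(2)[OF damped_L1L2(2)[OF e]] damped_norm_le(1)[OF e] real_le_rsqrt order_trans by blast
  then have l: "RL_left \<sigma> \<phi> \<in> L2 Om \<and> L2_norm Om (RL_left \<sigma> \<phi>) \<le> sqrt ?E"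
    using L2_Om(1)[OF damped_L1L2(2)[OF e]] lim(1) m(1) by (intro L2_Fatou[where f = "\<lambda>n. damped_left (e n)"]) auto
  have "L2_norm Om (damped_right (e n)) \<le> sqrt ?E" for n
    using L2_Om(2)[OF damped_L1L2(4)[OF e]] damped_norm_le(2)[OF e] real_le_rsqrt order_trans by blast
  then have r: "RL_right \<sigma> \<phi> \<in> L2 Om \<and> L2_norm Om (RL_right \<sigma> \<phi>) \<le> sqrt ?E"
    using L2_Om(1)[OF damped_L1L2(4)[OF e]] lim(2) m(2) by (intro L2_Fatou[where f = "\<lambda>n. damped_right (e n)"]) auto
  show "RL_left \<sigma> \<phi> \<in> L2 Om" "RL_right \<sigma> \<phi> \<in> L2 Om" using l r by auto
  show "(L2_norm Om (RL_left \<sigma> \<phi>))\<^sup>2 \<le> ?E" "(L2_norm Om (RL_right \<sigma> \<phi>))\<^sup>2 \<le> ?E"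
    using power_mono[of "L2_norm Om (RL_left \<sigma> \<phi>)" "sqrt ?E" 2] power_mono[of "L2_norm Om (RL_right \<sigma> \<phi>)" "sqrt ?E" 2] l r E0 by auto
  \<comment> \<open>Norm bounds alone do not identify the limit of the inner products; the uniform
    bound \<open>B\<close> on a set of finite measure does.\<close>
  have "(\<lambda>n. L2_ip Om (damped_left (e n)) (damped_right (e n))) \<longlonglongrightarrow> L2_ip Om (RL_left \<sigma> \<phi>) (RL_right \<sigma> \<phi>)"
    unfolding L2_ip_def
  proof (rule integral_dominated_convergence[where w = "\<lambda>x. B * B"])
    interpret finite_measure Om by (rule finite_measure_Om)
    show "integrable Om (\<lambda>x. B * B)" by simp
    show "AE x in Om. (\<lambda>n. inner (damped_left (e n) x) (damped_right (e n) x)) \<longlonglongrightarrow> inner (RL_left \<sigma> \<phi> x) (RL_right \<sigma> \<phi> x)"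
      by (intro AE_I2 tendsto_inner lim) auto
    have "norm (inner (damped_left (e n) x) (damped_right (e n) x)) \<le> B * B" if "x \<in> {0<..<1}" for n x
      using mult_mono[OF B(1)[OF that, of n] B(2)[OF that, of n]] order_trans[OF abs_ge_zero B(1)[OF that, of n]]
      by (simp add: abs_mult)
    then show "AE x in Om. norm (inner (damped_left (e n) x) (damped_right (e n) x)) \<le> B * B" for n
      by (intro AE_I2) auto
  qed measurable
  moreover have "L2_ip Om (damped_left (e n)) (damped_right (e n)) = L2_ip lborel (damped_left (e n)) (damped_right (e n))" for n
    unfolding L2_ip_def Om_integral
  proof (rule Bochner_Integration.integral_cong[OF refl])
    fix x show "indicat_real {0<..<1} x *\<^sub>R inner (damped_left (e n) x) (damped_right (e n) x)
        = inner (damped_left (e n) x) (damped_right (e n) x)"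
      by (cases "x \<le> 0"; cases "1 \<le> x") (auto simp: damped_support indicator_def)
  qed
  ultimately have "(\<lambda>n. L2_ip lborel (damped_left (e n)) (damped_right (e n))) \<longlonglongrightarrow> L2_ip Om (RL_left \<sigma> \<phi>) (RL_right \<sigma> \<phi>)"
    by simp
  from LIMSEQ_unique[OF this damped_ip_tendsto[OF e e0]]
  show "L2_ip Om (RL_left \<sigma> \<phi>) (RL_right \<sigma> \<phi>) = cos (pi * \<sigma>) * ?E" .
qed

end

section \<open>The Lax--Milgram theorem\<close>

text \<open>Elements that are identified (functions equal almost everywhere) are not equal, so the
  form is only assumed to be positive semidefinite.\<close>

locale semi_hilbert =
  fixes V :: "('a \<Rightarrow> real) set" and B :: "('a \<Rightarrow> real) \<Rightarrow> ('a \<Rightarrow> real) \<Rightarrow> real"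
  assumes nonempty: "V \<noteq> {}"
    and comb: "\<And>u v c. u \<in> V \<Longrightarrow> v \<in> V \<Longrightarrow> (\<lambda>x. u x + c * v x) \<in> V"
    and sym: "\<And>u v. u \<in> V \<Longrightarrow> v \<in> V \<Longrightarrow> B u v = B v u"
    and lin: "\<And>u v w c. u \<in> V \<Longrightarrow> v \<in> V \<Longrightarrow> w \<in> V \<Longrightarrow> B (\<lambda>x. u x + c * v x) w = B u w + c * B v w"
    and pos: "\<And>u. u \<in> V \<Longrightarrow> 0 \<le> B u u"
    and complete: "\<And>u. (\<And>n::nat. u n \<in> V) \<Longrightarrow>
      (\<And>e. 0 < e \<Longrightarrow> \<exists>N. \<forall>m\<ge>N. \<forall>n\<ge>N. B (\<lambda>x. u m x - u n x) (\<lambda>x. u m x - u n x) < e) \<Longrightarrow>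
      \<exists>z\<in>V. (\<lambda>n. B (\<lambda>x. u n x - z x) (\<lambda>x. u n x - z x)) \<longlonglongrightarrow> 0"
begin

lemma diff_closed: "u \<in> V \<Longrightarrow> v \<in> V \<Longrightarrow> (\<lambda>x. u x - v x) \<in> V"
  using comb[of u v "-1"] by simp

lemma lin_diff: "u \<in> V \<Longrightarrow> v \<in> V \<Longrightarrow> w \<in> V \<Longrightarrow> B (\<lambda>x. u x - v x) w = B u w - B v w"
  using lin[of u v w "-1"] by simp

lemma lin_right: "u \<in> V \<Longrightarrow> v \<in> V \<Longrightarrow> w \<in> V \<Longrightarrow> B w (\<lambda>x. u x + c * v x) = B w u + c * B w v"
  using lin[of u v w c] comb[of u v c] sym by simp

lemma B_comb: "u \<in> V \<Longrightarrow> v \<in> V \<Longrightarrow> B (\<lambda>x. u x + c * v x) (\<lambda>x. u x + c * v x) = B u u + 2 * c * B u v + c\<^sup>2 * B v v"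
  using comb[of u v c] sym[of v u] by (simp add: lin lin_right power2_eq_square algebra_simps)

lemma B_diff: "u \<in> V \<Longrightarrow> v \<in> V \<Longrightarrow> B (\<lambda>x. u x - v x) (\<lambda>x. u x - v x) = B u u - 2 * B u v + B v v"
  using B_comb[of u v "-1"] by simp

lemma quadratic_nonneg_imp:
  fixes b c :: real
  assumes "\<And>t. 0 \<le> 2 * t * b + t\<^sup>2 * c" shows "b = 0"
proof (rule ccontr)
  assume b: "b \<noteq> 0"
  have c: "0 \<le> c" using assms[of 1] assms[of "-1"] by simp
  \<comment> \<open>The quadratic is minimal at - b / c; the denominator \<open>c + 1\<close> also
    covers c = 0 and still produces a negative value.\<close>
  define t where "t = - b / (c + 1)"
  have tc: "t * (c + 1) = - b" using c by (simp add: t_def)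
  have "(c + 1)\<^sup>2 * (2 * t * b + t\<^sup>2 * c) = 2 * (t * (c + 1)) * b * (c + 1) + (t * (c + 1))\<^sup>2 * c"
    by (simp add: power2_eq_square algebra_simps)
  also have "\<dots> = - (b\<^sup>2 * (c + 2))"
    unfolding tc by (simp add: power2_eq_square algebra_simps)
  finally have "(c + 1)\<^sup>2 * (2 * t * b + t\<^sup>2 * c) = - (b\<^sup>2 * (c + 2))" .
  moreover have "0 \<le> (c + 1)\<^sup>2 * (2 * t * b + t\<^sup>2 * c)"
    using assms[of t] by (intro mult_nonneg_nonneg) auto
  moreover have "0 < b\<^sup>2 * (c + 2)" using b c by (intro mult_pos_pos) auto
  ultimately show False by simp
qed

lemma Cauchy_Schwarz: 
  assumes "u \<in> V" "v \<in> V" shows "\<bar>B u v\<bar> \<le> sqrt (B u u) * sqrt (B v v)"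
proof -
  have q: "0 \<le> B u u + 2 * t * B u v + t\<^sup>2 * B v v" for t
    using pos[OF comb[OF assms, of t]] B_comb[OF assms, of t] by simp
  have "(B u v)\<^sup>2 \<le> B u u * B v v"
  proof (cases "B v v = 0")
    case True
    have "B u v = 0"
    proof (rule ccontr)
      assume n: "B u v \<noteq> 0"
      \<comment> \<open>\<open>B v v = 0\<close> does not make \<open>v\<close> zero, but the
        quadratic in \<open>q\<close> is then linear in \<open>t\<close>, and at this point it takes
        the value -1.\<close>
      show False using q[of "- (B u u + 1) / (2 * B u v)"] n True by (simp add: field_simps)
    qed
    then show ?thesis using True by simp
  next
    case False
    then have p: "0 < B v v" using pos[OF assms(2)] by simp
    have "B u u + 2 * (- B u v / B v v) * B u v + (- B u v / B v v)\<^sup>2 * B v v = B u u - (B u v)\<^sup>2 / B v v"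
      using p by (simp add: power2_eq_square)
    then have "(B u v)\<^sup>2 / B v v \<le> B u u" using q[of "- B u v / B v v"] by simp
    then show ?thesis using p by (simp add: divide_le_eq)
  qed
  then have "sqrt ((B u v)\<^sup>2) \<le> sqrt (B u u * B v v)" by (rule real_sqrt_le_mono)
  then show ?thesis by (simp add: real_sqrt_mult)
qed

text \<open>A variational proof: the representing element minimises \<open>B v v - 2 * l v\<close>.
  The parallelogram identity makes a minimising sequence Cauchy, and completeness supplies its
  limit.\<close>

lemma Riesz:
  assumes l: "\<And>u v c. u \<in> V \<Longrightarrow> v \<in> V \<Longrightarrow> l (\<lambda>x. u x + c * v x) = l u + c * l v"
    and C: "\<And>u. u \<in> V \<Longrightarrow> \<bar>l u\<bar> \<le> C * sqrt (B u u)"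
  shows "\<exists>z\<in>V. \<forall>v\<in>V. B z v = l v"
proof -
  define J where "J v = B v v - 2 * l v" for v
  have low: "- C\<^sup>2 \<le> J v" if "v \<in> V" for v
  proof -
    have "0 \<le> (sqrt (B v v) - C)\<^sup>2" by simp
    also have "\<dots> = B v v - 2 * C * sqrt (B v v) + C\<^sup>2" using pos[OF that] by (simp add: power2_diff)
    finally show ?thesis using C[OF that] unfolding J_def by (simp add: abs_le_iff)
  qed
  define m where "m = Inf (J ` V)"
  have bdd: "bdd_below (J ` V)" using low by (intro bdd_belowI2)
  have mle: "m \<le> J v" if "v \<in> V" for v unfolding m_def using that bdd by (intro cInf_lower) auto
  have "\<exists>v\<in>V. J v < m + e" if "0 < e" for e
    using cInf_lessD[of "J ` V" "m + e"] nonempty that unfolding m_def by auto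
  then have "\<forall>n. \<exists>v\<in>V. J v < m + 1 / real (Suc n)" by simp
  then obtain v where v: "\<And>n. v n \<in> V" "\<And>n. J (v n) < m + 1 / real (Suc n)" by metis
  define \<delta> where "\<delta> n = 1 / real (Suc n)" for n
  have v\<delta>: "J (v n) < m + \<delta> n" for n using v(2) by (simp add: \<delta>_def)
  \<comment> \<open>For the midpoint \<open>?h\<close>, four times \<open>J ?h\<close> is 2 J a + 2
    J b minus the form at a - b, and \<open>J ?h\<close> is at least \<open>m\<close>. The midpoint
    is written as a + (b - a) / 2 to fit \<open>comb\<close>.\<close>
  have par: "B (\<lambda>x. a x - b x) (\<lambda>x. a x - b x) \<le> 2 * (J a - m) + 2 * (J b - m)" if "a \<in> V" "b \<in> V" for a b
  proof -
    let ?d = "\<lambda>x. b x + (-1) * a x"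
    let ?h = "\<lambda>x. a x + (1/2) * ?d x"
    have d: "?d \<in> V" using comb[OF that(2,1), of "-1"] by simp
    have Bdd: "B ?d ?d = B b b - 2 * B a b + B a a"
      using B_comb[OF that(2,1), of "-1"] sym[OF that] by simp
    have Bad: "B a ?d = B a b - B a a" using lin_right[OF that(2,1,1), of "-1"] by simp
    have "J ?h = (B a a + B a ?d + 1/4 * B ?d ?d) - 2 * (l a + 1/2 * l ?d)"
      unfolding J_def using B_comb[OF that(1) d, of "1/2"] l[OF that(1) d, of "1/2"] by (simp add: power2_eq_square)
    moreover have "l ?d = l b - l a" using l[OF that(2,1), of "-1"] by simp
    ultimately have "4 * J ?h = B a a + B b b + 2 * B a b - 4 * l a - 4 * l b"
      unfolding Bdd Bad by argo
    moreover have "m \<le> J ?h" by (rule mle[OF comb[OF that(1) d]])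
    ultimately show ?thesis unfolding B_diff[OF that] J_def by simp
  qed
  have "\<exists>N. \<forall>p\<ge>N. \<forall>q\<ge>N. B (\<lambda>x. v p x - v q x) (\<lambda>x. v p x - v q x) < e" if e: "0 < e" for e
  proof -
    obtain N where N: "\<delta> N < e / 4" using nat_approx_posE[of "e/4"] e unfolding \<delta>_def by auto
    have "B (\<lambda>x. v p x - v q x) (\<lambda>x. v p x - v q x) < e" if "p \<ge> N" "q \<ge> N" for p q
    proof -
      have "\<delta> p \<le> \<delta> N" "\<delta> q \<le> \<delta> N"
        using that by (simp_all add: \<delta>_def frac_le)
      then show ?thesis using par[OF v(1)[of p] v(1)[of q]] v\<delta>[of p] v\<delta>[of q] N by argo
    qed
    then show ?thesis by blast
  qed
  with complete[of v] v(1) obtain z where z: "z \<in> V" "(\<lambda>n. B (\<lambda>x. v n x - z x) (\<lambda>x. v n x - z x)) \<longlonglongrightarrow> 0"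
    by blast
  have "B z w = l w" if w: "w \<in> V" for w
  proof -
    have lim: "(\<lambda>n. B (v n) w) \<longlonglongrightarrow> B z w"
    proof (rule LIM_zero_cancel, rule Lim_null_comparison)
      have "(\<lambda>n. sqrt (B (\<lambda>x. v n x - z x) (\<lambda>x. v n x - z x)) * sqrt (B w w)) \<longlonglongrightarrow> sqrt 0 * sqrt (B w w)"
        by (intro tendsto_mult tendsto_real_sqrt z(2) tendsto_const)
      then show "(\<lambda>n. sqrt (B (\<lambda>x. v n x - z x) (\<lambda>x. v n x - z x)) * sqrt (B w w)) \<longlonglongrightarrow> 0" by simp
      show "\<forall>\<^sub>F n in sequentially. norm (B (v n) w - B z w) \<le> sqrt (B (\<lambda>x. v n x - z x) (\<lambda>x. v n x - z x)) * sqrt (B w w)"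
        using Cauchy_Schwarz[OF diff_closed[OF v(1) z(1)] w] lin_diff[OF v(1) z(1) w] by simp
    qed
    \<comment> \<open>Minimality is exploited along the sequence: \<open>m\<close> is at most the
      value of \<open>J\<close> at \<open>v n + t w\<close>, while \<open>J (v n)\<close> exceeds
      \<open>m\<close> by less than 1 / (n + 1). The limit is taken in the resulting inequality, so
      continuity of \<open>J\<close> at \<open>z\<close> is not asked for.\<close>
    have "0 \<le> 2 * t * (B z w - l w) + t\<^sup>2 * B w w" for t
    proof (rule LIMSEQ_le_const)
      show "(\<lambda>n. 2 * t * (B (v n) w - l w) + t\<^sup>2 * B w w + 1 / real (Suc n)) \<longlonglongrightarrow> 2 * t * (B z w - l w) + t\<^sup>2 * B w w"
      proof -
        have "(\<lambda>n. 2 * t * (B (v n) w - l w) + t\<^sup>2 * B w w + 1 / real (Suc n)) \<longlonglongrightarrow> 2 * t * (B z w - l w) + t\<^sup>2 * B w w + 0"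
          by (intro tendsto_add tendsto_mult tendsto_diff lim tendsto_const LIMSEQ_inverse_real_of_nat[unfolded inverse_eq_divide])
        then show ?thesis by simp
      qed
      have "0 \<le> 2 * t * (B (v n) w - l w) + t\<^sup>2 * B w w + 1 / real (Suc n)" for n
      proof -
        have "m \<le> J (\<lambda>x. v n x + t * w x)" by (rule mle[OF comb[OF v(1) w]])
        also have "\<dots> = J (v n) + 2 * t * (B (v n) w - l w) + t\<^sup>2 * B w w"
          unfolding J_def B_comb[OF v(1) w] l[OF v(1) w] by (simp add: algebra_simps)
        finally show ?thesis using v(2)[of n] by linarith
      qed
      then show "\<exists>N. \<forall>n\<ge>N. 0 \<le> 2 * t * (B (v n) w - l w) + t\<^sup>2 * B w w + 1 / real (Suc n)" by blast
    qed
    then show ?thesis using quadratic_nonneg_imp[of "B z w - l w" "B w w"] by simp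
  qed
  with z(1) show ?thesis by blast
qed

text \<open>If \<open>A\<close> represents the form \<open>a\<close> and \<open>f\<close> the functional \<open>l\<close>, the equation \<open>A u = f\<close> is solved
  weakly against the range of \<open>A\<close> by a second use of Riesz' theorem, now for \<open>B (A u) (A v)\<close>;
  coercivity shows that the range of \<open>A\<close> is large enough.\<close>

theorem Lax_Milgram:
  assumes al: "\<And>u v w c. u \<in> V \<Longrightarrow> v \<in> V \<Longrightarrow> w \<in> V \<Longrightarrow> a (\<lambda>x. u x + c * v x) w = a u w + c * a v w"
    and ar: "\<And>u v w c. u \<in> V \<Longrightarrow> v \<in> V \<Longrightarrow> w \<in> V \<Longrightarrow> a w (\<lambda>x. u x + c * v x) = a w u + c * a w v"
    and K: "\<And>u v. u \<in> V \<Longrightarrow> v \<in> V \<Longrightarrow> \<bar>a u v\<bar> \<le> K * sqrt (B u u) * sqrt (B v v)"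
    and coercive: "\<And>u. u \<in> V \<Longrightarrow> \<alpha> * B u u \<le> a u u" and \<alpha>: "0 < \<alpha>"
    and l: "\<And>u v c. u \<in> V \<Longrightarrow> v \<in> V \<Longrightarrow> l (\<lambda>x. u x + c * v x) = l u + c * l v"
    and C: "\<And>u. u \<in> V \<Longrightarrow> \<bar>l u\<bar> \<le> C * sqrt (B u u)"
  shows "\<exists>u\<in>V. \<forall>v\<in>V. a u v = l v"
proof -
  have "\<exists>z\<in>V. \<forall>v\<in>V. B z v = a u v" if "u \<in> V" for u
    by (rule Riesz[where C = "K * sqrt (B u u)"]) (use ar K that in auto)
  then obtain A where A: "\<And>u. u \<in> V \<Longrightarrow> A u \<in> V" "\<And>u v. u \<in> V \<Longrightarrow> v \<in> V \<Longrightarrow> B (A u) v = a u v" by metis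
  obtain f where f: "f \<in> V" "\<And>v. v \<in> V \<Longrightarrow> B f v = l v" using Riesz[OF l C] by blast
  have B': "B (A u) (A v) = a u (A v)" if "u \<in> V" "v \<in> V" for u v using A that by simp
  \<comment> \<open>Together with \<open>upper\<close> this makes \<open>B (A u) (A u)\<close>
    comparable to \<open>B u u\<close>, which is why completeness carries over to the second
    form.\<close>
  have lower: "\<alpha>\<^sup>2 * B u u \<le> B (A u) (A u)" if u: "u \<in> V" for u
  proof (cases "B u u = 0")
    case False
    then have s: "0 < sqrt (B u u)" using pos[OF u] by simp
    have "(\<alpha> * sqrt (B u u)) * sqrt (B u u) \<le> sqrt (B (A u) (A u)) * sqrt (B u u)"
      using coercive[OF u] Cauchy_Schwarz[OF A(1)[OF u] u] A(2)[OF u u] pos[OF u] by (simp add: mult.assoc)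
    then have "\<alpha> * sqrt (B u u) \<le> sqrt (B (A u) (A u))"
      using s by (simp only: mult_le_cancel_right_pos)
    then have "(\<alpha> * sqrt (B u u))\<^sup>2 \<le> (sqrt (B (A u) (A u)))\<^sup>2"
      using \<alpha> pos[OF u] by (intro power_mono) auto
    then show ?thesis using pos[OF u] pos[OF A(1)[OF u]] by (simp add: power_mult_distrib)
  qed (use pos[OF A(1)[OF u]] in simp)
  have upper: "B (A u) (A u) \<le> K\<^sup>2 * B u u" if u: "u \<in> V" for u
  proof (cases "B (A u) (A u) = 0")
    case False
    then have s: "0 < sqrt (B (A u) (A u))" using pos[OF A(1)[OF u]] by simp
    have "sqrt (B (A u) (A u)) * sqrt (B (A u) (A u)) \<le> (K * sqrt (B u u)) * sqrt (B (A u) (A u))"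
      using K[OF u A(1)[OF u]] A(2)[OF u A(1)[OF u]] pos[OF A(1)[OF u]] by simp
    then have "sqrt (B (A u) (A u)) \<le> K * sqrt (B u u)" using s by (simp only: mult_le_cancel_right_pos)
    then have "(sqrt (B (A u) (A u)))\<^sup>2 \<le> (K * sqrt (B u u))\<^sup>2" using s by (intro power_mono) auto
    then show ?thesis using pos[OF u] pos[OF A(1)[OF u]] by (simp add: power_mult_distrib)
  qed (use pos[OF u] in simp)
  interpret A: semi_hilbert V "\<lambda>u v. B (A u) (A v)"
  proof
    fix u v w :: "'a \<Rightarrow> real" and c :: real assume uvw: "u \<in> V" "v \<in> V" "w \<in> V"
    show "B (A (\<lambda>x. u x + c * v x)) (A w) = B (A u) (A w) + c * B (A v) (A w)"
      using uvw A comb[OF uvw(1,2), of c] al[OF uvw(1,2) A(1)[OF uvw(3)]] by simp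
  next
    fix u :: "nat \<Rightarrow> 'a \<Rightarrow> real"
    let ?d = "\<lambda>m n x. u m x - u n x"
    assume u: "\<And>n. u n \<in> V" and cau: "\<And>e. 0 < e \<Longrightarrow> \<exists>N. \<forall>m\<ge>N. \<forall>n\<ge>N. B (A (?d m n)) (A (?d m n)) < e"
    have "\<exists>N. \<forall>m\<ge>N. \<forall>n\<ge>N. B (?d m n) (?d m n) < e" if e: "0 < e" for e
    proof -
      obtain N where N: "\<And>m n. m \<ge> N \<Longrightarrow> n \<ge> N \<Longrightarrow> B (A (?d m n)) (A (?d m n)) < \<alpha>\<^sup>2 * e"
        using cau[of "\<alpha>\<^sup>2 * e"] e \<alpha> by auto
      have "B (?d m n) (?d m n) < e" if mn: "m \<ge> N" "n \<ge> N" for m n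
      proof -
        have "\<alpha>\<^sup>2 * B (?d m n) (?d m n) < \<alpha>\<^sup>2 * e"
          using N[OF mn] lower[OF diff_closed[OF u[of m] u[of n]]] by simp
        then show ?thesis using \<alpha> by simp
      qed
      then show ?thesis by blast
    qed
    from complete[OF u this] obtain z where z: "z \<in> V" "(\<lambda>n. B (\<lambda>x. u n x - z x) (\<lambda>x. u n x - z x)) \<longlonglongrightarrow> 0"
      by blast
    have "(\<lambda>n. K\<^sup>2 * B (\<lambda>x. u n x - z x) (\<lambda>x. u n x - z x)) \<longlonglongrightarrow> K\<^sup>2 * 0"
      by (rule tendsto_mult_left[OF z(2)])
    then have lim: "(\<lambda>n. K\<^sup>2 * B (\<lambda>x. u n x - z x) (\<lambda>x. u n x - z x)) \<longlonglongrightarrow> 0" by simp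
    have "(\<lambda>n. B (A (\<lambda>x. u n x - z x)) (A (\<lambda>x. u n x - z x))) \<longlonglongrightarrow> 0"
      by (rule tendsto_sandwich[OF _ _ tendsto_const lim])
         (use pos A(1) upper diff_closed[OF u z(1)] in auto)
    with z(1) show "\<exists>z\<in>V. (\<lambda>n. B (A (\<lambda>x. u n x - z x)) (A (\<lambda>x. u n x - z x))) \<longlonglongrightarrow> 0" by blast
  qed (use nonempty comb sym pos A(1) in auto)
  have "\<exists>u\<in>V. \<forall>v\<in>V. B (A u) (A v) = a v f"
  proof (rule A.Riesz)
    fix u assume u: "u \<in> V"
    show "\<bar>a u f\<bar> \<le> sqrt (B f f) * sqrt (B (A u) (A u))"
      using Cauchy_Schwarz[OF A(1)[OF u] f(1)] A(2)[OF u f(1)] by (simp add: mult.commute)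
  qed (use al f(1) in auto)
  then obtain u where u: "u \<in> V" "\<And>v. v \<in> V \<Longrightarrow> B (A u) (A v) = a v f" by blast
  let ?z = "\<lambda>x. A u x - f x"
  have z: "?z \<in> V" by (rule diff_closed[OF A(1)[OF u(1)] f(1)])
  \<comment> \<open>By the choice of \<open>u\<close>, the element \<open>?z\<close> is orthogonal
    to every \<open>A v\<close>, which says \<open>a v ?z = 0\<close>. Taking \<open>v = ?z\<close>
    then lets coercivity act.\<close>
  have "a v ?z = 0" if "v \<in> V" for v
    using ar[OF A(1)[OF u(1)] f(1) that, of "-1"] u(2)[OF that] A that u(1) sym[OF A(1)[OF u(1)] A(1)[OF that]] by simp
  then have "\<alpha> * B ?z ?z \<le> 0" using coercive[OF z] z by simp
  then have "B ?z ?z = 0" using \<alpha> pos[OF z] by (simp add: mult_le_0_iff)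
  then have "B ?z v = 0" if "v \<in> V" for v using Cauchy_Schwarz[OF z that] by simp
  then have "B (A u) v = l v" if "v \<in> V" for v
    using lin_diff[OF A(1)[OF u(1)] f(1) that] f(2)[OF that] that by simp
  then show ?thesis using A(2)[OF u(1)] u(1) by auto
qed

end

section \<open>Sobolev spaces\<close>

text \<open>The L2 norms of \<open>hs_rep\<close> and \<open>en_rep\<close> are the Sobolev norm and
  the square root of the energy. Statements about Sobolev spaces thereby become statements about
  L2.\<close>

definition hs_rep :: "real \<Rightarrow> (real \<Rightarrow> real) \<Rightarrow> real \<Rightarrow> complex" where
  "hs_rep \<sigma> u \<omega> = ((1 + \<bar>\<omega>\<bar>\<^sup>2) powr (\<sigma> / 2)) *\<^sub>R fourier u \<omega>"

definition en_rep :: "real \<Rightarrow> (real \<Rightarrow> real) \<Rightarrow> real \<Rightarrow> complex" where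
  "en_rep \<sigma> u \<omega> = (\<bar>\<omega>\<bar> powr \<sigma>) *\<^sub>R fourier u \<omega>"

lemma powr_half_square: "(x powr (\<sigma> / 2))\<^sup>2 = x powr \<sigma>" for x :: real
  by (simp add: power2_eq_square powr_add[symmetric])

lemma norm_hs_rep: "(norm (hs_rep \<sigma> u \<omega>))\<^sup>2 = (1 + \<bar>\<omega>\<bar>\<^sup>2) powr \<sigma> * (norm (fourier u \<omega>))\<^sup>2"
proof -
  have "(norm (hs_rep \<sigma> u \<omega>))\<^sup>2 = ((1 + \<bar>\<omega>\<bar>\<^sup>2) powr (\<sigma> / 2))\<^sup>2 * (norm (fourier u \<omega>))\<^sup>2"
    by (simp add: hs_rep_def power_mult_distrib)
  then show ?thesis unfolding powr_half_square .
qed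

lemma norm_en_rep: "(norm (en_rep \<sigma> u \<omega>))\<^sup>2 = \<bar>\<omega>\<bar> powr (2 * \<sigma>) * (norm (fourier u \<omega>))\<^sup>2"
  using powr_half_square[of "\<bar>\<omega>\<bar>" "2 * \<sigma>"] by (simp add: en_rep_def power_mult_distrib)

lemma Hs_norm_eq: "Hs_norm \<sigma> u = L2_norm lborel (hs_rep \<sigma> u)"
  by (simp add: Hs_norm_def L2_norm_def norm_hs_rep)

lemma Hs_norm_nonneg [simp]: "0 \<le> Hs_norm \<sigma> u"
  by (simp add: Hs_norm_eq)

lemma energy_eq: "seminorm_energy \<sigma> (fourier u) = (L2_norm lborel (en_rep \<sigma> u))\<^sup>2"
  by (simp add: seminorm_energy_def L2_norm_sq norm_en_rep)

lemma rep_measurable: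
  assumes "u \<in> L2 lborel"
  shows "hs_rep \<sigma> u \<in> borel_measurable borel" "en_rep \<sigma> u \<in> borel_measurable borel"
  using fourier_measurable[OF assms] unfolding hs_rep_def[abs_def] en_rep_def[abs_def] by measurable

lemma Hs_iff: "u \<in> Hs \<sigma> \<longleftrightarrow> u \<in> L2 lborel \<and> hs_rep \<sigma> u \<in> L2 lborel"
proof -
  have "hs_rep \<sigma> u \<in> L2 lborel \<longleftrightarrow> integrable lborel (\<lambda>\<omega>. (1 + \<bar>\<omega>\<bar>\<^sup>2) powr \<sigma> * (norm (fourier u \<omega>))\<^sup>2)"
    if "u \<in> L2 lborel"
    using rep_measurable[OF that] by (simp add: L2_def norm_hs_rep)
  then show ?thesis using has_fourier_exists by (auto simp: Hs_def)
qed

lemma Hs_L2: "u \<in> Hs \<sigma> \<Longrightarrow> u \<in> L2 lborel" and Hs_rep_L2: "u \<in> Hs \<sigma> \<Longrightarrow> hs_rep \<sigma> u \<in> L2 lborel"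
  by (simp_all add: Hs_iff)

lemma hs_rep_comb:
  assumes "u \<in> L2 lborel" "v \<in> L2 lborel"
  shows "AE \<omega> in lborel. hs_rep \<sigma> (\<lambda>x. u x + c * v x) \<omega> = hs_rep \<sigma> u \<omega> + c *\<^sub>R hs_rep \<sigma> v \<omega>"
  using fourier_comb[OF assms, of c] by eventually_elim (simp add: hs_rep_def algebra_simps)

lemma en_rep_comb:
  assumes "u \<in> L2 lborel" "v \<in> L2 lborel"
  shows "AE \<omega> in lborel. en_rep \<sigma> (\<lambda>x. u x + c * v x) \<omega> = en_rep \<sigma> u \<omega> + c *\<^sub>R en_rep \<sigma> v \<omega>"
  using fourier_comb[OF assms, of c] by eventually_elim (simp add: en_rep_def algebra_simps)

lemma Hs_comb:
  assumes "u \<in> Hs \<sigma>" "v \<in> Hs \<sigma>" shows "(\<lambda>x. u x + c * v x) \<in> Hs \<sigma>"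
proof -
  note uv = assms[THEN Hs_L2]
  have L: "(\<lambda>x. u x + c * v x) \<in> L2 lborel" by (rule L2_comb_real[OF uv])
  have "hs_rep \<sigma> (\<lambda>x. u x + c * v x) \<in> L2 lborel"
    by (rule L2_cong_AE[OF L2_comb[OF assms[THEN Hs_rep_L2], of c]])
       (use rep_measurable(1)[OF L] hs_rep_comb[OF uv, THEN AE_symmetric] in auto)
  with L show ?thesis by (simp add: Hs_iff)
qed

lemma Hs_diff: "u \<in> Hs \<sigma> \<Longrightarrow> v \<in> Hs \<sigma> \<Longrightarrow> (\<lambda>x. u x - v x) \<in> Hs \<sigma>"
  using Hs_comb[of u \<sigma> v "-1"] by simp

lemma Hs_norm_comb:
  assumes "u \<in> Hs \<sigma>" "v \<in> Hs \<sigma>"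
  shows "Hs_norm \<sigma> (\<lambda>x. u x + c * v x) = L2_norm lborel (\<lambda>\<omega>. hs_rep \<sigma> u \<omega> + c *\<^sub>R hs_rep \<sigma> v \<omega>)"
  unfolding Hs_norm_eq
  by (rule L2_norm_cong_AE) (use L2_measurable[OF Hs_rep_L2[OF Hs_comb[OF assms]]] L2_measurable[OF L2_comb[OF assms[THEN Hs_rep_L2]]]
    hs_rep_comb[OF assms[THEN Hs_L2]] in auto)

lemma Hs_norm_diff:
  assumes "u \<in> Hs \<sigma>" "v \<in> Hs \<sigma>"
  shows "Hs_norm \<sigma> (\<lambda>x. u x - v x) = L2_norm lborel (\<lambda>\<omega>. hs_rep \<sigma> u \<omega> - hs_rep \<sigma> v \<omega>)"
  using Hs_norm_comb[OF assms, of "-1"] by simp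

lemma Hs_norm_triangle:
  assumes "u \<in> Hs \<sigma>" "v \<in> Hs \<sigma>" "w \<in> Hs \<sigma>"
  shows "Hs_norm \<sigma> (\<lambda>x. u x - w x) \<le> Hs_norm \<sigma> (\<lambda>x. u x - v x) + Hs_norm \<sigma> (\<lambda>x. v x - w x)"
  using L2_norm_diff_triangle[OF assms[THEN Hs_rep_L2]] by (simp add: Hs_norm_diff assms)

lemma Hs_norm_commute:
  assumes "u \<in> Hs \<sigma>" "v \<in> Hs \<sigma>"
  shows "Hs_norm \<sigma> (\<lambda>x. u x - v x) = Hs_norm \<sigma> (\<lambda>x. v x - u x)"
  unfolding Hs_norm_diff[OF assms] Hs_norm_diff[OF assms(2,1)] by (rule L2_norm_minus_commute)

lemma L2_norm_le_Hs_norm: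
  assumes "0 \<le> \<sigma>" "u \<in> Hs \<sigma>" shows "L2_norm lborel u \<le> Hs_norm \<sigma> u"
proof -
  note u = Hs_L2[OF assms(2)]
  have "norm (fourier u \<omega>) \<le> norm (hs_rep \<sigma> u \<omega>)" for \<omega>
  proof -
    have "1 \<le> (1 + \<bar>\<omega>\<bar>\<^sup>2) powr (\<sigma> / 2)" using assms(1) by (intro ge_one_powr_ge_zero) auto
    from mult_right_mono[OF this norm_ge_zero[of "fourier u \<omega>"]] show ?thesis by (simp add: hs_rep_def)
  qed
  then have "(norm (fourier u \<omega>))\<^sup>2 \<le> (norm (hs_rep \<sigma> u \<omega>))\<^sup>2" for \<omega>
    by (rule power_mono) simp
  then have "L2_norm lborel (fourier u) \<le> L2_norm lborel (hs_rep \<sigma> u)"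
    unfolding L2_norm_def by (intro real_sqrt_le_mono integral_mono L2_integrable fourier_L2 u Hs_rep_L2 assms(2))
  then show ?thesis by (simp add: Plancherel[OF u] Hs_norm_eq)
qed

lemma norm_en_rep_le:
  assumes "0 \<le> \<sigma>" shows "norm (en_rep \<sigma> u \<omega>) \<le> norm (hs_rep \<sigma> u \<omega>)"
proof -
  have "\<bar>\<omega>\<bar> powr \<sigma> = (\<bar>\<omega>\<bar> powr 2) powr (\<sigma> / 2)" by (simp add: powr_powr del: powr_numeral)
  also have "\<dots> \<le> (1 + \<bar>\<omega>\<bar>\<^sup>2) powr (\<sigma> / 2)" using assms by (intro powr_mono2) auto
  finally show ?thesis
    unfolding hs_rep_def en_rep_def norm_scaleR by (intro mult_right_mono) auto
qed

lemma en_rep_L2: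
  assumes "0 \<le> \<sigma>" "u \<in> Hs \<sigma>" shows "en_rep \<sigma> u \<in> L2 lborel"
  by (rule L2_bound[OF Hs_rep_L2[OF assms(2)], where c = 1])
     (use rep_measurable[OF Hs_L2[OF assms(2)]] norm_en_rep_le[OF assms(1)] in auto)

lemma en_rep_norm_le:
  assumes "0 \<le> \<sigma>" "u \<in> Hs \<sigma>" shows "L2_norm lborel (en_rep \<sigma> u) \<le> Hs_norm \<sigma> u"
  unfolding Hs_norm_eq L2_norm_def
  by (intro real_sqrt_le_mono integral_mono L2_integrable en_rep_L2 Hs_rep_L2 assms power_mono norm_en_rep_le) simp

lemma en_rep_norm_diff:
  assumes "0 \<le> \<sigma>" "u \<in> Hs \<sigma>" "v \<in> Hs \<sigma>"
  shows "L2_norm lborel (\<lambda>\<omega>. en_rep \<sigma> u \<omega> - en_rep \<sigma> v \<omega>) \<le> Hs_norm \<sigma> (\<lambda>x. u x - v x)"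
proof -
  have "L2_norm lborel (\<lambda>\<omega>. en_rep \<sigma> u \<omega> - en_rep \<sigma> v \<omega>) = L2_norm lborel (en_rep \<sigma> (\<lambda>x. u x - v x))"
    using en_rep_comb[OF assms(2,3)[THEN Hs_L2], of \<sigma> "-1"]
      L2_measurable[OF L2_diff[OF en_rep_L2[OF assms(1,2)] en_rep_L2[OF assms(1,3)]]]
      L2_measurable[OF en_rep_L2[OF assms(1) Hs_diff[OF assms(2,3)]]]
    by (intro L2_norm_cong_AE) auto
  also have "\<dots> \<le> Hs_norm \<sigma> (\<lambda>x. u x - v x)" by (rule en_rep_norm_le[OF assms(1) Hs_diff[OF assms(2,3)]])
  finally show ?thesis .
qed

definition hs_ip :: "real \<Rightarrow> (real \<Rightarrow> real) \<Rightarrow> (real \<Rightarrow> real) \<Rightarrow> real" where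
  "hs_ip \<sigma> u v = L2_ip lborel (hs_rep \<sigma> u) (hs_rep \<sigma> v)"

lemma hs_ip_self: "hs_ip \<sigma> u u = (Hs_norm \<sigma> u)\<^sup>2"
  by (simp add: hs_ip_def L2_ip_self Hs_norm_eq)

lemma hs_ip_comb:
  assumes "u \<in> Hs \<sigma>" "v \<in> Hs \<sigma>" "w \<in> Hs \<sigma>"
  shows "hs_ip \<sigma> (\<lambda>x. u x + c * v x) w = hs_ip \<sigma> u w + c * hs_ip \<sigma> v w"
proof -
  have "hs_ip \<sigma> (\<lambda>x. u x + c * v x) w = L2_ip lborel (\<lambda>\<omega>. hs_rep \<sigma> u \<omega> + c *\<^sub>R hs_rep \<sigma> v \<omega>) (hs_rep \<sigma> w)"
    unfolding hs_ip_def
    using hs_rep_comb[OF assms(1,2)[THEN Hs_L2]]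
    by (intro L2_ip_cong_AE L2_measurable Hs_rep_L2 Hs_comb L2_comb assms) auto
  then show ?thesis
    using L2_ip_comb_left[OF assms[THEN Hs_rep_L2]] by (simp add: hs_ip_def)
qed

text \<open>After division by (1 + t)^\<sigma> the claim concerns two numbers of [0, 1] with sum 1,
  each of which is at most its own \<sigma>-th power.\<close>

lemma one_plus_powr_le:
  fixes t :: real
  assumes "0 < \<sigma>" "\<sigma> \<le> 1" "0 \<le> t" shows "(1 + t) powr \<sigma> \<le> 1 + t powr \<sigma>"
proof -
  have le: "x \<le> x powr \<sigma>" if "0 \<le> x" "x \<le> 1" for x :: real
    using powr_mono'[OF assms(2) that] that by simp
  have "1 / (1 + t) \<le> (1 / (1 + t)) powr \<sigma>" "t / (1 + t) \<le> (t / (1 + t)) powr \<sigma>"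
    using assms(3) by (intro le; simp)+
  moreover have "1 / (1 + t) + t / (1 + t) = 1" using assms(3) by (simp add: field_simps)
  ultimately have "1 \<le> (1 / (1 + t)) powr \<sigma> + (t / (1 + t)) powr \<sigma>" by linarith
  also have "\<dots> = (1 + t powr \<sigma>) / (1 + t) powr \<sigma>"
    using assms(3) by (simp add: powr_divide add_divide_distrib)
  finally show ?thesis using assms(3) by (simp add: le_divide_eq)
qed

lemma Hs_norm_le_energy:
  assumes "0 < \<sigma>" "\<sigma> \<le> 1" "u \<in> Hs \<sigma>"
  shows "(Hs_norm \<sigma> u)\<^sup>2 \<le> (L2_norm lborel u)\<^sup>2 + seminorm_energy \<sigma> (fourier u)"
proof -
  note u = Hs_L2[OF assms(3)]
  have s0: "0 \<le> \<sigma>" using assms(1) by simp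
  have i: "integrable lborel (\<lambda>\<omega>. (norm (fourier u \<omega>))\<^sup>2)" "integrable lborel (\<lambda>\<omega>. (norm (en_rep \<sigma> u \<omega>))\<^sup>2)"
    by (intro L2_integrable fourier_L2 u en_rep_L2 assms(3) s0)+
  have "(Hs_norm \<sigma> u)\<^sup>2 \<le> (\<integral>\<omega>. (norm (fourier u \<omega>))\<^sup>2 + (norm (en_rep \<sigma> u \<omega>))\<^sup>2 \<partial>lborel)"
    unfolding Hs_norm_eq L2_norm_sq
  proof (rule integral_mono)
    fix \<omega> :: real
    have "(\<bar>\<omega>\<bar>\<^sup>2) powr \<sigma> = (\<bar>\<omega>\<bar> powr 2) powr \<sigma>" by simp
    also have "\<dots> = \<bar>\<omega>\<bar> powr (2 * \<sigma>)" by (simp add: powr_powr del: powr_numeral)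
    finally have "(1 + \<bar>\<omega>\<bar>\<^sup>2) powr \<sigma> \<le> 1 + \<bar>\<omega>\<bar> powr (2 * \<sigma>)"
      using one_plus_powr_le[OF assms(1,2), of "\<bar>\<omega>\<bar>\<^sup>2"] by simp
    from mult_right_mono[OF this, of "(norm (fourier u \<omega>))\<^sup>2"]
    show "(norm (hs_rep \<sigma> u \<omega>))\<^sup>2 \<le> (norm (fourier u \<omega>))\<^sup>2 + (norm (en_rep \<sigma> u \<omega>))\<^sup>2"
      unfolding norm_hs_rep norm_en_rep by (simp only: zero_le_power2 distrib_right mult_1_left)
  qed (use i L2_integrable[OF Hs_rep_L2[OF assms(3)]] in auto)
  also have "\<dots> = (L2_norm lborel (fourier u))\<^sup>2 + (L2_norm lborel (en_rep \<sigma> u))\<^sup>2"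
    using i by (simp add: L2_norm_sq)
  finally show ?thesis by (simp add: Plancherel[OF u] energy_eq)
qed

text \<open>On \<open>{-1..1}\<close> the transform of a function supported in the unit interval is bounded by
  \<open>\<parallel>u\<parallel> / sqrt (2 * pi)\<close>, so the low frequencies carry at most the fraction \<open>1 / pi\<close> of the norm.\<close>

lemma Poincare_fourier:
  assumes "0 \<le> \<sigma>" "u \<in> Hs \<sigma>" and supp: "AE x in lborel. x \<notin> {0<..<1} \<longrightarrow> u x = 0"
  shows "(1 - 1 / pi) * (L2_norm lborel u)\<^sup>2 \<le> seminorm_energy \<sigma> (fourier u)"
proof -
  note u = Hs_L2[OF assms(2)]
  have [measurable]: "u \<in> borel_measurable borel" using L2_measurable[OF u] by simp
  let ?N = "L2_norm lborel u"
  let ?v = "\<lambda>x. indicat_real {0..1} x * u x"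
  have AE: "AE x in lborel. u x = ?v x" using supp by eventually_elim (auto simp: indicator_def)
  have v: "integrable lborel ?v" "(\<integral>x. \<bar>?v x\<bar> \<partial>lborel) \<le> ?N"
    using L2_integrable_on_bounded[OF u, of 0 1] by simp_all
  have ui: "integrable lborel u" using integrable_cong_AE[of u lborel ?v] AE v(1) by auto
  have "(\<integral>x. \<bar>u x\<bar> \<partial>lborel) = (\<integral>x. \<bar>?v x\<bar> \<partial>lborel)"
    by (rule integral_cong_AE) (use AE in auto)
  then have "norm (fint u \<omega>) \<le> 1 / sqrt (2 * pi) * ?N" for \<omega>
    using fint_bound[OF ui, of \<omega>] v(2) mult_left_mono[OF v(2), of "1 / sqrt (2 * pi)"] by simp
  then have "(norm (fint u \<omega>))\<^sup>2 \<le> (1 / sqrt (2 * pi) * ?N)\<^sup>2" for \<omega> by (rule power_mono) simp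
  then have fb: "(norm (fint u \<omega>))\<^sup>2 \<le> ?N\<^sup>2 / (2 * pi)" for \<omega>
    by (simp add: power_mult_distrib power_divide)
  \<comment> \<open>Low frequencies are estimated by \<open>fb\<close>; for the others the weight in
    the energy is at least 1. The interval has length 2, so the constant integrates to
    \<open>?N\<^sup>2 / pi\<close>.\<close>
  have bd: "AE \<omega> in lborel. (norm (fourier u \<omega>))\<^sup>2 \<le> indicat_real {-1..1} \<omega> * (?N\<^sup>2 / (2 * pi)) + (norm (en_rep \<sigma> u \<omega>))\<^sup>2"
    using fourier_eq_fint[OF ui u]
  proof eventually_elim
    fix \<omega> assume eq: "fourier u \<omega> = fint u \<omega>"
    show "(norm (fourier u \<omega>))\<^sup>2 \<le> indicat_real {-1..1} \<omega> * (?N\<^sup>2 / (2 * pi)) + (norm (en_rep \<sigma> u \<omega>))\<^sup>2"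
    proof (cases "\<omega> \<in> {-1..1}")
      case True
      then show ?thesis using fb[of \<omega>] eq by (simp add: add_increasing2)
    next
      case False
      then have "1 \<le> \<bar>\<omega>\<bar> powr (2 * \<sigma>)" using assms(1) by (intro ge_one_powr_ge_zero) auto
      from mult_right_mono[OF this, of "(norm (fourier u \<omega>))\<^sup>2"] False
      show ?thesis by (simp add: norm_en_rep)
    qed
  qed
  have i: "integrable lborel (\<lambda>\<omega>. indicat_real {-1..1::real} \<omega> * (?N\<^sup>2 / (2 * pi)))"
    by (intro integrable_mult_left integrable_real_indicator) auto
  have ie: "integrable lborel (\<lambda>\<omega>. (norm (en_rep \<sigma> u \<omega>))\<^sup>2)"
    by (intro L2_integrable en_rep_L2 assms(1,2))
  have "?N\<^sup>2 = (\<integral>\<omega>. (norm (fourier u \<omega>))\<^sup>2 \<partial>lborel)"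
    by (simp add: L2_norm_sq[symmetric] Plancherel[OF u] del: L2_norm_sq)
  also have "\<dots> \<le> (\<integral>\<omega>. indicat_real {-1..1} \<omega> * (?N\<^sup>2 / (2 * pi)) + (norm (en_rep \<sigma> u \<omega>))\<^sup>2 \<partial>lborel)"
    by (rule integral_mono_AE[OF L2_integrable[OF fourier_L2[OF u]] _ bd]) (use i ie in auto)
  also have "\<dots> = ?N\<^sup>2 / pi + seminorm_energy \<sigma> (fourier u)"
    using i ie by (simp add: energy_eq L2_norm_sq)
  finally show ?thesis by (simp add: algebra_simps)
qed

section \<open>Test functions\<close>

lemma test_function_support:
  assumes "\<phi> \<in> test_functions" "x \<notin> {0<..<1}" shows "\<phi> x = 0" "deriv \<phi> x = 0"
proof -
  let ?S = "- closure {x. \<phi> x \<noteq> 0}"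
  have "closure {x. \<phi> x \<noteq> 0} \<subseteq> {0<..<1}" using assms(1) by (simp add: test_functions_def)
  with assms(2) have x: "x \<in> ?S" by blast
  have z: "\<phi> y = 0" if "y \<in> ?S" for y
    using that closure_subset[of "{x. \<phi> x \<noteq> 0}"] by blast
  show "\<phi> x = 0" by (rule z[OF x])
  have "open ?S" by (rule open_Compl[OF closed_closure])
  then have "(\<phi> has_real_derivative 0) (at x)"
    using has_field_derivative_transform_within_open[OF DERIV_const[of 0] _ x, of \<phi>] z by metis
  then show "deriv \<phi> x = 0" by (rule DERIV_imp_deriv)
qed

lemma test_function_C1:
  assumes "\<phi> \<in> test_functions" shows "C1_supported \<phi> (deriv \<phi>)"
proof -
  have d: "((deriv ^^ k) \<phi>) differentiable (at x)" for k x using assms by (simp add: test_functions_def)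
  have "(\<phi> has_real_derivative deriv \<phi> x) (at x)" for x
    using d[of 0 x] by (simp add: DERIV_deriv_iff_real_differentiable)
  moreover have "continuous_on UNIV (deriv \<phi>)"
    using d[of 1] by (intro continuous_at_imp_continuous_on) (auto intro: differentiable_imp_continuous_within)
  ultimately show ?thesis using test_function_support[OF assms] by (simp add: C1_supported_def)
qed

lemma test_functions_comb:
  assumes "\<phi> \<in> test_functions" "\<psi> \<in> test_functions" shows "(\<lambda>x. \<phi> x + c * \<psi> x) \<in> test_functions"
proof -
  have d: "((deriv ^^ k) \<phi>) differentiable (at x)" "((deriv ^^ k) \<psi>) differentiable (at x)" for k x
    using assms by (auto simp: test_functions_def)
  have eq: "(deriv ^^ k) (\<lambda>x. \<phi> x + c * \<psi> x) = (\<lambda>x. (deriv ^^ k) \<phi> x + c * (deriv ^^ k) \<psi> x)" for k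
  proof (induction k)
    case (Suc k)
    show ?case
    proof
      fix x
      have "((\<lambda>x. (deriv ^^ k) \<phi> x + c * (deriv ^^ k) \<psi> x) has_real_derivative deriv ((deriv ^^ k) \<phi>) x + c * deriv ((deriv ^^ k) \<psi>) x) (at x)"
        using d[of k x] by (intro DERIV_add DERIV_cmult) (simp_all add: DERIV_deriv_iff_real_differentiable)
      from DERIV_imp_deriv[OF this]
      show "(deriv ^^ Suc k) (\<lambda>x. \<phi> x + c * \<psi> x) x = (deriv ^^ Suc k) \<phi> x + c * (deriv ^^ Suc k) \<psi> x"
        by (simp add: Suc.IH)
    qed
  qed simp
  let ?A = "closure {x. \<phi> x \<noteq> 0}" and ?B = "closure {x. \<psi> x \<noteq> 0}"
  have "{x. \<phi> x + c * \<psi> x \<noteq> 0} \<subseteq> {x. \<phi> x \<noteq> 0} \<union> {x. \<psi> x \<noteq> 0}" by auto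
  from closure_mono[OF this] have sub: "closure {x. \<phi> x + c * \<psi> x \<noteq> 0} \<subseteq> ?A \<union> ?B" by (simp add: closure_Un)
  have AB: "compact (?A \<union> ?B)" "?A \<union> ?B \<subseteq> {0<..<1}"
    using assms by (auto simp: test_functions_def intro: compact_Un)
  have "compact (closure {x. \<phi> x + c * \<psi> x \<noteq> 0})"
    using compact_Int_closed[OF AB(1) closed_closure, of "{x. \<phi> x + c * \<psi> x \<noteq> 0}"] sub by (simp add: Int_absorb1)
  then show ?thesis
    unfolding test_functions_def mem_Collect_eq eq using d sub AB(2) by (auto intro!: differentiable_add differentiable_mult)
qed

lemma C1_supported_comb:
  assumes "C1_supported \<phi> \<phi>'" "C1_supported \<psi> \<psi>'"
  shows "C1_supported (\<lambda>x. \<phi> x + c * \<psi> x) (\<lambda>x. \<phi>' x + c * \<psi>' x)"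
  using assms unfolding C1_supported_def by (auto intro!: DERIV_add DERIV_cmult continuous_intros)

lemma test_function_fourier:
  assumes "\<phi> \<in> test_functions"
  shows "\<phi> \<in> L2 lborel" "AE \<omega> in lborel. fourier \<phi> \<omega> = fint \<phi> \<omega>"
proof -
  note C = test_function_C1[OF assms]
  show "\<phi> \<in> L2 lborel" by (rule C1_supported_fun(4)[OF C C])
  then show "AE \<omega> in lborel. fourier \<phi> \<omega> = fint \<phi> \<omega>"
    by (intro fourier_eq_fint C1_supported_fun(3)[OF C C])
qed

lemma test_function_energy:
  assumes "\<phi> \<in> test_functions"
  shows "seminorm_energy \<sigma> (fourier \<phi>) = seminorm_energy \<sigma> (fint \<phi>)"
proof -
  note T = test_function_fourier[OF assms]
  have [measurable]: "fourier \<phi> \<in> borel_measurable borel" "\<phi> \<in> borel_measurable borel"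
    using fourier_measurable[OF T(1)] L2_measurable[OF T(1)] by auto
  show ?thesis unfolding seminorm_energy_def
    by (rule integral_cong_AE) (use T(2) in auto)
qed

lemma test_function_Hs:
  assumes \<phi>: "\<phi> \<in> test_functions" and \<sigma>: "0 \<le> \<sigma>" "\<sigma> \<le> 1"
  shows "\<phi> \<in> Hs \<sigma>"
proof -
  note T = test_function_fourier[OF \<phi>]
  have [measurable]: "fourier \<phi> \<in> borel_measurable borel" "\<phi> \<in> borel_measurable borel"
    using fourier_measurable[OF T(1)] L2_measurable[OF T(1)] by auto
  have "integrable lborel (\<lambda>\<omega>. (norm (hs_rep \<sigma> \<phi> \<omega>))\<^sup>2)"
  proof (rule Bochner_Integration.integrable_bound[OF C1_supported_fint[OF test_function_C1[OF \<phi>]]])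
    show "(\<lambda>\<omega>. (norm (hs_rep \<sigma> \<phi> \<omega>))\<^sup>2) \<in> borel_measurable lborel"
      using rep_measurable(1)[OF T(1), of \<sigma>] by measurable
    show "AE \<omega> in lborel. norm ((norm (hs_rep \<sigma> \<phi> \<omega>))\<^sup>2) \<le> norm ((1 + \<omega>\<^sup>2) * (norm (fint \<phi> \<omega>))\<^sup>2)"
      using T(2)
    proof eventually_elim
      fix \<omega> assume eq: "fourier \<phi> \<omega> = fint \<phi> \<omega>"
      have "(1 + \<bar>\<omega>\<bar>\<^sup>2) powr \<sigma> \<le> (1 + \<bar>\<omega>\<bar>\<^sup>2) powr 1" using \<sigma> by (intro powr_mono) auto
      then have "(1 + \<bar>\<omega>\<bar>\<^sup>2) powr \<sigma> \<le> 1 + \<omega>\<^sup>2" by simp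
      from mult_right_mono[OF this, of "(norm (fint \<phi> \<omega>))\<^sup>2"]
      show "norm ((norm (hs_rep \<sigma> \<phi> \<omega>))\<^sup>2) \<le> norm ((1 + \<omega>\<^sup>2) * (norm (fint \<phi> \<omega>))\<^sup>2)"
        unfolding norm_hs_rep eq by simp
    qed
  qed
  then have "hs_rep \<sigma> \<phi> \<in> L2 lborel"
    unfolding L2_def using rep_measurable(1)[OF T(1), of \<sigma>] by simp
  with T(1) show ?thesis unfolding Hs_iff by blast
qed

section \<open>The space of functions vanishing outside the unit interval\<close>

lemma Htilde_Hs: "u \<in> Htilde \<sigma> \<Longrightarrow> u \<in> Hs \<sigma>"
  by (simp add: Htilde_def)

lemma Htilde_L2: "u \<in> Htilde \<sigma> \<Longrightarrow> u \<in> L2 lborel"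
  by (intro Hs_L2 Htilde_Hs)

lemma Htilde_approx: "u \<in> Htilde \<sigma> \<Longrightarrow> 0 < e \<Longrightarrow> \<exists>\<phi>\<in>test_functions. Hs_norm \<sigma> (\<lambda>x. \<phi> x - u x) < e"
  by (simp add: Htilde_def)

text \<open>The condition that \<open>has_extension\<close> puts on an approximating
  sequence.\<close>

definition test_seq :: "real \<Rightarrow> (real \<Rightarrow> real) \<Rightarrow> (nat \<Rightarrow> real \<Rightarrow> real) \<Rightarrow> bool" where
  "test_seq \<sigma> u \<phi> \<longleftrightarrow> (\<forall>n. \<phi> n \<in> test_functions) \<and> (\<lambda>n. Hs_norm \<sigma> (\<lambda>x. \<phi> n x - u x)) \<longlonglongrightarrow> 0"

lemma test_seq_exists:
  assumes "u \<in> Htilde \<sigma>" obtains \<phi> where "test_seq \<sigma> u \<phi>"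
proof -
  have "\<forall>n. \<exists>\<phi>\<in>test_functions. Hs_norm \<sigma> (\<lambda>x. \<phi> x - u x) < 1 / real (Suc n)"
    using Htilde_approx[OF assms] by simp
  then obtain \<phi> where \<phi>: "\<And>n. \<phi> n \<in> test_functions" "\<And>n. Hs_norm \<sigma> (\<lambda>x. \<phi> n x - u x) < 1 / real (Suc n)" by metis
  have "(\<lambda>n. Hs_norm \<sigma> (\<lambda>x. \<phi> n x - u x)) \<longlonglongrightarrow> 0"
    by (rule tendsto_sandwich[OF _ _ tendsto_const LIMSEQ_inverse_real_of_nat[unfolded inverse_eq_divide]];
        rule always_eventually, rule allI, rule Hs_norm_nonneg less_imp_le[OF \<phi>(2)])
  with \<phi>(1) that show ?thesis by (auto simp: test_seq_def)
qed

lemma Htilde_comb: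
  assumes \<sigma>: "0 \<le> \<sigma>" "\<sigma> \<le> 1" and u: "u \<in> Htilde \<sigma>" and v: "v \<in> Htilde \<sigma>"
  shows "(\<lambda>x. u x + c * v x) \<in> Htilde \<sigma>"
    and "test_seq \<sigma> u \<phi> \<Longrightarrow> test_seq \<sigma> v \<psi> \<Longrightarrow> test_seq \<sigma> (\<lambda>x. u x + c * v x) (\<lambda>n x. \<phi> n x + c * \<psi> n x)"
proof -
  note uv = Htilde_Hs[OF u] Htilde_Hs[OF v]
  show *: "test_seq \<sigma> (\<lambda>x. u x + c * v x) (\<lambda>n x. \<phi> n x + c * \<psi> n x)" if s: "test_seq \<sigma> u \<phi>" "test_seq \<sigma> v \<psi>" for \<phi> \<psi>
  proof -
    have t: "\<phi> n \<in> test_functions" "\<psi> n \<in> test_functions" for n using s by (auto simp: test_seq_def)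
    note H = test_function_Hs[OF t(1) \<sigma>] test_function_Hs[OF t(2) \<sigma>]
    have le: "Hs_norm \<sigma> (\<lambda>x. (\<phi> n x + c * \<psi> n x) - (u x + c * v x)) \<le> Hs_norm \<sigma> (\<lambda>x. \<phi> n x - u x) + \<bar>c\<bar> * Hs_norm \<sigma> (\<lambda>x. \<psi> n x - v x)" for n
    proof -
      note d = Hs_diff[OF H(1)[of n] uv(1)] Hs_diff[OF H(2)[of n] uv(2)]
      have "Hs_norm \<sigma> (\<lambda>x. (\<phi> n x + c * \<psi> n x) - (u x + c * v x)) = Hs_norm \<sigma> (\<lambda>x. (\<phi> n x - u x) + c * (\<psi> n x - v x))"
        by (rule arg_cong[where f = "Hs_norm \<sigma>"]) (auto simp: algebra_simps)
      also have "\<dots> \<le> L2_norm lborel (hs_rep \<sigma> (\<lambda>x. \<phi> n x - u x)) + L2_norm lborel (\<lambda>\<omega>. c *\<^sub>R hs_rep \<sigma> (\<lambda>x. \<psi> n x - v x) \<omega>)"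
        unfolding Hs_norm_comb[OF d] by (intro L2_norm_triangle L2_scale Hs_rep_L2 d)
      finally show ?thesis by (simp add: L2_norm_scale Hs_norm_eq)
    qed
    have "(\<lambda>n. Hs_norm \<sigma> (\<lambda>x. \<phi> n x - u x) + \<bar>c\<bar> * Hs_norm \<sigma> (\<lambda>x. \<psi> n x - v x)) \<longlonglongrightarrow> 0 + \<bar>c\<bar> * 0"
      using s by (intro tendsto_add tendsto_mult tendsto_const) (auto simp: test_seq_def)
    then have lim: "(\<lambda>n. Hs_norm \<sigma> (\<lambda>x. \<phi> n x - u x) + \<bar>c\<bar> * Hs_norm \<sigma> (\<lambda>x. \<psi> n x - v x)) \<longlonglongrightarrow> 0" by simp
    have "(\<lambda>n. Hs_norm \<sigma> (\<lambda>x. (\<phi> n x + c * \<psi> n x) - (u x + c * v x))) \<longlonglongrightarrow> 0"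
      by (rule tendsto_sandwich[OF _ _ tendsto_const lim]) (use le in auto)
    then show ?thesis using test_functions_comb[OF t] by (simp add: test_seq_def)
  qed
  obtain \<phi> where \<phi>: "test_seq \<sigma> u \<phi>" using test_seq_exists[OF u] .
  obtain \<psi> where \<psi>: "test_seq \<sigma> v \<psi>" using test_seq_exists[OF v] .
  have "\<exists>\<phi>\<in>test_functions. Hs_norm \<sigma> (\<lambda>x. \<phi> x - (u x + c * v x)) < e" if e: "0 < e" for e
  proof -
    have "\<forall>\<^sub>F n in sequentially. Hs_norm \<sigma> (\<lambda>x. (\<phi> n x + c * \<psi> n x) - (u x + c * v x)) < e"
      using *[OF \<phi> \<psi>] e by (intro order_tendstoD) (auto simp: test_seq_def)
    then obtain n where "Hs_norm \<sigma> (\<lambda>x. (\<phi> n x + c * \<psi> n x) - (u x + c * v x)) < e"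
      by (auto simp: eventually_sequentially)
    moreover have "(\<lambda>x. \<phi> n x + c * \<psi> n x) \<in> test_functions" using *[OF \<phi> \<psi>] by (simp add: test_seq_def)
    ultimately show ?thesis by (rule rev_bexI[rotated])
  qed
  then show "(\<lambda>x. u x + c * v x) \<in> Htilde \<sigma>" using Hs_comb[OF uv] by (simp add: Htilde_def)
qed

lemma Htilde_nonempty: "0 \<le> \<sigma> \<Longrightarrow> \<sigma> \<le> 1 \<Longrightarrow> Htilde \<sigma> \<noteq> {}"
proof -
  assume \<sigma>: "0 \<le> \<sigma>" "\<sigma> \<le> 1"
  have "(deriv ^^ k) (\<lambda>x::real. 0 :: real) = (\<lambda>x. 0)" for k by (induction k) auto
  then have t: "(\<lambda>x. 0) \<in> test_functions" by (simp add: test_functions_def)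
  have "Hs_norm \<sigma> (\<lambda>x. (\<lambda>x. 0) x - (\<lambda>x. 0) x) = 0"
    unfolding Hs_norm_diff[OF test_function_Hs[OF t \<sigma>] test_function_Hs[OF t \<sigma>]] by (simp add: L2_norm_def)
  then have "(\<lambda>x. 0) \<in> Htilde \<sigma>"
    using t test_function_Hs[OF t \<sigma>] by (auto simp: Htilde_def intro!: bexI[of _ "\<lambda>x. 0"])
  then show ?thesis by blast
qed

text \<open>Test functions vanish outside the interval, so the part of \<open>u\<close> living there
  is no larger in L2 than \<open>\<phi> x - u x\<close>, whose norm can be made arbitrarily
  small.\<close>

lemma Htilde_support:
  assumes \<sigma>: "0 \<le> \<sigma>" "\<sigma> \<le> 1" and u: "u \<in> Htilde \<sigma>"
  shows "AE x in lborel. x \<notin> {0<..<1} \<longrightarrow> u x = 0"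
proof -
  let ?i = "indicat_real (- {0<..<1})"
  have iu: "(\<lambda>x. ?i x * u x) \<in> L2 lborel" by (intro L2_mult_indicator Htilde_L2[OF u]) simp
  have "L2_norm lborel (\<lambda>x. ?i x * u x) \<le> e" if e: "0 < e" for e
  proof -
    obtain \<phi> where \<phi>: "\<phi> \<in> test_functions" "Hs_norm \<sigma> (\<lambda>x. \<phi> x - u x) < e" using Htilde_approx[OF u e] by blast
    have d: "(\<lambda>x. \<phi> x - u x) \<in> Hs \<sigma>" by (rule Hs_diff[OF test_function_Hs[OF \<phi>(1) \<sigma>] Htilde_Hs[OF u]])
    have "L2_norm lborel (\<lambda>x. ?i x * u x) \<le> L2_norm lborel (\<lambda>x. \<phi> x - u x)"
      by (rule L2_norm_mono[OF iu Hs_L2[OF d]])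
         (use test_function_support(1)[OF \<phi>(1)] in \<open>auto simp: indicator_def\<close>)
    then show ?thesis using L2_norm_le_Hs_norm[OF \<sigma>(1) d] \<phi>(2) by simp
  qed
  then have "L2_norm lborel (\<lambda>x. ?i x * u x) \<le> 0" by (rule field_le_epsilon[of _ 0, simplified])
  then have "L2_norm lborel (\<lambda>x. ?i x * u x) = 0" by (intro order_antisym) simp_all
  from L2_norm_zero_AE[OF iu this] show ?thesis by eventually_elim (auto simp: indicator_def)
qed

text \<open>Completeness of L2 produces two limits, \<open>z\<close> of the functions and
  \<open>G\<close> of the weighted transforms. They belong together because
  \<open>fourier (u n)\<close> tends both to \<open>fourier z\<close>, by Plancherel's theorem, and
  to \<open>G\<close> divided by the weight, which is at least 1. Approximability by test functions
  passes to \<open>z\<close> by the triangle inequality.\<close>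

lemma Htilde_complete:
  assumes \<sigma>: "0 \<le> \<sigma>" "\<sigma> \<le> 1" and u: "\<And>n::nat. u n \<in> Htilde \<sigma>"
    and C: "\<And>e. 0 < e \<Longrightarrow> \<exists>N. \<forall>m\<ge>N. \<forall>n\<ge>N. Hs_norm \<sigma> (\<lambda>x. u m x - u n x) < e"
  shows "\<exists>z\<in>Htilde \<sigma>. (\<lambda>n. Hs_norm \<sigma> (\<lambda>x. u n x - z x)) \<longlonglongrightarrow> 0"
proof -
  note H = Htilde_Hs[OF u] and L = Htilde_L2[OF u]
  have "\<exists>N. \<forall>m\<ge>N. \<forall>n\<ge>N. L2_norm lborel (\<lambda>\<omega>. hs_rep \<sigma> (u m) \<omega> - hs_rep \<sigma> (u n) \<omega>) < e" if "0 < e" for e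
    using C[OF that] unfolding Hs_norm_diff[OF H H] .
  then obtain G where G: "G \<in> L2 lborel" "L2_tendsto lborel (\<lambda>n. hs_rep \<sigma> (u n)) G"
    by (rule L2_complete[OF Hs_rep_L2[OF H]])
  have "\<exists>N. \<forall>m\<ge>N. \<forall>n\<ge>N. L2_norm lborel (\<lambda>x. u m x - u n x) < e" if "0 < e" for e
  proof -
    obtain N where N: "\<And>m n. m \<ge> N \<Longrightarrow> n \<ge> N \<Longrightarrow> Hs_norm \<sigma> (\<lambda>x. u m x - u n x) < e"
      using C[OF \<open>0 < e\<close>] by auto
    have "L2_norm lborel (\<lambda>x. u m x - u n x) < e" if "m \<ge> N" "n \<ge> N" for m n
      using L2_norm_le_Hs_norm[OF \<sigma>(1) Hs_diff[OF H[of m] H[of n]]] N[OF that] by simp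
    then show ?thesis by blast
  qed
  then obtain z where z: "z \<in> L2 lborel" "L2_tendsto lborel u z"
    by (rule L2_complete[OF L])
  have [measurable]: "G \<in> borel_measurable borel" using L2_measurable[OF G(1)] by simp
  define w where "w \<omega> = (1 + \<bar>\<omega>\<bar>\<^sup>2) powr (\<sigma> / 2)" for \<omega> :: real
  have w1: "1 \<le> w \<omega>" for \<omega> unfolding w_def using \<sigma> by (intro ge_one_powr_ge_zero) auto
  have w0: "0 < w \<omega>" "w \<omega> \<noteq> 0" for \<omega> using w1[of \<omega>] by auto
  have hw: "hs_rep \<sigma> v \<omega> = w \<omega> *\<^sub>R fourier v \<omega>" for v \<omega> by (simp add: hs_rep_def w_def)
  have [measurable]: "w \<in> borel_measurable borel" unfolding w_def by measurable
  let ?F = "\<lambda>\<omega>. (1 / w \<omega>) *\<^sub>R G \<omega>"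
  have le: "norm (fourier (u n) \<omega> - ?F \<omega>) \<le> 1 * norm (hs_rep \<sigma> (u n) \<omega> - G \<omega>)" for n \<omega>
  proof -
    have "fourier (u n) \<omega> - ?F \<omega> = (1 / w \<omega>) *\<^sub>R (hs_rep \<sigma> (u n) \<omega> - G \<omega>)"
      using w0[of \<omega>] by (simp add: hw scaleR_diff_right)
    then have "norm (fourier (u n) \<omega> - ?F \<omega>) = (1 / w \<omega>) * norm (hs_rep \<sigma> (u n) \<omega> - G \<omega>)" using w0(1)[of \<omega>] by simp
    also have "\<dots> \<le> 1 * norm (hs_rep \<sigma> (u n) \<omega> - G \<omega>)"
      using w1[of \<omega>] w0(1)[of \<omega>] by (intro mult_right_mono) (auto simp: divide_le_eq_1)
    finally show ?thesis .
  qed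
  have FL: "(\<lambda>\<omega>. fourier (u n) \<omega> - ?F \<omega>) \<in> L2 lborel" for n
  proof (rule L2_bound[OF L2_diff[OF Hs_rep_L2[OF H] G(1)], where c = 1])
    have [measurable]: "fourier (u n) \<in> borel_measurable borel" by (rule fourier_measurable[OF L])
    show "(\<lambda>\<omega>. fourier (u n) \<omega> - ?F \<omega>) \<in> borel_measurable lborel" by measurable
    show "AE \<omega> in lborel. norm (fourier (u n) \<omega> - ?F \<omega>) \<le> 1 * norm (hs_rep \<sigma> (u n) \<omega> - G \<omega>)"
      using le by simp
  qed
  have lim0: "(\<lambda>n. L2_norm lborel (\<lambda>\<omega>. hs_rep \<sigma> (u n) \<omega> - G \<omega>)) \<longlonglongrightarrow> 0"
    using G(2) by (simp add: L2_tendsto_def)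
  have le0: "L2_norm lborel (\<lambda>\<omega>. fourier (u n) \<omega> - ?F \<omega>) \<le> L2_norm lborel (\<lambda>\<omega>. hs_rep \<sigma> (u n) \<omega> - G \<omega>)" for n
    by (rule L2_norm_mono[OF FL L2_diff[OF Hs_rep_L2[OF H] G(1)]]) (use le in simp)
  have "(\<lambda>n. L2_norm lborel (\<lambda>\<omega>. fourier (u n) \<omega> - ?F \<omega>)) \<longlonglongrightarrow> 0"
    by (rule tendsto_sandwich[OF _ _ tendsto_const lim0]; rule always_eventually, rule allI, rule L2_norm_nonneg le0)
  with FL have t1: "L2_tendsto lborel (\<lambda>n. fourier (u n)) ?F" by (simp add: L2_tendsto_def)
  have eq: "L2_norm lborel (\<lambda>\<omega>. fourier (u n) \<omega> - fourier z \<omega>) = L2_norm lborel (\<lambda>x. u n x - z x)" for n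
  proof -
    have "L2_norm lborel (\<lambda>\<omega>. fourier (u n) \<omega> - fourier z \<omega>) = L2_norm lborel (fourier (\<lambda>x. u n x - z x))"
      using fourier_comb[OF L[of n] z(1), of "-1"] fourier_measurable[OF L[of n]] fourier_measurable[OF z(1)]
        fourier_measurable[OF L2_diff[OF L[of n] z(1)]]
      by (intro L2_norm_cong_AE) auto
    also have "\<dots> = L2_norm lborel (\<lambda>x. u n x - z x)" by (rule Plancherel[OF L2_diff[OF L z(1)]])
    finally show ?thesis .
  qed
  have t2: "L2_tendsto lborel (\<lambda>n. fourier (u n)) (fourier z)"
    using z(2) L2_diff[OF fourier_L2[OF L] fourier_L2[OF z(1)]] by (simp add: L2_tendsto_def eq)
  have rep: "AE \<omega> in lborel. G \<omega> = hs_rep \<sigma> z \<omega>"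
    using L2_tendsto_unique[OF t2 t1]
  proof eventually_elim
    fix \<omega> assume "fourier z \<omega> = ?F \<omega>"
    then show "G \<omega> = hs_rep \<sigma> z \<omega>" using w0[of \<omega>] by (simp add: hw)
  qed
  have zH: "z \<in> Hs \<sigma>"
    using z(1) L2_cong_AE[OF G(1) _ rep] rep_measurable(1)[OF z(1)] by (simp add: Hs_iff)
  have "L2_norm lborel (\<lambda>\<omega>. hs_rep \<sigma> (u n) \<omega> - G \<omega>) = Hs_norm \<sigma> (\<lambda>x. u n x - z x)" for n
    unfolding Hs_norm_diff[OF H zH]
    by (rule L2_norm_cong_AE[OF L2_measurable[OF L2_diff[OF Hs_rep_L2[OF H] G(1)]]
        L2_measurable[OF L2_diff[OF Hs_rep_L2[OF H] Hs_rep_L2[OF zH]]]]) (use rep in auto)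
  then have lim: "(\<lambda>n. Hs_norm \<sigma> (\<lambda>x. u n x - z x)) \<longlonglongrightarrow> 0" using G(2) by (simp add: L2_tendsto_def)
  have "\<exists>\<phi>\<in>test_functions. Hs_norm \<sigma> (\<lambda>x. \<phi> x - z x) < e" if e: "0 < e" for e
  proof -
    have "\<forall>\<^sub>F n in sequentially. Hs_norm \<sigma> (\<lambda>x. u n x - z x) < e / 2"
      using lim e by (intro order_tendstoD) auto
    then obtain n where n: "Hs_norm \<sigma> (\<lambda>x. u n x - z x) < e / 2" by (auto simp: eventually_sequentially)
    obtain \<phi> where \<phi>: "\<phi> \<in> test_functions" "Hs_norm \<sigma> (\<lambda>x. \<phi> x - u n x) < e / 2"
      using Htilde_approx[OF u[of n], of "e/2"] e by auto
    have "Hs_norm \<sigma> (\<lambda>x. \<phi> x - z x) < e"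
      using Hs_norm_triangle[OF test_function_Hs[OF \<phi>(1) \<sigma>] H[of n] zH] n \<phi>(2) by simp
    with \<phi>(1) show ?thesis by blast
  qed
  then have "z \<in> Htilde \<sigma>" using zH by (simp add: Htilde_def)
  with lim show ?thesis by blast
qed

section \<open>Extension of the fractional derivatives\<close>

text \<open>The Lipschitz bound makes the images of one approximating sequence Cauchy. It then
  compares any other sequence with this one, since \<open>has_extension\<close> demands the same
  limit along all of them.\<close>

lemma has_extension_exists:
  assumes \<sigma>: "0 \<le> \<sigma>" "\<sigma> \<le> 1" and u: "u \<in> Htilde \<sigma>"
    and D: "\<And>\<phi>. \<phi> \<in> test_functions \<Longrightarrow> D \<phi> \<in> L2 Om"
    and Lip: "\<And>\<phi> \<psi>. \<phi> \<in> test_functions \<Longrightarrow> \<psi> \<in> test_functions \<Longrightarrow>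
      L2_norm Om (\<lambda>x. D \<phi> x - D \<psi> x) \<le> Hs_norm \<sigma> (\<lambda>x. \<phi> x - \<psi> x)"
  shows "\<exists>g. has_extension D \<sigma> u g"
proof -
  obtain \<phi> where s: "test_seq \<sigma> u \<phi>" using test_seq_exists[OF u] .
  then have t: "\<phi> n \<in> test_functions" for n by (simp add: test_seq_def)
  have lim: "(\<lambda>n. Hs_norm \<sigma> (\<lambda>x. \<phi> n x - u x)) \<longlonglongrightarrow> 0" using s by (simp add: test_seq_def)
  have tri: "Hs_norm \<sigma> (\<lambda>x. a x - b x) \<le> Hs_norm \<sigma> (\<lambda>x. a x - u x) + Hs_norm \<sigma> (\<lambda>x. b x - u x)"
    if "a \<in> test_functions" "b \<in> test_functions" for a b
    using Hs_norm_triangle[OF test_function_Hs[OF that(1) \<sigma>] Htilde_Hs[OF u] test_function_Hs[OF that(2) \<sigma>]]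
      Hs_norm_commute[OF Htilde_Hs[OF u] test_function_Hs[OF that(2) \<sigma>]] by simp
  have "\<exists>N. \<forall>m\<ge>N. \<forall>n\<ge>N. L2_norm Om (\<lambda>x. D (\<phi> m) x - D (\<phi> n) x) < e" if e: "0 < e" for e
  proof -
    have "\<forall>\<^sub>F n in sequentially. Hs_norm \<sigma> (\<lambda>x. \<phi> n x - u x) < e / 2"
      using lim e by (intro order_tendstoD) auto
    then obtain N where N: "\<And>n. n \<ge> N \<Longrightarrow> Hs_norm \<sigma> (\<lambda>x. \<phi> n x - u x) < e / 2" by (auto simp: eventually_sequentially)
    have "L2_norm Om (\<lambda>x. D (\<phi> m) x - D (\<phi> n) x) < e" if "m \<ge> N" "n \<ge> N" for m n
      using Lip[OF t[of m] t[of n]] tri[OF t[of m] t[of n]] N[OF that(1)] N[OF that(2)] by simp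
    then show ?thesis by blast
  qed
  then obtain g where g: "g \<in> L2 Om" "L2_tendsto Om (\<lambda>n. D (\<phi> n)) g"
    by (rule L2_complete[OF D[OF t]])
  have "L2_tendsto Om (\<lambda>n. D (\<psi> n)) g"
    if \<psi>: "\<And>n. \<psi> n \<in> test_functions" "(\<lambda>n. Hs_norm \<sigma> (\<lambda>x. \<psi> n x - u x)) \<longlonglongrightarrow> 0" for \<psi>
  proof -
    let ?b = "\<lambda>n. (Hs_norm \<sigma> (\<lambda>x. \<psi> n x - u x) + Hs_norm \<sigma> (\<lambda>x. \<phi> n x - u x)) + L2_norm Om (\<lambda>x. D (\<phi> n) x - g x)"
    have "?b \<longlonglongrightarrow> (0 + 0) + 0"
      using g(2) by (intro tendsto_add \<psi>(2) lim) (simp add: L2_tendsto_def)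
    then have b: "?b \<longlonglongrightarrow> 0" by simp
    have "L2_norm Om (\<lambda>x. D (\<psi> n) x - g x) \<le> ?b n" for n
      using L2_norm_diff_triangle[OF D[OF \<psi>(1)[of n]] D[OF t[of n]] g(1)] Lip[OF \<psi>(1)[of n] t[of n]] tri[OF \<psi>(1)[of n] t[of n]] by simp
    then have "(\<lambda>n. L2_norm Om (\<lambda>x. D (\<psi> n) x - g x)) \<longlonglongrightarrow> 0"
      by (intro tendsto_sandwich[OF _ _ tendsto_const b]) auto
    then show ?thesis using L2_diff[OF D[OF \<psi>(1)] g(1)] by (simp add: L2_tendsto_def)
  qed
  with g(1) show ?thesis unfolding has_extension_def by blast
qed

text \<open>Linearity of \<open>D\<close> is asked only at points of the interval, where the
  Riemann-Liouville derivatives are known as convolutions; limits in L2 of the interval do not see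
  other points.\<close>

lemma has_extension_comb:
  assumes \<sigma>: "0 \<le> \<sigma>" "\<sigma> \<le> 1" and u: "u \<in> Htilde \<sigma>" and v: "v \<in> Htilde \<sigma>"
    and D: "\<And>\<phi> \<psi> c x. \<phi> \<in> test_functions \<Longrightarrow> \<psi> \<in> test_functions \<Longrightarrow> x \<in> {0<..<1} \<Longrightarrow>
      D (\<lambda>x. \<phi> x + c * \<psi> x) x = D \<phi> x + c * D \<psi> x"
    and g: "has_extension D \<sigma> u g" and h: "has_extension D \<sigma> v h" and k: "has_extension D \<sigma> (\<lambda>x. u x + c * v x) k"
  shows "AE x in Om. k x = g x + c * h x"
proof -
  obtain \<phi> where \<phi>: "test_seq \<sigma> u \<phi>" using test_seq_exists[OF u] .
  obtain \<psi> where \<psi>: "test_seq \<sigma> v \<psi>" using test_seq_exists[OF v] .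
  have t: "\<phi> n \<in> test_functions" "\<psi> n \<in> test_functions" for n using \<phi> \<psi> by (auto simp: test_seq_def)
  have 1: "L2_tendsto Om (\<lambda>n. D (\<lambda>x. \<phi> n x + c * \<psi> n x)) k"
    using k Htilde_comb(2)[OF \<sigma> u v \<phi> \<psi>, of c] by (simp add: has_extension_def test_seq_def)
  have 2: "L2_tendsto Om (\<lambda>n x. D (\<phi> n) x + c * D (\<psi> n) x) (\<lambda>x. g x + c * h x)"
    using L2_tendsto_comb[of Om "\<lambda>n. D (\<phi> n)" g "\<lambda>n. D (\<psi> n)" h c] g h \<phi> \<psi>
    by (simp add: has_extension_def test_seq_def)
  let ?p = "\<lambda>n x. D (\<lambda>x. \<phi> n x + c * \<psi> n x) x - (g x + c * h x)"
  let ?q = "\<lambda>n x. D (\<phi> n) x + c * D (\<psi> n) x - (g x + c * h x)"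
  have eq: "?p n x = ?q n x" if "x \<in> space Om" for n x
    using D[OF t] that by simp
  have "L2_norm Om (?p n) = L2_norm Om (?q n)" for n by (rule L2_cong(1)[OF eq])
  moreover have "?p n \<in> L2 Om \<longleftrightarrow> ?q n \<in> L2 Om" for n by (rule L2_cong(2)[OF eq])
  ultimately have "L2_tendsto Om (\<lambda>n. D (\<lambda>x. \<phi> n x + c * \<psi> n x)) (\<lambda>x. g x + c * h x)"
    using 2 by (simp add: L2_tendsto_def)
  with 1 show ?thesis by (rule L2_tendsto_unique)
qed

context
  fixes \<sigma> :: real
  assumes \<sigma>: "0 < \<sigma>" "\<sigma> < 1"
begin

lemma \<sigma>_le: "0 \<le> \<sigma>" "\<sigma> \<le> 1"
  using \<sigma> by auto

lemma conv_comb: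
  assumes "integrable lborel (\<lambda>y. k y * g (x - y))" "integrable lborel (\<lambda>y. k y * h (x - y))"
  shows "conv k (\<lambda>x. g x + c * h x) x = conv k g x + c * conv k h x"
proof -
  have "conv k (\<lambda>x. g x + c * h x) x = (\<integral>y. k y * g (x - y) + c * (k y * h (x - y)) \<partial>lborel)"
    unfolding conv_def by (rule Bochner_Integration.integral_cong) (auto simp: algebra_simps)
  also have "\<dots> = conv k g x + c * conv k h x" using assms by (simp add: conv_def)
  finally show ?thesis .
qed

lemma kernel_conv_integrable:
  assumes \<phi>: "C1_supported \<phi> \<psi>" and x: "x \<in> {0<..<1}"
  shows "integrable lborel (\<lambda>y. frac_kernel \<sigma> 0 y * \<psi> (x - y))"
    and "integrable lborel (\<lambda>y. frac_kernel \<sigma> 0 (- y) * \<psi> (x - y))"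
proof -
  obtain M where M: "\<And>x. \<bar>\<psi> x\<bar> \<le> M" using C1_supported_derivative(1)[OF \<phi> \<phi>] by blast
  note m = C1_supported_derivative(2)[OF \<phi> \<phi>]
  let ?w = "\<lambda>z. exp 2 * frac_kernel \<sigma> 1 z"
  have w: "integrable lborel ?w" "integrable lborel (\<lambda>z. ?w (- z))"
    using frac_kernel_integrable[OF \<sigma>(2), of 1] lborel_integrable_reflect[OF frac_kernel_integrable[OF \<sigma>(2), of 1], of 0] by simp_all
  have x': "x \<in> {-1<..<2}" using x by auto
  show "integrable lborel (\<lambda>y. frac_kernel \<sigma> 0 y * \<psi> (x - y))"
    by (rule conv_local_integrable[OF M C1_supported_props(5)[OF \<phi>] m w(1), where k = "\<lambda>_. frac_kernel \<sigma> 0"])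
       (use x' frac_kernel_local_bound[OF \<sigma>(2), of 0] frac_kernel_nonneg[OF \<sigma>(2)] in auto)
  show "integrable lborel (\<lambda>y. frac_kernel \<sigma> 0 (- y) * \<psi> (x - y))"
    by (rule conv_local_integrable[OF M C1_supported_props(5)[OF \<phi>] m w(2), where k = "\<lambda>_ y. frac_kernel \<sigma> 0 (- y)"])
       (use x' frac_kernel_local_bound[OF \<sigma>(2), of 0] frac_kernel_nonneg[OF \<sigma>(2)] in auto)
qed

lemma RL_comb:
  assumes \<phi>: "\<phi> \<in> test_functions" and \<psi>: "\<psi> \<in> test_functions" and x: "x \<in> {0<..<1}"
  shows "RL_left \<sigma> (\<lambda>x. \<phi> x + c * \<psi> x) x = RL_left \<sigma> \<phi> x + c * RL_left \<sigma> \<psi> x"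
    and "RL_right \<sigma> (\<lambda>x. \<phi> x + c * \<psi> x) x = RL_right \<sigma> \<phi> x + c * RL_right \<sigma> \<psi> x"
proof -
  note C = test_function_C1[OF \<phi>] test_function_C1[OF \<psi>]
  note CC = C1_supported_comb[OF C, of c]
  show "RL_left \<sigma> (\<lambda>x. \<phi> x + c * \<psi> x) x = RL_left \<sigma> \<phi> x + c * RL_left \<sigma> \<psi> x"
    unfolding RL_left_eq[OF CC \<sigma>(2) x] RL_left_eq[OF C(1) \<sigma>(2) x] RL_left_eq[OF C(2) \<sigma>(2) x]
    by (rule conv_comb[OF kernel_conv_integrable(1)[OF C(1) x] kernel_conv_integrable(1)[OF C(2) x]])
  show "RL_right \<sigma> (\<lambda>x. \<phi> x + c * \<psi> x) x = RL_right \<sigma> \<phi> x + c * RL_right \<sigma> \<psi> x"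
    unfolding RL_right_eq[OF CC \<sigma>(2) x] RL_right_eq[OF C(1) \<sigma>(2) x] RL_right_eq[OF C(2) \<sigma>(2) x]
      conv_comb[OF kernel_conv_integrable(2)[OF C(1) x] kernel_conv_integrable(2)[OF C(2) x]] by simp
qed

lemma RL_test:
  assumes "\<phi> \<in> test_functions"
  shows "RL_left \<sigma> \<phi> \<in> L2 Om" "RL_right \<sigma> \<phi> \<in> L2 Om"
    "L2_norm Om (RL_left \<sigma> \<phi>) \<le> L2_norm lborel (en_rep \<sigma> \<phi>)"
    "L2_norm Om (RL_right \<sigma> \<phi>) \<le> L2_norm lborel (en_rep \<sigma> \<phi>)"
    "L2_ip Om (RL_left \<sigma> \<phi>) (RL_right \<sigma> \<phi>) = cos (pi * \<sigma>) * (L2_norm lborel (en_rep \<sigma> \<phi>))\<^sup>2"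
proof -
  note C = test_function_C1[OF assms]
  note R = RL_smooth[OF \<sigma> C, folded test_function_energy[OF assms], unfolded energy_eq]
  show "RL_left \<sigma> \<phi> \<in> L2 Om" "RL_right \<sigma> \<phi> \<in> L2 Om"
    "L2_ip Om (RL_left \<sigma> \<phi>) (RL_right \<sigma> \<phi>) = cos (pi * \<sigma>) * (L2_norm lborel (en_rep \<sigma> \<phi>))\<^sup>2"
    using R by auto
  show "L2_norm Om (RL_left \<sigma> \<phi>) \<le> L2_norm lborel (en_rep \<sigma> \<phi>)" "L2_norm Om (RL_right \<sigma> \<phi>) \<le> L2_norm lborel (en_rep \<sigma> \<phi>)"
    using R by (auto intro: power2_le_imp_le)
qed

lemma RL_Lipschitz:
  assumes \<phi>: "\<phi> \<in> test_functions" and \<psi>: "\<psi> \<in> test_functions"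
  shows "L2_norm Om (\<lambda>x. RL_left \<sigma> \<phi> x - RL_left \<sigma> \<psi> x) \<le> Hs_norm \<sigma> (\<lambda>x. \<phi> x - \<psi> x)"
    and "L2_norm Om (\<lambda>x. RL_right \<sigma> \<phi> x - RL_right \<sigma> \<psi> x) \<le> Hs_norm \<sigma> (\<lambda>x. \<phi> x - \<psi> x)"
proof -
  have t: "(\<lambda>x. \<phi> x - \<psi> x) \<in> test_functions" using test_functions_comb[OF \<phi> \<psi>, of "-1"] by simp
  have le: "L2_norm lborel (en_rep \<sigma> (\<lambda>x. \<phi> x - \<psi> x)) \<le> Hs_norm \<sigma> (\<lambda>x. \<phi> x - \<psi> x)"
    by (rule en_rep_norm_le[OF \<sigma>_le(1) test_function_Hs[OF t \<sigma>_le]])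
  have "L2_norm Om (\<lambda>x. RL_left \<sigma> \<phi> x - RL_left \<sigma> \<psi> x) = L2_norm Om (RL_left \<sigma> (\<lambda>x. \<phi> x - \<psi> x))"
    unfolding L2_norm_def using RL_comb(1)[OF \<phi> \<psi>, of _ "-1"]
    by (intro arg_cong[where f = sqrt] Bochner_Integration.integral_cong) auto
  then show "L2_norm Om (\<lambda>x. RL_left \<sigma> \<phi> x - RL_left \<sigma> \<psi> x) \<le> Hs_norm \<sigma> (\<lambda>x. \<phi> x - \<psi> x)"
    using RL_test(3)[OF t] le by simp
  have "L2_norm Om (\<lambda>x. RL_right \<sigma> \<phi> x - RL_right \<sigma> \<psi> x) = L2_norm Om (RL_right \<sigma> (\<lambda>x. \<phi> x - \<psi> x))"
    unfolding L2_norm_def using RL_comb(2)[OF \<phi> \<psi>, of _ "-1"]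
    by (intro arg_cong[where f = sqrt] Bochner_Integration.integral_cong) auto
  then show "L2_norm Om (\<lambda>x. RL_right \<sigma> \<phi> x - RL_right \<sigma> \<psi> x) \<le> Hs_norm \<sigma> (\<lambda>x. \<phi> x - \<psi> x)"
    using RL_test(4)[OF t] le by simp
qed

text \<open>Justifies the choice by \<open>SOME\<close> in the definitions of \<open>D_left\<close>
  and \<open>D_right\<close>.\<close>

lemma D_extension:
  assumes "u \<in> Htilde \<sigma>"
  shows "has_extension (RL_left \<sigma>) \<sigma> u (D_left \<sigma> u)" "has_extension (RL_right \<sigma>) \<sigma> u (D_right \<sigma> u)"
proof -
  show "has_extension (RL_left \<sigma>) \<sigma> u (D_left \<sigma> u)"
    unfolding D_left_def
    using has_extension_exists[OF \<sigma>_le assms RL_test(1) RL_Lipschitz(1)]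
    by (rule someI_ex[of "has_extension (RL_left \<sigma>) \<sigma> u"])
  show "has_extension (RL_right \<sigma>) \<sigma> u (D_right \<sigma> u)"
    unfolding D_right_def
    using has_extension_exists[OF \<sigma>_le assms RL_test(2) RL_Lipschitz(2)]
    by (rule someI_ex[of "has_extension (RL_right \<sigma>) \<sigma> u"])
qed

lemma D_L2:
  assumes "u \<in> Htilde \<sigma>" shows "D_left \<sigma> u \<in> L2 Om" "D_right \<sigma> u \<in> L2 Om"
  using D_extension[OF assms] by (auto simp: has_extension_def)

lemma D_comb:
  assumes "u \<in> Htilde \<sigma>" "v \<in> Htilde \<sigma>"
  shows "AE x in Om. D_left \<sigma> (\<lambda>x. u x + c * v x) x = D_left \<sigma> u x + c * D_left \<sigma> v x"
    and "AE x in Om. D_right \<sigma> (\<lambda>x. u x + c * v x) x = D_right \<sigma> u x + c * D_right \<sigma> v x"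
proof -
  note E = D_extension[OF assms(1)] D_extension[OF assms(2)] D_extension[OF Htilde_comb(1)[OF \<sigma>_le assms, of c]]
  show "AE x in Om. D_left \<sigma> (\<lambda>x. u x + c * v x) x = D_left \<sigma> u x + c * D_left \<sigma> v x"
    by (rule has_extension_comb[OF \<sigma>_le assms RL_comb(1) E(1,3,5)])
  show "AE x in Om. D_right \<sigma> (\<lambda>x. u x + c * v x) x = D_right \<sigma> u x + c * D_right \<sigma> v x"
    by (rule has_extension_comb[OF \<sigma>_le assms RL_comb(2) E(2,4,6)])
qed

text \<open>The bounds involve the energy and not the full norm, so that the deviation of
  \<open>d\<close> from its mean can be set against the cosine term. They pass from test functions
  to \<open>u\<close> because \<open>en_rep\<close> is continuous in the Sobolev norm.\<close>

lemma D_bounds: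
  assumes u: "u \<in> Htilde \<sigma>"
  shows "L2_norm Om (D_left \<sigma> u) \<le> L2_norm lborel (en_rep \<sigma> u)"
    and "L2_norm Om (D_right \<sigma> u) \<le> L2_norm lborel (en_rep \<sigma> u)"
    and "L2_ip Om (D_left \<sigma> u) (D_right \<sigma> u) = cos (pi * \<sigma>) * (L2_norm lborel (en_rep \<sigma> u))\<^sup>2"
proof -
  obtain \<phi> where s: "test_seq \<sigma> u \<phi>" using test_seq_exists[OF u] .
  then have t: "\<phi> n \<in> test_functions" for n by (simp add: test_seq_def)
  note H = test_function_Hs[OF t \<sigma>_le]
  note eu = en_rep_L2[OF \<sigma>_le(1) Htilde_Hs[OF u]] and ep = en_rep_L2[OF \<sigma>_le(1) H]
  have l: "L2_tendsto Om (\<lambda>n. RL_left \<sigma> (\<phi> n)) (D_left \<sigma> u)" and r: "L2_tendsto Om (\<lambda>n. RL_right \<sigma> (\<phi> n)) (D_right \<sigma> u)"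
    using D_extension[OF u] s by (auto simp: has_extension_def test_seq_def)
  have lim: "(\<lambda>n. Hs_norm \<sigma> (\<lambda>x. \<phi> n x - u x)) \<longlonglongrightarrow> 0" using s by (simp add: test_seq_def)
  have "(\<lambda>n. L2_norm lborel (\<lambda>\<omega>. en_rep \<sigma> (\<phi> n) \<omega> - en_rep \<sigma> u \<omega>)) \<longlonglongrightarrow> 0"
    by (rule tendsto_sandwich[OF _ _ tendsto_const lim])
       (use en_rep_norm_diff[OF \<sigma>_le(1) H Htilde_Hs[OF u]] in auto)
  then have "L2_tendsto lborel (\<lambda>n. en_rep \<sigma> (\<phi> n)) (en_rep \<sigma> u)"
    using L2_diff[OF ep eu] by (simp add: L2_tendsto_def)
  from L2_tendsto_norm[OF this ep eu]
  have E: "(\<lambda>n. L2_norm lborel (en_rep \<sigma> (\<phi> n))) \<longlonglongrightarrow> L2_norm lborel (en_rep \<sigma> u)" .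
  note Dl = D_L2(1)[OF u] and Dr = D_L2(2)[OF u]
  note R = RL_test[OF t]
  show "L2_norm Om (D_left \<sigma> u) \<le> L2_norm lborel (en_rep \<sigma> u)"
    by (rule LIMSEQ_le[OF L2_tendsto_norm[OF l R(1) Dl] E]) (use R(3) in auto)
  show "L2_norm Om (D_right \<sigma> u) \<le> L2_norm lborel (en_rep \<sigma> u)"
    by (rule LIMSEQ_le[OF L2_tendsto_norm[OF r R(2) Dr] E]) (use R(4) in auto)
  have "(\<lambda>n. L2_ip Om (RL_left \<sigma> (\<phi> n)) (RL_right \<sigma> (\<phi> n))) \<longlonglongrightarrow> cos (pi * \<sigma>) * (L2_norm lborel (en_rep \<sigma> u))\<^sup>2"
    unfolding R(5) by (intro tendsto_mult tendsto_power E tendsto_const)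
  from LIMSEQ_unique[OF L2_tendsto_ip[OF l R(1) Dl r R(2) Dr] this]
  show "L2_ip Om (D_left \<sigma> u) (D_right \<sigma> u) = cos (pi * \<sigma>) * (L2_norm lborel (en_rep \<sigma> u))\<^sup>2" .
qed

lemma semi_hilbert_Htilde: "semi_hilbert (Htilde \<sigma>) (hs_ip \<sigma>)"
proof
  fix u :: "nat \<Rightarrow> real \<Rightarrow> real"
  assume u: "\<And>n. u n \<in> Htilde \<sigma>"
    and C: "\<And>e. 0 < e \<Longrightarrow> \<exists>N. \<forall>m\<ge>N. \<forall>n\<ge>N. hs_ip \<sigma> (\<lambda>x. u m x - u n x) (\<lambda>x. u m x - u n x) < e"
  have "\<exists>N. \<forall>m\<ge>N. \<forall>n\<ge>N. Hs_norm \<sigma> (\<lambda>x. u m x - u n x) < e" if e: "0 < e" for e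
  proof -
    have "0 < e\<^sup>2" using e by simp
    from C[OF this] show ?thesis
      unfolding hs_ip_self using power_less_imp_less_base[of _ 2 e] e by (meson less_imp_le)
  qed
  from Htilde_complete[OF \<sigma>_le u this] obtain z where z: "z \<in> Htilde \<sigma>" "(\<lambda>n. Hs_norm \<sigma> (\<lambda>x. u n x - z x)) \<longlonglongrightarrow> 0"
    by blast
  from tendsto_power[OF z(2), of 2] z(1)
  show "\<exists>z\<in>Htilde \<sigma>. (\<lambda>n. hs_ip \<sigma> (\<lambda>x. u n x - z x) (\<lambda>x. u n x - z x)) \<longlonglongrightarrow> 0"
    unfolding hs_ip_self by auto
next
  show "hs_ip \<sigma> u v = hs_ip \<sigma> v u" for u v by (simp add: hs_ip_def L2_ip_commute)
  show "0 \<le> hs_ip \<sigma> u u" for u by (simp add: hs_ip_self)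
qed (use Htilde_nonempty[OF \<sigma>_le] Htilde_comb(1)[OF \<sigma>_le] hs_ip_comb Htilde_Hs in auto)

end

section \<open>The variational problem\<close>

lemma Om_not_null: "emeasure Om (space Om) \<noteq> 0"
  by (simp add: emeasure_restrict_space)

text \<open>\<open>real_of_ereal\<close> sends both infinities to 0, so both are excluded: the upper
  one by the bound \<open>C\<close>, the lower one because the interval is not a null set.\<close>

lemma ess_sup_finite:
  assumes "f \<in> L_infty Om" shows "ereal (ess_sup Om f) = esssup Om (\<lambda>x. ereal (f x))"
proof -
  have [measurable]: "f \<in> borel_measurable Om" using assms by (simp add: L_infty_def)
  obtain C where C: "AE x in Om. \<bar>f x\<bar> \<le> C" using assms by (auto simp: L_infty_def)
  have "esssup Om (\<lambda>x. ereal (f x)) \<le> ereal C"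
    by (rule esssup_I) (use C in auto)
  then have "esssup Om (\<lambda>x. ereal (f x)) \<noteq> \<infinity>" by auto
  moreover have "esssup Om (\<lambda>x. ereal (f x)) \<noteq> - \<infinity>"
  proof
    assume "esssup Om (\<lambda>x. ereal (f x)) = - \<infinity>"
    then have "AE x in Om. False" using esssup_AE[of "\<lambda>x. ereal (f x)" Om] by auto
    then have "ae_filter Om = bot" by (simp add: trivial_limit_def)
    then show False using Om_not_null ae_filter_eq_bot_iff[of Om] by simp
  qed
  ultimately show ?thesis by (cases "esssup Om (\<lambda>x. ereal (f x))") (simp_all add: ess_sup_def)
qed

lemma AE_le_ess_sup: "f \<in> L_infty Om \<Longrightarrow> AE x in Om. f x \<le> ess_sup Om f"
  using esssup_AE[of "\<lambda>x. ereal (f x)" Om] by (simp add: ess_sup_finite[symmetric])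

lemma L_infty_uminus: "f \<in> L_infty M \<Longrightarrow> (\<lambda>x. - f x) \<in> L_infty M"
  by (auto simp: L_infty_def)

lemma ess_inf_eq:
  assumes "f \<in> L_infty Om" shows "ess_inf Om f = - ess_sup Om (\<lambda>x. - f x)"
proof -
  have [measurable]: "f \<in> borel_measurable Om" using assms by (simp add: L_infty_def)
  have "esssup Om (\<lambda>x. ereal (- f x)) = Limsup (ae_filter Om) (\<lambda>x. - ereal (f x))"
    by (simp add: esssup_def)
  also have "\<dots> = - Liminf (ae_filter Om) (\<lambda>x. ereal (f x))" by (rule ereal_Limsup_uminus)
  finally show ?thesis by (simp add: ess_inf_def ess_sup_def)
qed

lemma AE_ess_inf_le: "f \<in> L_infty Om \<Longrightarrow> AE x in Om. ess_inf Om f \<le> f x"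
  using AE_le_ess_sup[OF L_infty_uminus, of f] ess_inf_eq[of f]
  by (auto elim!: eventually_mono)

lemma L_infty_mult_L2:
  assumes d: "d \<in> borel_measurable M" "AE x in M. \<bar>d x\<bar> \<le> C" and g: "g \<in> L2 M"
  shows "(\<lambda>x. d x * g x) \<in> L2 M" "0 \<le> C \<Longrightarrow> L2_norm M (\<lambda>x. d x * g x) \<le> C * L2_norm M g"
proof -
  have m: "g \<in> borel_measurable M" by (rule L2_measurable[OF g])
  have le: "AE x in M. norm (d x * g x) \<le> C * norm (g x)"
    using d(2) by eventually_elim (auto simp: abs_mult intro: mult_right_mono)
  show dg: "(\<lambda>x. d x * g x) \<in> L2 M"
    by (rule L2_bound[OF g _ le]) (use d(1) m in measurable)
  assume C: "0 \<le> C"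
  have "(\<integral>x. (norm (d x * g x))\<^sup>2 \<partial>M) \<le> (\<integral>x. C\<^sup>2 * (norm (g x))\<^sup>2 \<partial>M)"
  proof (rule integral_mono_AE[OF L2_integrable[OF dg]])
    show "integrable M (\<lambda>x. C\<^sup>2 * (norm (g x))\<^sup>2)" using L2_integrable[OF g] by simp
    show "AE x in M. (norm (d x * g x))\<^sup>2 \<le> C\<^sup>2 * (norm (g x))\<^sup>2"
      using le
    proof eventually_elim
      fix x assume "norm (d x * g x) \<le> C * norm (g x)"
      from power_mono[OF this norm_ge_zero, of 2]
      show "(norm (d x * g x))\<^sup>2 \<le> C\<^sup>2 * (norm (g x))\<^sup>2" by (simp only: power_mult_distrib)
    qed
  qed
  also have "\<dots> = (C * L2_norm M g)\<^sup>2" by (simp only: integral_mult_right_zero L2_norm_sq[symmetric] power_mult_distrib)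
  finally show "L2_norm M (\<lambda>x. d x * g x) \<le> C * L2_norm M g"
    using C by (subst L2_norm_le_iff) auto
qed

lemma L_infty_obtain:
  assumes "d \<in> L_infty M" obtains C where "0 \<le> C" "d \<in> borel_measurable M" "AE x in M. \<bar>d x\<bar> \<le> C"
proof -
  obtain C where "AE x in M. \<bar>d x\<bar> \<le> C" using assms by (auto simp: L_infty_def)
  then have "AE x in M. \<bar>d x\<bar> \<le> max 0 C" by eventually_elim auto
  then show ?thesis using that[of "max 0 C"] assms by (auto simp: L_infty_def)
qed

lemma L2_norm_Om_Htilde:
  assumes \<sigma>: "0 \<le> \<sigma>" "\<sigma> \<le> 1" and u: "u \<in> Htilde \<sigma>"
  shows "L2_norm Om u = L2_norm lborel u"
proof -
  have m [measurable]: "u \<in> borel_measurable borel" using L2_measurable[OF Htilde_L2[OF u]] by simp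
  have "(\<integral>x. (norm (u x))\<^sup>2 \<partial>Om) = (\<integral>x. (norm (u x))\<^sup>2 \<partial>lborel)"
    unfolding Om_integral
  proof (rule integral_cong_AE)
    show "AE x in lborel. indicat_real {0<..<1} x *\<^sub>R (norm (u x))\<^sup>2 = (norm (u x))\<^sup>2"
      using Htilde_support[OF \<sigma> u] by eventually_elim (auto simp: indicator_def)
  qed measurable
  then show ?thesis by (simp add: L2_norm_def)
qed

text \<open>\<open>Gamma\<close> is logarithmically convex and takes the value 1 at 1 and at
  2.\<close>

lemma Gamma_le_one:
  assumes "0 < \<sigma>" "\<sigma> < 1" shows "Gamma (\<sigma> + 1) \<le> (1::real)"
proof -
  have "(ln \<circ> Gamma) ((1 - \<sigma>) *\<^sub>R 1 + \<sigma> *\<^sub>R 2) \<le> (1 - \<sigma>) * (ln \<circ> Gamma) 1 + \<sigma> * (ln \<circ> Gamma) (2::real)"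
    using assms by (intro convex_onD[OF log_convex_Gamma_real]) auto
  moreover have "(1 - \<sigma>) *\<^sub>R 1 + \<sigma> *\<^sub>R 2 = \<sigma> + (1::real)" by simp
  moreover have "Gamma (2::real) = 1" using Gamma_fact[of 1, where 'a = real] by simp
  ultimately have "ln (Gamma (\<sigma> + 1)) \<le> 0" by simp
  moreover have "0 < Gamma (\<sigma> + 1)" using assms by (intro Gamma_real_pos) auto
  ultimately show ?thesis by (simp add: ln_le_zero_iff)
qed

text \<open>The constants are far from sharp, so the elementary Poincare constant \<open>1 - 1 / pi\<close> is enough.\<close>

lemma coercivity_constant:
  fixes G N E :: real
  assumes "0 \<le> G" "G \<le> 1" "0 \<le> N" "(1 - 1 / pi) * N \<le> E"
  shows "G ^ 4 / 8 * (N + E) \<le> E - G\<^sup>2 / 4 * N"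
proof -
  have "1 / pi \<le> 1 / 3" using pi_gt3 by (intro divide_left_mono) auto
  then have "2 / 3 * N \<le> (1 - 1 / pi) * N" using assms(3) by (intro mult_right_mono) auto
  from order_trans[OF this assms(4)] have E: "2 * N \<le> 3 * E" by simp
  then have E0: "0 \<le> N + E" using assms(3) by simp
  have "G ^ 4 \<le> 1" "G\<^sup>2 \<le> 1" using assms(1,2) by (simp_all add: power_le_one)
  then have "G ^ 4 * (N + E) \<le> 1 * (N + E)" "G\<^sup>2 * N \<le> 1 * N"
    using E0 assms(3) by (intro mult_right_mono; simp)+
  then have "G ^ 4 * (N + E) \<le> N + E" "G\<^sup>2 * N \<le> N" by simp_all
  \<comment> \<open>From 2 N \<le> 3 E, the sum X / 8 + Y / 4 is at most (3 N + E) / 8, hence at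
    most 11 E / 16.\<close>
  moreover have "X / 8 \<le> E - Y / 4" if "X \<le> N + E" "Y \<le> N" for X Y
    using that E assms(3) by (simp add: field_simps)
  ultimately have "G ^ 4 * (N + E) / 8 \<le> E - G\<^sup>2 * N / 4" by blast
  then show ?thesis by simp
qed

section \<open>The form, its coercivity and the solution\<close>

locale variational_problem =
  fixes s :: real and d r f :: "real \<Rightarrow> real"
  assumes s: "1 < s" "s < 2"
    and d: "d \<in> L_infty Om" and r: "r \<in> L_infty Om" and f: "f \<in> L2 Om"
    and gamma_pos: "gamma_coeff s d > 0"
    and gamma_r: "gamma_coeff s d * ((Gamma (s / 2 + 1))\<^sup>2 / 4) + ess_inf Om r \<ge> 0"
begin

abbreviation "\<sigma> \<equiv> s / 2"
abbreviation "a \<equiv> bilinear_a s d r"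

lemma \<sigma>: "0 < \<sigma>" "\<sigma> < 1" and \<sigma>_bounds: "0 \<le> \<sigma>" "\<sigma> \<le> 1"
  using s by auto

sublocale semi_hilbert "Htilde \<sigma>" "hs_ip \<sigma>"
  by (rule semi_hilbert_Htilde[OF \<sigma>])

lemma Htilde_Om: "u \<in> Htilde \<sigma> \<Longrightarrow> u \<in> L2 Om"
  by (rule L2_Om(1)[OF Htilde_L2])

lemma d_mult_L2: "g \<in> L2 Om \<Longrightarrow> (\<lambda>x. d x * g x) \<in> L2 Om"
  using L_infty_obtain[OF d] L_infty_mult_L2(1) by metis

lemma r_mult_L2: "g \<in> L2 Om \<Longrightarrow> (\<lambda>x. r x * g x) \<in> L2 Om"
  using L_infty_obtain[OF r] L_infty_mult_L2(1) by metis

lemma a_eq: "a u v = - L2_ip Om (\<lambda>x. d x * D_left \<sigma> u x) (D_right \<sigma> v) + L2_ip Om (\<lambda>x. r x * u x) v"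
  by (simp add: bilinear_a_def L2_inner_eq_ip)

lemma L2_ip_comb_left_real:
  fixes g h k :: "real \<Rightarrow> real"
  assumes "g \<in> L2 Om" "h \<in> L2 Om" "k \<in> L2 Om"
  shows "L2_ip Om (\<lambda>x. g x + c * h x) k = L2_ip Om g k + c * L2_ip Om h k"
    and "L2_ip Om k (\<lambda>x. g x + c * h x) = L2_ip Om k g + c * L2_ip Om k h"
  using L2_ip_comb_left[OF assms, of c] by (simp_all add: L2_ip_commute[of Om k])

lemma a_left:
  assumes "u \<in> Htilde \<sigma>" "v \<in> Htilde \<sigma>" "w \<in> Htilde \<sigma>"
  shows "a (\<lambda>x. u x + c * v x) w = a u w + c * a v w"
proof -
  note D = D_L2[OF \<sigma> assms(1)] D_L2[OF \<sigma> assms(2)] D_L2[OF \<sigma> assms(3)]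
  note Dc = D_L2[OF \<sigma> Htilde_comb(1)[OF \<sigma>_bounds assms(1,2), of c]]
  have "L2_ip Om (\<lambda>x. d x * D_left \<sigma> (\<lambda>x. u x + c * v x) x) (D_right \<sigma> w)
      = L2_ip Om (\<lambda>x. d x * D_left \<sigma> u x + c * (d x * D_left \<sigma> v x)) (D_right \<sigma> w)"
  proof (rule L2_ip_cong_AE)
    show "AE x in Om. d x * D_left \<sigma> (\<lambda>x. u x + c * v x) x = d x * D_left \<sigma> u x + c * (d x * D_left \<sigma> v x)"
      using D_comb(1)[OF \<sigma> assms(1,2), of c] by eventually_elim (simp add: algebra_simps)
  qed (simp_all add: L2_measurable d_mult_L2 L2_comb_real D Dc)
  also have "\<dots> = L2_ip Om (\<lambda>x. d x * D_left \<sigma> u x) (D_right \<sigma> w) + c * L2_ip Om (\<lambda>x. d x * D_left \<sigma> v x) (D_right \<sigma> w)"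
    by (intro L2_ip_comb_left_real d_mult_L2 D)
  finally have 1: "L2_ip Om (\<lambda>x. d x * D_left \<sigma> (\<lambda>x. u x + c * v x) x) (D_right \<sigma> w) = \<dots>" .
  have "(\<lambda>x. r x * (u x + c * v x)) = (\<lambda>x. r x * u x + c * (r x * v x))" by (auto simp: algebra_simps)
  then have "L2_ip Om (\<lambda>x. r x * (u x + c * v x)) w = L2_ip Om (\<lambda>x. r x * u x + c * (r x * v x)) w" by simp
  also have "\<dots> = L2_ip Om (\<lambda>x. r x * u x) w + c * L2_ip Om (\<lambda>x. r x * v x) w"
    by (intro L2_ip_comb_left_real r_mult_L2 Htilde_Om assms)
  finally show ?thesis unfolding a_eq 1 by (simp add: algebra_simps)
qed

lemma a_right:
  assumes "u \<in> Htilde \<sigma>" "v \<in> Htilde \<sigma>" "w \<in> Htilde \<sigma>"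
  shows "a w (\<lambda>x. u x + c * v x) = a w u + c * a w v"
proof -
  note D = D_L2[OF \<sigma> assms(1)] D_L2[OF \<sigma> assms(2)] D_L2[OF \<sigma> assms(3)]
  note Dc = D_L2[OF \<sigma> Htilde_comb(1)[OF \<sigma>_bounds assms(1,2), of c]]
  have "L2_ip Om (\<lambda>x. d x * D_left \<sigma> w x) (D_right \<sigma> (\<lambda>x. u x + c * v x))
      = L2_ip Om (\<lambda>x. d x * D_left \<sigma> w x) (\<lambda>x. D_right \<sigma> u x + c * D_right \<sigma> v x)"
    using D_comb(2)[OF \<sigma> assms(1,2), of c]
    by (intro L2_ip_cong_AE) (simp_all add: L2_measurable d_mult_L2 L2_comb_real D Dc)
  also have "\<dots> = L2_ip Om (\<lambda>x. d x * D_left \<sigma> w x) (D_right \<sigma> u) + c * L2_ip Om (\<lambda>x. d x * D_left \<sigma> w x) (D_right \<sigma> v)"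
    by (intro L2_ip_comb_left_real d_mult_L2 D)
  finally have 1: "L2_ip Om (\<lambda>x. d x * D_left \<sigma> w x) (D_right \<sigma> (\<lambda>x. u x + c * v x)) = \<dots>" .
  have "L2_ip Om (\<lambda>x. r x * w x) (\<lambda>x. u x + c * v x) = L2_ip Om (\<lambda>x. r x * w x) u + c * L2_ip Om (\<lambda>x. r x * w x) v"
    by (intro L2_ip_comb_left_real r_mult_L2 Htilde_Om assms)
  then show ?thesis unfolding a_eq 1 by (simp add: algebra_simps)
qed

lemma a_bounded: "\<exists>K. \<forall>u\<in>Htilde \<sigma>. \<forall>v\<in>Htilde \<sigma>. \<bar>a u v\<bar> \<le> K * Hs_norm \<sigma> u * Hs_norm \<sigma> v"
proof -
  obtain C where C: "0 \<le> C" "d \<in> borel_measurable Om" "AE x in Om. \<bar>d x\<bar> \<le> C" using L_infty_obtain[OF d] .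
  obtain C' where C': "0 \<le> C'" "r \<in> borel_measurable Om" "AE x in Om. \<bar>r x\<bar> \<le> C'" using L_infty_obtain[OF r] .
  have "\<bar>a u v\<bar> \<le> (C + C') * Hs_norm \<sigma> u * Hs_norm \<sigma> v" if uv: "u \<in> Htilde \<sigma>" "v \<in> Htilde \<sigma>" for u v
  proof -
    note D = D_L2[OF \<sigma> uv(1)] D_L2[OF \<sigma> uv(2)]
    note H = Htilde_Hs[OF uv(1)] Htilde_Hs[OF uv(2)]
    have Dl: "L2_norm Om (D_left \<sigma> u) \<le> Hs_norm \<sigma> u" and Dr: "L2_norm Om (D_right \<sigma> v) \<le> Hs_norm \<sigma> v"
      using D_bounds(1)[OF \<sigma> uv(1)] D_bounds(2)[OF \<sigma> uv(2)] en_rep_norm_le[OF \<sigma>_bounds(1) H(1)] en_rep_norm_le[OF \<sigma>_bounds(1) H(2)]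
      by simp_all
    have nu: "L2_norm Om u \<le> Hs_norm \<sigma> u" and nv: "L2_norm Om v \<le> Hs_norm \<sigma> v"
      using L2_norm_le_Hs_norm[OF \<sigma>_bounds(1) H(1)] L2_norm_le_Hs_norm[OF \<sigma>_bounds(1) H(2)]
      by (simp_all add: L2_norm_Om_Htilde[OF \<sigma>_bounds] uv)
    have "\<bar>L2_ip Om (\<lambda>x. d x * D_left \<sigma> u x) (D_right \<sigma> v)\<bar> \<le> L2_norm Om (\<lambda>x. d x * D_left \<sigma> u x) * L2_norm Om (D_right \<sigma> v)"
      by (intro L2_Cauchy_Schwarz d_mult_L2 D)
    also have "\<dots> \<le> (C * Hs_norm \<sigma> u) * Hs_norm \<sigma> v"
      using order_trans[OF L_infty_mult_L2(2)[OF C(2,3) D(1) C(1)] mult_left_mono[OF Dl C(1)]] C(1)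
      by (intro mult_mono Dr) auto
    finally have 1: "\<bar>L2_ip Om (\<lambda>x. d x * D_left \<sigma> u x) (D_right \<sigma> v)\<bar> \<le> C * Hs_norm \<sigma> u * Hs_norm \<sigma> v" .
    have "\<bar>L2_ip Om (\<lambda>x. r x * u x) v\<bar> \<le> L2_norm Om (\<lambda>x. r x * u x) * L2_norm Om v"
      by (intro L2_Cauchy_Schwarz r_mult_L2 Htilde_Om uv)
    also have "\<dots> \<le> (C' * Hs_norm \<sigma> u) * Hs_norm \<sigma> v"
      using order_trans[OF L_infty_mult_L2(2)[OF C'(2,3) Htilde_Om[OF uv(1)] C'(1)] mult_left_mono[OF nu C'(1)]] C'(1)
      by (intro mult_mono nv) auto
    finally have "\<bar>L2_ip Om (\<lambda>x. r x * u x) v\<bar> \<le> C' * Hs_norm \<sigma> u * Hs_norm \<sigma> v" .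
    with 1 show ?thesis unfolding a_eq by (simp add: distrib_right)
  qed
  then show ?thesis by blast
qed

text \<open>\<open>mu d\<close> and \<open>rho d\<close> are the midpoint and the half-length of the
  essential range of \<open>d\<close>. A negative \<open>rho d\<close> would make the interval a
  null set.\<close>

lemma d_deviation: "AE x in Om. \<bar>d x - mu d\<bar> \<le> rho d" "0 \<le> rho d"
proof -
  show *: "AE x in Om. \<bar>d x - mu d\<bar> \<le> rho d"
    using AE_le_ess_sup[OF d] AE_ess_inf_le[OF d]
    by eventually_elim (auto simp: mu_def rho_def abs_le_iff field_simps)
  show "0 \<le> rho d"
  proof (rule ccontr)
    assume "\<not> 0 \<le> rho d"
    then have "\<not> \<bar>y\<bar> \<le> rho d" for y by auto
    with * have "AE x in Om. False" by simp
    then have "ae_filter Om = bot" by (simp add: trivial_limit_def)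
    then show False using Om_not_null ae_filter_eq_bot_iff[of Om] by simp
  qed
qed

text \<open>s pi / 2 lies between pi / 2 and pi. The minus sign in \<open>bilinear_a\<close> thus
  turns the main term into a positive multiple of the energy.\<close>

lemma cos_neg: "cos (pi * \<sigma>) = - \<bar>cos (s * (pi / 2))\<bar>"
proof -
  have eq: "pi * \<sigma> = s * (pi / 2)" by simp
  have "0 < cos (pi - s * (pi / 2))"
    using s pi_gt_zero by (intro cos_gt_zero_pi) (auto simp: field_simps)
  then have "cos (s * (pi / 2)) < 0" by (simp add: cos_diff)
  then show ?thesis unfolding eq by simp
qed

lemma coercive:
  assumes u: "u \<in> Htilde \<sigma>"
  shows "alpha_coeff s d * (Hs_norm \<sigma> u)\<^sup>2 \<le> a u u"
proof -
  let ?E = "(L2_norm lborel (en_rep \<sigma> u))\<^sup>2" and ?N = "(L2_norm lborel u)\<^sup>2"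
  let ?G = "Gamma (\<sigma> + 1)" and ?g = "gamma_coeff s d"
  let ?Dl = "D_left \<sigma> u" and ?Dr = "D_right \<sigma> u"
  note D = D_L2[OF \<sigma> u] and B = D_bounds[OF \<sigma> u]
  have dm: "(\<lambda>x. d x - mu d) \<in> borel_measurable Om" using d by (auto simp: L_infty_def)
  note dL = L_infty_mult_L2[OF dm d_deviation(1) D(1)]
  have "L2_ip Om (\<lambda>x. d x * ?Dl x) ?Dr = L2_ip Om (\<lambda>x. (d x - mu d) * ?Dl x + mu d * ?Dl x) ?Dr"
    by (simp add: algebra_simps)
  also have "\<dots> = L2_ip Om (\<lambda>x. (d x - mu d) * ?Dl x) ?Dr + mu d * L2_ip Om ?Dl ?Dr"
    by (rule L2_ip_comb_left_real[OF dL(1) D])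
  also have "L2_ip Om ?Dl ?Dr = - \<bar>cos (s * (pi / 2))\<bar> * ?E" unfolding B(3) cos_neg ..
  finally have 1: "L2_ip Om (\<lambda>x. d x * ?Dl x) ?Dr = L2_ip Om (\<lambda>x. (d x - mu d) * ?Dl x) ?Dr - mu d * \<bar>cos (s * (pi / 2))\<bar> * ?E"
    by simp
  have "\<bar>L2_ip Om (\<lambda>x. (d x - mu d) * ?Dl x) ?Dr\<bar> \<le> L2_norm Om (\<lambda>x. (d x - mu d) * ?Dl x) * L2_norm Om ?Dr"
    by (rule L2_Cauchy_Schwarz[OF dL(1) D(2)])
  also have "\<dots> \<le> (rho d * L2_norm lborel (en_rep \<sigma> u)) * L2_norm lborel (en_rep \<sigma> u)"
    using order_trans[OF dL(2)[OF d_deviation(2)] mult_left_mono[OF B(1) d_deviation(2)]] d_deviation(2)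
    by (intro mult_mono B(2)) auto
  finally have 2: "\<bar>L2_ip Om (\<lambda>x. (d x - mu d) * ?Dl x) ?Dr\<bar> \<le> rho d * ?E" by (simp add: power2_eq_square)
  have uO: "u \<in> L2 Om" by (rule Htilde_Om[OF u])
  have "ess_inf Om r * ?N = (\<integral>x. ess_inf Om r * (norm (u x))\<^sup>2 \<partial>Om)"
    unfolding L2_norm_Om_Htilde[OF \<sigma>_bounds u, symmetric] L2_norm_sq by simp
  also have "\<dots> \<le> (\<integral>x. inner (r x * u x) (u x) \<partial>Om)"
  proof (rule integral_mono_AE)
    show "AE x in Om. ess_inf Om r * (norm (u x))\<^sup>2 \<le> inner (r x * u x) (u x)"
      using AE_ess_inf_le[OF r]
    proof eventually_elim
      fix x assume "ess_inf Om r \<le> r x"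
      from mult_right_mono[OF this, of "(u x)\<^sup>2"] show "ess_inf Om r * (norm (u x))\<^sup>2 \<le> inner (r x * u x) (u x)"
        by (simp add: power2_eq_square mult.assoc)
    qed
  qed (use L2_integrable[OF uO] L2_ip_integrable[OF r_mult_L2[OF uO] uO] in auto)
  finally have 3: "ess_inf Om r * ?N \<le> L2_ip Om (\<lambda>x. r x * u x) u" by (simp only: L2_ip_def)
  \<comment> \<open>The assumption on the coefficients limits how negative the zeroth order term can
    be; what remains has to be absorbed by the energy through the Poincare inequality.\<close>
  have "- (?g * (?G\<^sup>2 / 4)) * ?N \<le> ess_inf Om r * ?N"
    using gamma_r by (intro mult_right_mono) auto
  then have "?g * ?E - ?g * (?G\<^sup>2 / 4) * ?N \<le> a u u"
    using 1 2 3 unfolding a_eq gamma_coeff_def by (simp add: algebra_simps abs_le_iff)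
  then have 4: "?g * (?E - ?G\<^sup>2 / 4 * ?N) \<le> a u u" by (simp add: algebra_simps)
  have G: "0 \<le> ?G" "?G \<le> 1" using Gamma_real_nonneg[of "\<sigma> + 1"] Gamma_le_one[OF \<sigma>] \<sigma> by auto
  have P: "(1 - 1 / pi) * ?N \<le> ?E"
    using Poincare_fourier[OF \<sigma>_bounds(1) Htilde_Hs[OF u] Htilde_support[OF \<sigma>_bounds u]] by (simp only: energy_eq)
  have "(Hs_norm \<sigma> u)\<^sup>2 \<le> ?N + ?E"
    using Hs_norm_le_energy[OF \<sigma>(1) \<sigma>_bounds(2) Htilde_Hs[OF u]] by (simp only: energy_eq)
  then have "?G ^ 4 / 8 * (Hs_norm \<sigma> u)\<^sup>2 \<le> ?G ^ 4 / 8 * (?N + ?E)"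
    using G(1) by (intro mult_left_mono) auto
  also have "\<dots> \<le> ?E - ?G\<^sup>2 / 4 * ?N" by (rule coercivity_constant[OF G _ P]) simp
  finally have "?g * (?G ^ 4 / 8 * (Hs_norm \<sigma> u)\<^sup>2) \<le> ?g * (?E - ?G\<^sup>2 / 4 * ?N)"
    using gamma_pos by (intro mult_left_mono) auto
  with 4 show ?thesis by (simp only: alpha_coeff_def mult.assoc)
qed

lemma alpha_pos: "0 < alpha_coeff s d"
proof -
  have "0 < Gamma (\<sigma> + 1)" using \<sigma> by (intro Gamma_real_pos) simp
  then show ?thesis using gamma_pos by (simp add: alpha_coeff_def)
qed

lemma load_bounded:
  assumes "v \<in> Htilde \<sigma>" shows "\<bar>L2_inner Om f v\<bar> \<le> L2_norm Om f * Hs_norm \<sigma> v"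
proof -
  have "\<bar>L2_inner Om f v\<bar> \<le> L2_norm Om f * L2_norm Om v"
    unfolding L2_inner_eq_ip by (rule L2_Cauchy_Schwarz[OF f Htilde_Om[OF assms]])
  also have "\<dots> \<le> L2_norm Om f * Hs_norm \<sigma> v"
    using L2_norm_le_Hs_norm[OF \<sigma>_bounds(1) Htilde_Hs[OF assms]] L2_norm_Om_Htilde[OF \<sigma>_bounds assms]
    by (intro mult_left_mono) auto
  finally show ?thesis .
qed

lemma solution_exists: "\<exists>u\<in>Htilde \<sigma>. \<forall>v\<in>Htilde \<sigma>. a u v = L2_inner Om f v"
proof -
  have sq: "sqrt (hs_ip \<sigma> u u) = Hs_norm \<sigma> u" for u by (simp add: hs_ip_self)
  obtain K where K: "\<And>u v. u \<in> Htilde \<sigma> \<Longrightarrow> v \<in> Htilde \<sigma> \<Longrightarrow> \<bar>a u v\<bar> \<le> K * Hs_norm \<sigma> u * Hs_norm \<sigma> v"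
    using a_bounded by blast
  show ?thesis
  proof (rule Lax_Milgram[where K = K and \<alpha> = "alpha_coeff s d" and C = "L2_norm Om f"])
    show "L2_inner Om f (\<lambda>x. u x + c * v x) = L2_inner Om f u + c * L2_inner Om f v"
      if "u \<in> Htilde \<sigma>" "v \<in> Htilde \<sigma>" for u v c
      unfolding L2_inner_eq_ip by (rule L2_ip_comb_left_real(2)[OF Htilde_Om[OF that(1)] Htilde_Om[OF that(2)] f])
  qed (use a_left a_right K coercive alpha_pos load_bounded in \<open>simp_all add: sq hs_ip_self\<close>)
qed

text \<open>Coercivity makes the Sobolev norm of the difference 0, which determines the function up
  to a null set.\<close>

lemma solution_unique:
  assumes u: "u \<in> Htilde \<sigma>" "\<forall>v\<in>Htilde \<sigma>. a u v = L2_inner Om f v"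
    and w: "w \<in> Htilde \<sigma>" "\<forall>v\<in>Htilde \<sigma>. a w v = L2_inner Om f v"
  shows "AE x in lborel. w x = u x"
proof -
  let ?z = "\<lambda>x. w x - u x"
  have z: "?z \<in> Htilde \<sigma>" by (rule diff_closed[OF w(1) u(1)])
  have "a ?z ?z = 0" using a_left[OF w(1) u(1) z, of "-1"] u(2) w(2) z by simp
  then have "alpha_coeff s d * (Hs_norm \<sigma> ?z)\<^sup>2 \<le> 0" using coercive[OF z] by simp
  then have "(Hs_norm \<sigma> ?z)\<^sup>2 \<le> 0" using alpha_pos by (simp add: mult_le_0_iff)
  then have "Hs_norm \<sigma> ?z = 0" by simp
  then have "L2_norm lborel ?z = 0"
    using L2_norm_le_Hs_norm[OF \<sigma>_bounds(1) Htilde_Hs[OF z]] by (simp add: order_antisym)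
  from L2_norm_zero_AE[OF Htilde_L2[OF z] this] show ?thesis by simp
qed

text \<open>The equation is tested with the solution itself and one factor of its norm is cancelled;
  a norm equal to 0 is treated apart for this division.\<close>

lemma solution_bound:
  assumes u: "u \<in> Htilde \<sigma>" "\<forall>v\<in>Htilde \<sigma>. a u v = L2_inner Om f v"
  shows "Hs_norm \<sigma> u \<le> 1 / alpha_coeff s d * L2_norm Om f"
proof (cases "Hs_norm \<sigma> u = 0")
  case True
  then show ?thesis using alpha_pos by simp
next
  case False
  then have p: "0 < Hs_norm \<sigma> u" by (simp add: order_less_le)
  have "(alpha_coeff s d * Hs_norm \<sigma> u) * Hs_norm \<sigma> u \<le> L2_norm Om f * Hs_norm \<sigma> u"
    using coercive[OF u(1)] load_bounded[OF u(1)] u by (simp add: power2_eq_square mult.assoc)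
  then have "alpha_coeff s d * Hs_norm \<sigma> u \<le> L2_norm Om f" using p by (simp only: mult_le_cancel_right_pos)
  then show ?thesis using alpha_pos by (simp add: field_simps)
qed

end

theorem theorem3p6:
  fixes s d\<^sub>0 :: real and d r f :: "real \<Rightarrow> real"
  assumes "1 < s" and "s < 2"
    and "d \<in> L_infty Om" and "d\<^sub>0 > 0" and "AE x in Om. d x \<ge> d\<^sub>0"
    and "r \<in> L_infty Om"
    and "f \<in> L2 Om"
    and "gamma_coeff s d > 0"
    and "gamma_coeff s d * ((Gamma (s / 2 + 1))\<^sup>2 / 4) + ess_inf Om r \<ge> 0"
  shows "(\<forall>u\<in>Htilde (s / 2).
            bilinear_a s d r u u \<ge> alpha_coeff s d * (Hs_norm (s / 2) u)\<^sup>2) \<and>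
         (\<exists>u\<in>Htilde (s / 2).
            (\<forall>v\<in>Htilde (s / 2). bilinear_a s d r u v = L2_inner Om f v) \<and>
            (\<forall>w\<in>Htilde (s / 2). (\<forall>v\<in>Htilde (s / 2). bilinear_a s d r w v = L2_inner Om f v)
               \<longrightarrow> (AE x in lborel. w x = u x)) \<and>
            Hs_norm (s / 2) u \<le> 1 / alpha_coeff s d * L2_norm Om f)"
proof -
  interpret variational_problem s d r f
    by unfold_locales (use assms in auto)
  obtain u where u: "u \<in> Htilde (s / 2)" "\<forall>v\<in>Htilde (s / 2). bilinear_a s d r u v = L2_inner Om f v"
    using solution_exists by blast
  show ?thesis
    using coercive u solution_unique[OF u] solution_bound[OF u] by blast
qed

end
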